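(* Let $\mathcal{R}$ be a full subcategory of the category $\mathbf{Reg}$ of regular rings and ring homomorphisms and let $\lambda$ be an infinite cardinal. Assume the following: (i) $\mathcal{R}$ is closed under small directed colimits and homomorphic images. (ii) Every $\lambda$-small subset $X$ of a member $R$ of $\mathcal{R}$ is contained in some $\lambda$-small member of $\mathcal{R}$ contained in $R$ (as a subring). Denote by $\mathbf{SCML}^{\twoheadrightarrow}$ the subcategory of $\mathbf{SCML}$ with the same objects and whose arrows are the surjective $0$-lattice homomorphisms. Then the 6-uple $$(\mathcal{R},\mathcal{R}^{(\lambda)},\mathbf{SCML},\mathbf{SCML}^{(\lambda)},\mathbf{SCML}^{\twoheadrightarrow},\mathbb{L})$$ is a projectable right $\lambda$-larder.
   Context: A set is $\lambda$-small if its cardinality is $<\lambda$. For a class $\mathcal{C}$ of structures, $\mathcal{C}^{(\lambda)}$ is the full subcategory of members with $\lambda$-small universe. Rings are associative, not necessarily unital; ring homomorphisms need not preserve units. $R$ is regular if for each $a\in R$ there is $b\in R$ with $aba=a$. $\mathbf{SCML}$ is the category of sectionally complemented modular lattices (lattices with $0$ in which for $x\le y$ there is $z$ with $x\vee z=y$, $x\wedge z=0$) and $0$-preserving lattice homomorphisms. $\mathbb{L}\colon\mathbf{Reg}\to\mathbf{SCML}$ sends $R$ to the lattice $\mathbb{L}(R)=\{xR\mid x\in R\}$ of principal right ideals and $f\colon R\to S$ to $\mathbb{L}(f)\colon xR\mapsto f(x)S$. **Right larders.** Let $\mathcal{B},\mathcal{S}$ be categories, $\mathcal{B}^\dagger\subseteq\mathcal{B}$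 and $\mathcal{S}^\dagger\subseteq\mathcal{S}$ full subcategories, $\mathcal{S}^{\Rightarrow}$ a subcategory of $\mathcal{S}$ (its arrows are called double arrows, written $\Rightarrow$), $\Psi\colon\mathcal{B}\to\mathcal{S}$ a functor. The 6-uple $(\mathcal{B},\mathcal{B}^\dagger,\mathcal{S},\mathcal{S}^\dagger,\mathcal{S}^{\Rightarrow},\Psi)$ is a *right $\lambda$-larder* if: (1) $\Psi(C)$ is weakly $\lambda$-presented in $\mathcal{S}$ for each $C\in\mathcal{B}^\dagger$; (2) for every object $B$ of $\mathcal{B}$, each $S\in\mathcal{S}^\dagger$, each double arrow $\psi\colon\Psi(B)\Rightarrow S$, each $\mathrm{cf}(\lambda)$-small set $I$ and each family $(\gamma_i\colon C_i\rightarrowtail B\mid i\in I)$ of monomorphisms of $\mathcal{B}$ with all $C_i\in\mathcal{B}^\dagger$, there is a monomorphism $\gamma\colon C\rightarrowtail B$ with $C\in\mathcal{B}^\dagger$ such that each $\gamma_i$ factors through $\gamma$ and $\psi\circ\Psi(\gamma)$ is a double arrow. It is *projectable* if every double arrow $\varphi\colon\Psi(C)\Rightarrow S$ ($C\in\mathcal{B}$, $S\in\mathcal{S}$) has a *projectability witness*: a pair $(a,\varepsilon)$ with $a\colon C\to\overline{C}$ an epimorphism in $\mathcal{B}$, $\varepsilon\colon\Psi(\overline{C})\to S$ an isomorphism, $\varphi=\varepsilon\circ\Psi(a)$, and such that for every $f\colon C\to Y$ in $\mathcal{B}$ and $\eta\colon\Psi(\overline{C})\to\Psi(Y)$ with $\Psi(f)=\eta\circ\Psi(a)$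 there is $g\colon\overline{C}\to Y$ with $f=g\circ a$ and $\eta=\Psi(g)$. An object $A$ of a category $\mathcal{C}$ is *weakly $\lambda$-presented* if for every set $\Omega$ and every colimit $B=\varinjlim_{Z\in[\Omega]^{<\lambda}}B_Z$ in $\mathcal{C}$ of a continuous diagram (preserving all existing directed suprema of $[\Omega]^{<\lambda}$ as colimits), every morphism $A\to B$ factors through some limiting morphism $B_Z\to B$; $[\Omega]^{<\lambda}$ is the poset of $\lambda$-small subsets of $\Omega$. *)

theory Defs
  imports "HOL-Algebra.Ring"
begin

unbundle cardinal_syntax

section \<open>Categories\<close>

record ('o, 'm) category =
  Obj :: "'o set"
  Arr :: "'m set"
  Dom :: "'m \<Rightarrow> 'o"
  Cod :: "'m \<Rightarrow> 'o"
  Ident :: "'o \<Rightarrow> 'm"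
  Comp :: "'m \<Rightarrow> 'm \<Rightarrow> 'm"  (infixr "\<bullet>\<index>" 70)

definition Hom :: "('o, 'm) category \<Rightarrow> 'o \<Rightarrow> 'o \<Rightarrow> 'm set" where
  "Hom C A B = {f \<in> Arr C. Dom C f = A \<and> Cod C f = B}"

locale category =
  fixes C :: "('o, 'm) category" (structure)
  assumes Dom_in: "f \<in> Arr C \<Longrightarrow> Dom C f \<in> Obj C"
    and Cod_in: "f \<in> Arr C \<Longrightarrow> Cod C f \<in> Obj C"
    and Ident_in: "A \<in> Obj C \<Longrightarrow> Ident C A \<in> Hom C A A"
    and Comp_in: "\<lbrakk>f \<in> Hom C A B; g \<in> Hom C B D\<rbrakk> \<Longrightarrow> g \<bullet> f \<in> Hom C A D"
    and Ident_left: "f \<in> Hom C A B \<Longrightarrow> Ident C B \<bullet> f = f"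
    and Ident_right: "f \<in> Hom C A B \<Longrightarrow> f \<bullet> Ident C A = f"
    and Comp_assoc: "\<lbrakk>f \<in> Hom C A B; g \<in> Hom C B D; h \<in> Hom C D E\<rbrakk>
                      \<Longrightarrow> (h \<bullet> g) \<bullet> f = h \<bullet> (g \<bullet> f)"

definition subcategory :: "('o, 'm) category \<Rightarrow> ('o, 'm) category \<Rightarrow> bool" where
  "subcategory D C \<longleftrightarrow> category D \<and> category C \<and> Obj D \<subseteq> Obj C
     \<and> (\<forall>A\<in>Obj D. \<forall>B\<in>Obj D. Hom D A B \<subseteq> Hom C A B)
     \<and> (\<forall>A\<in>Obj D. Ident D A = Ident C A)
     \<and> (\<forall>f\<in>Arr D. \<forall>g\<in>Arr D. Cod D f = Dom D g \<longrightarrow> g \<bullet>\<^bsub>D\<^esub> f = g \<bullet>\<^bsub>C\<^esub> f)"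

definition full_subcategory :: "('o, 'm) category \<Rightarrow> ('o, 'm) category \<Rightarrow> bool" where
  "full_subcategory D C \<longleftrightarrow>
     subcategory D C \<and> (\<forall>A\<in>Obj D. \<forall>B\<in>Obj D. Hom D A B = Hom C A B)"

definition full_subcategory_on :: "('o, 'm) category \<Rightarrow> 'o set \<Rightarrow> ('o, 'm) category" where
  "full_subcategory_on C X =
     C\<lparr>Obj := Obj C \<inter> X, Arr := {f \<in> Arr C. Dom C f \<in> X \<and> Cod C f \<in> X}\<rparr>"

definition monomorphism :: "('o, 'm) category \<Rightarrow> 'm \<Rightarrow> bool" where
  "monomorphism C f \<longleftrightarrow> f \<in> Arr C \<and>
     (\<forall>X\<in>Obj C. \<forall>g \<in> Hom C X (Dom C f). \<forall>h \<in> Hom C X (Dom C f).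
        f \<bullet>\<^bsub>C\<^esub> g = f \<bullet>\<^bsub>C\<^esub> h \<longrightarrow> g = h)"

definition epimorphism :: "('o, 'm) category \<Rightarrow> 'm \<Rightarrow> bool" where
  "epimorphism C f \<longleftrightarrow> f \<in> Arr C \<and>
     (\<forall>X\<in>Obj C. \<forall>g \<in> Hom C (Cod C f) X. \<forall>h \<in> Hom C (Cod C f) X.
        g \<bullet>\<^bsub>C\<^esub> f = h \<bullet>\<^bsub>C\<^esub> f \<longrightarrow> g = h)"

definition isomorphism :: "('o, 'm) category \<Rightarrow> 'm \<Rightarrow> bool" where
  "isomorphism C f \<longleftrightarrow> f \<in> Arr C \<and>
     (\<exists>g \<in> Hom C (Cod C f) (Dom C f).
        g \<bullet>\<^bsub>C\<^esub> f = Ident C (Dom C f) \<and> f \<bullet>\<^bsub>C\<^esub> g = Ident C (Cod C f))"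

record ('o, 'm, 'p, 'n) funct =
  FObj :: "'o \<Rightarrow> 'p"
  FArr :: "'m \<Rightarrow> 'n"

definition is_functor ::
  "('o, 'm) category \<Rightarrow> ('p, 'n) category \<Rightarrow> ('o, 'm, 'p, 'n) funct \<Rightarrow> bool" where
  "is_functor C D F \<longleftrightarrow> category C \<and> category D
     \<and> (\<forall>A\<in>Obj C. FObj F A \<in> Obj D)
     \<and> (\<forall>f\<in>Arr C. FArr F f \<in> Hom D (FObj F (Dom C f)) (FObj F (Cod C f)))
     \<and> (\<forall>A\<in>Obj C. FArr F (Ident C A) = Ident D (FObj F A))
     \<and> (\<forall>f\<in>Arr C. \<forall>g\<in>Arr C. Cod C f = Dom C g \<longrightarrow>
          FArr F (g \<bullet>\<^bsub>C\<^esub> f) = FArr F g \<bullet>\<^bsub>D\<^esub> FArr F f)"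


section \<open>Poset-indexed diagrams and their colimits\<close>

definition poset_on :: "'p set \<Rightarrow> ('p \<Rightarrow> 'p \<Rightarrow> bool) \<Rightarrow> bool" where
  "poset_on P leq \<longleftrightarrow> (\<forall>p\<in>P. leq p p)
     \<and> (\<forall>p\<in>P. \<forall>q\<in>P. leq p q \<and> leq q p \<longrightarrow> p = q)
     \<and> (\<forall>p\<in>P. \<forall>q\<in>P. \<forall>r\<in>P. leq p q \<and> leq q r \<longrightarrow> leq p r)"

definition directed_on :: "'p set \<Rightarrow> ('p \<Rightarrow> 'p \<Rightarrow> bool) \<Rightarrow> bool" where
  "directed_on X leq \<longleftrightarrow> X \<noteq> {} \<and> (\<forall>x\<in>X. \<forall>y\<in>X. \<exists>z\<in>X. leq x z \<and> leq y z)"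

definition is_lub_in :: "'p set \<Rightarrow> ('p \<Rightarrow> 'p \<Rightarrow> bool) \<Rightarrow> 'p set \<Rightarrow> 'p \<Rightarrow> bool" where
  "is_lub_in P leq X s \<longleftrightarrow> s \<in> P \<and> (\<forall>x\<in>X. leq x s)
     \<and> (\<forall>u\<in>P. (\<forall>x\<in>X. leq x u) \<longrightarrow> leq s u)"

definition poset_diagram ::
  "('o, 'm) category \<Rightarrow> 'p set \<Rightarrow> ('p \<Rightarrow> 'p \<Rightarrow> bool) \<Rightarrow> ('p \<Rightarrow> 'o) \<Rightarrow> ('p \<Rightarrow> 'p \<Rightarrow> 'm) \<Rightarrow> bool" where
  "poset_diagram C P leq D d \<longleftrightarrow> poset_on P leq
     \<and> (\<forall>p\<in>P. D p \<in> Obj C)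
     \<and> (\<forall>p\<in>P. \<forall>q\<in>P. leq p q \<longrightarrow> d p q \<in> Hom C (D p) (D q))
     \<and> (\<forall>p\<in>P. d p p = Ident C (D p))
     \<and> (\<forall>p\<in>P. \<forall>q\<in>P. \<forall>r\<in>P. leq p q \<and> leq q r \<longrightarrow> d p r = d q r \<bullet>\<^bsub>C\<^esub> d p q)"

definition is_cocone ::
  "('o, 'm) category \<Rightarrow> 'p set \<Rightarrow> ('p \<Rightarrow> 'p \<Rightarrow> bool) \<Rightarrow> ('p \<Rightarrow> 'o) \<Rightarrow> ('p \<Rightarrow> 'p \<Rightarrow> 'm)
     \<Rightarrow> 'o \<Rightarrow> ('p \<Rightarrow> 'm) \<Rightarrow> bool" where
  "is_cocone C P leq D d B b \<longleftrightarrow> B \<in> Obj C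
     \<and> (\<forall>p\<in>P. b p \<in> Hom C (D p) B)
     \<and> (\<forall>p\<in>P. \<forall>q\<in>P. leq p q \<longrightarrow> b q \<bullet>\<^bsub>C\<^esub> d p q = b p)"

definition is_colimit ::
  "('o, 'm) category \<Rightarrow> 'p set \<Rightarrow> ('p \<Rightarrow> 'p \<Rightarrow> bool) \<Rightarrow> ('p \<Rightarrow> 'o) \<Rightarrow> ('p \<Rightarrow> 'p \<Rightarrow> 'm)
     \<Rightarrow> 'o \<Rightarrow> ('p \<Rightarrow> 'm) \<Rightarrow> bool" where
  "is_colimit C P leq D d B b \<longleftrightarrow> is_cocone C P leq D d B b
     \<and> (\<forall>B' b'. is_cocone C P leq D d B' b' \<longrightarrow>
          (\<exists>!h. h \<in> Hom C B B' \<and> (\<forall>p\<in>P. h \<bullet>\<^bsub>C\<^esub> b p = b' p)))"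

definition continuous_diagram ::
  "('o, 'm) category \<Rightarrow> 'p set \<Rightarrow> ('p \<Rightarrow> 'p \<Rightarrow> bool) \<Rightarrow> ('p \<Rightarrow> 'o) \<Rightarrow> ('p \<Rightarrow> 'p \<Rightarrow> 'm) \<Rightarrow> bool" where
  "continuous_diagram C P leq D d \<longleftrightarrow> poset_diagram C P leq D d
     \<and> (\<forall>X s. X \<subseteq> P \<and> directed_on X leq \<and> is_lub_in P leq X s \<longrightarrow>
          is_colimit C X leq D d (D s) (\<lambda>x. d x s))"


section \<open>Smallness\<close>

text \<open>
  The universe of sets is played by a type \<open>'u\<close>, ``small'' meaning ``of cardinality less than that
  of \<open>'u\<close>''; every small set is equipotent to a subset of \<open>'u\<close>. The parameter
  \<open>\<kappa> :: 'u rel\<close> below stands for the cardinal \<open>|UNIV :: 'u set|\<close>: index sets are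
  subsets of \<open>'u\<close> of cardinality less than \<open>\<kappa>\<close>, and structures have carriers of
  cardinality less than \<open>\<kappa>\<close>. If \<open>\<kappa>\<close> is strongly inaccessible, this is
  the usual interpretation in a Grothendieck universe.
\<close>

definition small_subsets :: "'l rel \<Rightarrow> 'u set \<Rightarrow> 'u set set" where
  "small_subsets lam W = {Z. Z \<subseteq> W \<and> |Z| <o lam}"

definition cofinality :: "'l rel \<Rightarrow> 'l rel" where
  "cofinality lam = |SOME K. K \<subseteq> Field lam \<and> cofinal K lam
     \<and> (\<forall>K'. K' \<subseteq> Field lam \<and> cofinal K' lam \<longrightarrow> |K| \<le>o |K'| )|"

definition weakly_presented ::
  "'u rel \<Rightarrow> 'l rel \<Rightarrow> ('o, 'm) category \<Rightarrow> 'o \<Rightarrow> bool" where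
  "weakly_presented \<kappa> lam C A \<longleftrightarrow> A \<in> Obj C \<and>
     (\<forall>(W :: 'u set) D d B b f.
        |W| <o \<kappa>
        \<and> continuous_diagram C (small_subsets lam W) (\<subseteq>) D d
        \<and> is_colimit C (small_subsets lam W) (\<subseteq>) D d B b
        \<and> f \<in> Hom C A B
        \<longrightarrow> (\<exists>Z \<in> small_subsets lam W. \<exists>g \<in> Hom C A (D Z). f = b Z \<bullet>\<^bsub>C\<^esub> g))"

definition closed_under_small_directed_colimits ::
  "'u rel \<Rightarrow> ('o, 'm) category \<Rightarrow> ('o, 'm) category \<Rightarrow> bool" where
  "closed_under_small_directed_colimits \<kappa> C R \<longleftrightarrow>
     (\<forall>(P :: 'u set) leq D d B b.
        |P| <o \<kappa> \<and> directed_on P leq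
        \<and> poset_diagram R P leq D d \<and> is_colimit C P leq D d B b
        \<longrightarrow> B \<in> Obj R)"


section \<open>Larders\<close>

definition right_larder ::
  "'u rel \<Rightarrow> 'l rel \<Rightarrow> ('o, 'm) category \<Rightarrow> ('o, 'm) category
     \<Rightarrow> ('p, 'n) category \<Rightarrow> ('p, 'n) category \<Rightarrow> ('p, 'n) category
     \<Rightarrow> ('o, 'm, 'p, 'n) funct \<Rightarrow> bool" where
  "right_larder \<kappa> lam \<B> \<B>d \<S> \<S>d \<S>dbl \<Psi> \<longleftrightarrow>
     full_subcategory \<B>d \<B> \<and> full_subcategory \<S>d \<S> \<and> subcategory \<S>dbl \<S> \<and> is_functor \<B> \<S> \<Psi>
     \<and> (\<forall>C\<in>Obj \<B>d. weakly_presented \<kappa> lam \<S> (FObj \<Psi> C))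
     \<and> (\<forall>B\<in>Obj \<B>. \<forall>S\<in>Obj \<S>d. \<forall>\<psi> \<in> Hom \<S>dbl (FObj \<Psi> B) S.
          \<forall>(I :: 'u set) Ci \<gamma>i.
            |I| <o cofinality lam
            \<and> (\<forall>i\<in>I. Ci i \<in> Obj \<B>d \<and> \<gamma>i i \<in> Hom \<B> (Ci i) B \<and> monomorphism \<B> (\<gamma>i i))
            \<longrightarrow> (\<exists>C\<in>Obj \<B>d. \<exists>\<gamma> \<in> Hom \<B> C B. monomorphism \<B> \<gamma>
                  \<and> (\<forall>i\<in>I. \<exists>\<delta> \<in> Hom \<B> (Ci i) C. \<gamma>i i = \<gamma> \<bullet>\<^bsub>\<B>\<^esub> \<delta>)
                  \<and> \<psi> \<bullet>\<^bsub>\<S>\<^esub> FArr \<Psi> \<gamma> \<in> Arr \<S>dbl))"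

definition projectability_witness ::
  "('o, 'm) category \<Rightarrow> ('p, 'n) category \<Rightarrow> ('o, 'm, 'p, 'n) funct
     \<Rightarrow> 'o \<Rightarrow> 'p \<Rightarrow> 'n \<Rightarrow> 'm \<Rightarrow> 'n \<Rightarrow> bool" where
  "projectability_witness \<B> \<S> \<Psi> C S \<phi> a \<epsilon> \<longleftrightarrow>
     (\<exists>C'\<in>Obj \<B>. a \<in> Hom \<B> C C' \<and> epimorphism \<B> a
        \<and> \<epsilon> \<in> Hom \<S> (FObj \<Psi> C') S \<and> isomorphism \<S> \<epsilon>
        \<and> \<phi> = \<epsilon> \<bullet>\<^bsub>\<S>\<^esub> FArr \<Psi> a
        \<and> (\<forall>Y\<in>Obj \<B>. \<forall>f \<in> Hom \<B> C Y. \<forall>\<eta> \<in> Hom \<S> (FObj \<Psi> C') (FObj \<Psi> Y).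
             FArr \<Psi> f = \<eta> \<bullet>\<^bsub>\<S>\<^esub> FArr \<Psi> a
             \<longrightarrow> (\<exists>g \<in> Hom \<B> C' Y. f = g \<bullet>\<^bsub>\<B>\<^esub> a \<and> \<eta> = FArr \<Psi> g)))"

definition projectable_right_larder ::
  "'u rel \<Rightarrow> 'l rel \<Rightarrow> ('o, 'm) category \<Rightarrow> ('o, 'm) category
     \<Rightarrow> ('p, 'n) category \<Rightarrow> ('p, 'n) category \<Rightarrow> ('p, 'n) category
     \<Rightarrow> ('o, 'm, 'p, 'n) funct \<Rightarrow> bool" where
  "projectable_right_larder \<kappa> lam \<B> \<B>d \<S> \<S>d \<S>dbl \<Psi> \<longleftrightarrow>
     right_larder \<kappa> lam \<B> \<B>d \<S> \<S>d \<S>dbl \<Psi>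
     \<and> (\<forall>C\<in>Obj \<B>. \<forall>S\<in>Obj \<S>. \<forall>\<phi> \<in> Hom \<S>dbl (FObj \<Psi> C) S.
          \<exists>a \<epsilon>. projectability_witness \<B> \<S> \<Psi> C S \<phi> a \<epsilon>)"


section \<open>Categories of structures\<close>

text \<open>Arrows are triples (domain, map, codomain), the map being \<open>undefined\<close> off the domain.\<close>

type_synonym ('e, 's) structure_arrow =
  "('e, 's) partial_object_scheme \<times> ('e \<Rightarrow> 'e) \<times> ('e, 's) partial_object_scheme"

definition structure_category ::
  "('e, 's) partial_object_scheme set
     \<Rightarrow> (('e, 's) partial_object_scheme \<Rightarrow> ('e, 's) partial_object_scheme \<Rightarrow> ('e \<Rightarrow> 'e) set)
     \<Rightarrow> (('e, 's) partial_object_scheme, ('e, 's) structure_arrow) category" where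
  "structure_category X H =
     \<lparr>Obj = X,
      Arr = {(A, f, B). A \<in> X \<and> B \<in> X \<and> f \<in> H A B \<and> f \<in> extensional (carrier A)},
      Dom = (\<lambda>(A, f, B). A),
      Cod = (\<lambda>(A, f, B). B),
      Ident = (\<lambda>A. (A, \<lambda>x\<in>carrier A. x, A)),
      Comp = (\<lambda>(B', g, C) (A, f, B). (A, compose (carrier A) g f, C))\<rparr>"

definition small_part ::
  "'l rel \<Rightarrow> (('e, 's) partial_object_scheme, 'm) category
     \<Rightarrow> (('e, 's) partial_object_scheme, 'm) category" where
  "small_part lam C = full_subcategory_on C {A. |carrier A| <o lam}"


section \<open>Regular rings\<close>

text \<open>Rings need not be unital: the field \<open>one\<close> of the record is not used.\<close>

locale rng = abelian_group R for R (structure) +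
  assumes mult_closed: "\<lbrakk>x \<in> carrier R; y \<in> carrier R\<rbrakk> \<Longrightarrow> x \<otimes> y \<in> carrier R"
    and mult_assoc: "\<lbrakk>x \<in> carrier R; y \<in> carrier R; z \<in> carrier R\<rbrakk>
                      \<Longrightarrow> (x \<otimes> y) \<otimes> z = x \<otimes> (y \<otimes> z)"
    and distrib_right: "\<lbrakk>x \<in> carrier R; y \<in> carrier R; z \<in> carrier R\<rbrakk>
                      \<Longrightarrow> (x \<oplus> y) \<otimes> z = x \<otimes> z \<oplus> y \<otimes> z"
    and distrib_left: "\<lbrakk>x \<in> carrier R; y \<in> carrier R; z \<in> carrier R\<rbrakk>
                      \<Longrightarrow> z \<otimes> (x \<oplus> y) = z \<otimes> x \<oplus> z \<otimes> y"

locale regular_rng = rng R for R (structure) +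
  assumes regular: "a \<in> carrier R \<Longrightarrow> \<exists>b\<in>carrier R. a \<otimes> b \<otimes> a = a"

definition rng_hom :: "('a, 'c) ring_scheme \<Rightarrow> ('b, 'd) ring_scheme \<Rightarrow> ('a \<Rightarrow> 'b) set" where
  "rng_hom R S = {f \<in> carrier R \<rightarrow> carrier S. \<forall>x\<in>carrier R. \<forall>y\<in>carrier R.
     f (x \<oplus>\<^bsub>R\<^esub> y) = f x \<oplus>\<^bsub>S\<^esub> f y \<and> f (x \<otimes>\<^bsub>R\<^esub> y) = f x \<otimes>\<^bsub>S\<^esub> f y}"

definition is_subrng :: "'a ring \<Rightarrow> 'a ring \<Rightarrow> bool" where
  "is_subrng S R \<longleftrightarrow> rng S \<and> rng R \<and> carrier S \<subseteq> carrier R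
     \<and> (\<forall>x\<in>carrier S. \<forall>y\<in>carrier S.
          x \<oplus>\<^bsub>S\<^esub> y = x \<oplus>\<^bsub>R\<^esub> y \<and> x \<otimes>\<^bsub>S\<^esub> y = x \<otimes>\<^bsub>R\<^esub> y)"

type_synonym 'u ring_arrow = "'u ring \<times> ('u \<Rightarrow> 'u) \<times> 'u ring"

definition Reg :: "'u rel \<Rightarrow> ('u ring, 'u ring_arrow) category" where
  "Reg \<kappa> = structure_category {R. regular_rng R \<and> |carrier R| <o \<kappa>} rng_hom"

definition closed_under_homomorphic_images :: "('u ring, 'm) category \<Rightarrow> bool" where
  "closed_under_homomorphic_images \<R> \<longleftrightarrow>
     (\<forall>R\<in>Obj \<R>. \<forall>S :: 'u ring. \<forall>f \<in> rng_hom R S.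
        rng S \<and> f ` carrier R = carrier S \<longrightarrow> S \<in> Obj \<R>)"


section \<open>Sectionally complemented modular lattices\<close>

locale sc_modular_lattice = lattice L + weak_partial_order_bottom L for L (structure) +
  assumes modular: "\<lbrakk>x \<in> carrier L; y \<in> carrier L; z \<in> carrier L; x \<sqsubseteq> z\<rbrakk>
                      \<Longrightarrow> x \<squnion> (y \<sqinter> z) = (x \<squnion> y) \<sqinter> z"
    and sectional_complement: "\<lbrakk>x \<in> carrier L; y \<in> carrier L; x \<sqsubseteq> y\<rbrakk>
                      \<Longrightarrow> \<exists>z\<in>carrier L. x \<squnion> z = y \<and> x \<sqinter> z = \<bottom>"

definition zero_lattice_hom ::
  "('a, 'c) gorder_scheme \<Rightarrow> ('b, 'd) gorder_scheme \<Rightarrow> ('a \<Rightarrow> 'b) set" where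
  "zero_lattice_hom L M = {f \<in> carrier L \<rightarrow> carrier M. f \<bottom>\<^bsub>L\<^esub> = \<bottom>\<^bsub>M\<^esub> \<and>
     (\<forall>x\<in>carrier L. \<forall>y\<in>carrier L.
        f (x \<squnion>\<^bsub>L\<^esub> y) = f x \<squnion>\<^bsub>M\<^esub> f y \<and> f (x \<sqinter>\<^bsub>L\<^esub> y) = f x \<sqinter>\<^bsub>M\<^esub> f y)}"

type_synonym 'e lattice_arrow = "'e gorder \<times> ('e \<Rightarrow> 'e) \<times> 'e gorder"

text \<open>
  Principal right ideals being subsets of \<open>'u\<close>, \<open>SCML\<close> is used below with
  \<open>'e = 'u set\<close>, while smallness is still measured by \<open>\<kappa> :: 'u rel\<close>; every
  small lattice has an isomorphic copy there.
\<close>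

definition SCML :: "'k rel \<Rightarrow> ('e gorder, 'e lattice_arrow) category" where
  "SCML \<kappa> = structure_category {L. sc_modular_lattice L \<and> |carrier L| <o \<kappa>} zero_lattice_hom"

definition SCML_surj :: "'k rel \<Rightarrow> ('e gorder, 'e lattice_arrow) category" where
  "SCML_surj \<kappa> = structure_category {L. sc_modular_lattice L \<and> |carrier L| <o \<kappa>}
     (\<lambda>L M. {f \<in> zero_lattice_hom L M. f ` carrier L = carrier M})"


section \<open>The functor of principal right ideals\<close>

definition principal_right_ideal :: "('a, 'c) ring_scheme \<Rightarrow> 'a \<Rightarrow> 'a set" where
  "principal_right_ideal R x = {x \<otimes>\<^bsub>R\<^esub> r | r. r \<in> carrier R}"

definition LL_obj :: "'u ring \<Rightarrow> 'u set gorder" where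
  "LL_obj R = \<lparr>carrier = principal_right_ideal R ` carrier R, eq = (=), le = (\<subseteq>)\<rparr>"

definition LL_arr :: "'u ring_arrow \<Rightarrow> 'u set lattice_arrow" where
  "LL_arr = (\<lambda>(R, f, S).
     (LL_obj R,
      \<lambda>I \<in> carrier (LL_obj R). THE J. \<exists>x\<in>carrier R.
          I = principal_right_ideal R x \<and> J = principal_right_ideal S (f x),
      LL_obj S))"

definition LL :: "('u ring, 'u ring_arrow, 'u set gorder, 'u set lattice_arrow) funct" where
  "LL = \<lparr>FObj = LL_obj, FArr = LL_arr\<rparr>"

end

theory Submission
  imports Defs
begin

text \<open>
  \<^emph>\<open>Weak presentability.\<close> By continuity a colimit over the \<open>\<lambda>\<close>-small subsets of \<open>\<Omega>\<close> is already the
  colimit over the finite subsets of \<open>\<Omega>\<close>. There are few of these, so the set-theoretic directed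
  colimit of lattices is small enough to be an object of the category; hence every element of the
  colimit lives, and every identification happens, at a finite stage. The finite stages needed for
  the elements of a \<open>\<lambda>\<close>-small lattice and for their pairs have a \<open>\<lambda>\<close>-small union, even when \<open>\<lambda>\<close> is
  singular.

  \<^emph>\<open>Extension property.\<close> The images of the given subrings together with one preimage for each
  element of the target lattice form a \<open>\<lambda>\<close>-small set; any \<open>\<lambda>\<close>-small subring around it will do.

  \<^emph>\<open>Projectability.\<close> For a surjective \<open>\<phi>: L(C) \<rightarrow> S\<close> the set \<open>I = {x. \<phi>(xC) = 0}\<close> is a two-sided
  ideal, and \<open>\<phi>(xC) \<le> \<phi>(yC)\<close> means that \<open>x\<close> lies in \<open>yC\<close> modulo \<open>I\<close>. So \<open>S\<close> is isomorphic to
  \<open>L(C/I)\<close>, and the canonical projection \<open>C \<rightarrow> C/I\<close> is the witness.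
\<close>

section \<open>Categories of structures\<close>

text \<open>The size assumptions decide the route. \<open>\<kappa>\<close> is regular and
  uncountable but need not be inaccessible, so \<open>small_subsets lam W\<close> may have
  \<open>\<kappa>\<close> or more members, and a disjoint union over it may be too big for an object
  of \<open>SCML \<kappa>\<close>. An abstract colimit says nothing about its elements until it is
  compared with a concrete cocone inside the category; over \<open>Fpow W\<close> such a cocone
  exists. Finite stages also explain why singular \<open>lam\<close> is harmless here: fewer than
  \<open>lam\<close> finite sets have a \<open>lam\<close>-small union, while for arbitrary
  \<open>lam\<close>-small sets only unions over index sets below the cofinality are controlled. The
  extension property is of the latter kind, and there the cofinality enters. The delicate point for
  projectability is that the kernel is closed under left multiplication, since right ideals see only
  right multiples; a perspectivity argument in the lattice forces it.\<close>

lemma Obj_structure_category [simp]: "Obj (structure_category X H) = X"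
  and Dom_structure_category [simp]: "Dom (structure_category X H) (A, f, B) = A"
  and Cod_structure_category [simp]: "Cod (structure_category X H) (A, f, B) = B"
  and Comp_structure_category [simp]:
    "(B', g, D) \<bullet>\<^bsub>structure_category X H\<^esub> (A, f, B) = (A, compose (carrier A) g f, D)"
  and Ident_structure_category [simp]:
    "Ident (structure_category X H) A = (A, \<lambda>x\<in>carrier A. x, A)"
  by (simp_all add: structure_category_def)

lemma Hom_structure_category:
  "\<phi> \<in> Hom (structure_category X H) A B \<longleftrightarrow>
     (\<exists>f. \<phi> = (A, f, B) \<and> A \<in> X \<and> B \<in> X \<and> f \<in> H A B \<and> f \<in> extensional (carrier A))"
  by (auto simp: Hom_def structure_category_def)

lemma Arr_structure_category:
  "\<phi> \<in> Arr (structure_category X H) \<longleftrightarrow>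
     (\<exists>A f B. \<phi> = (A, f, B) \<and> A \<in> X \<and> B \<in> X \<and> f \<in> H A B \<and> f \<in> extensional (carrier A))"
  by (auto simp: structure_category_def)

text \<open>Composition is \<open>compose\<close> on carriers, so the unit and associative laws
  require that maps send carrier to carrier; this is the assumption \<open>maps\<close>.\<close>

lemma category_structure_category:
  assumes ident: "\<And>A. A \<in> X \<Longrightarrow> (\<lambda>x\<in>carrier A. x) \<in> H A A"
    and comp: "\<And>A B D f g. \<lbrakk>A \<in> X; B \<in> X; D \<in> X; f \<in> H A B; g \<in> H B D\<rbrakk>
      \<Longrightarrow> compose (carrier A) g f \<in> H A D"
    and maps: "\<And>A B f. \<lbrakk>A \<in> X; B \<in> X; f \<in> H A B\<rbrakk> \<Longrightarrow> f \<in> carrier A \<rightarrow> carrier B"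
  shows "category (structure_category X H)"
proof
  fix \<phi> assume "\<phi> \<in> Arr (structure_category X H)"
  then show "Dom (structure_category X H) \<phi> \<in> Obj (structure_category X H)"
    "Cod (structure_category X H) \<phi> \<in> Obj (structure_category X H)"
    by (auto simp: Arr_structure_category)
next
  fix A assume "A \<in> Obj (structure_category X H)"
  then show "Ident (structure_category X H) A \<in> Hom (structure_category X H) A A"
    by (auto simp: Hom_structure_category ident)
next
  fix \<phi> \<psi> A B D assume "\<phi> \<in> Hom (structure_category X H) A B" "\<psi> \<in> Hom (structure_category X H) B D"
  then show "\<psi> \<bullet>\<^bsub>structure_category X H\<^esub> \<phi> \<in> Hom (structure_category X H) A D"
    by (auto simp: Hom_structure_category comp)
next
  fix \<phi> A B assume *: "\<phi> \<in> Hom (structure_category X H) A B"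
  then obtain f where f: "\<phi> = (A, f, B)" "A \<in> X" "B \<in> X" "f \<in> H A B" "f \<in> extensional (carrier A)"
    by (auto simp: Hom_structure_category)
  have "f \<in> carrier A \<rightarrow> carrier B" using maps f by blast
  then show "Ident (structure_category X H) B \<bullet>\<^bsub>structure_category X H\<^esub> \<phi> = \<phi>"
    "\<phi> \<bullet>\<^bsub>structure_category X H\<^esub> Ident (structure_category X H) A = \<phi>"
    using f by (auto simp: Id_compose compose_Id)
next
  fix \<phi> \<psi> \<chi> A B D E
  assume *: "\<phi> \<in> Hom (structure_category X H) A B" "\<psi> \<in> Hom (structure_category X H) B D"
    "\<chi> \<in> Hom (structure_category X H) D E"
  then obtain f g h where f: "\<phi> = (A, f, B)" "\<psi> = (B, g, D)" "\<chi> = (D, h, E)"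
    "A \<in> X" "B \<in> X" "f \<in> H A B"
    by (auto simp: Hom_structure_category)
  have "f \<in> carrier A \<rightarrow> carrier B" using maps f by blast
  then show "(\<chi> \<bullet>\<^bsub>structure_category X H\<^esub> \<psi>) \<bullet>\<^bsub>structure_category X H\<^esub> \<phi> =
    \<chi> \<bullet>\<^bsub>structure_category X H\<^esub> (\<psi> \<bullet>\<^bsub>structure_category X H\<^esub> \<phi>)"
    using f by (simp add: compose_assoc)
qed

lemma subcategory_structure_category:
  assumes "category (structure_category X H)" "category (structure_category X K)"
    and "\<And>A B. \<lbrakk>A \<in> X; B \<in> X\<rbrakk> \<Longrightarrow> H A B \<subseteq> K A B"
  shows "subcategory (structure_category X H) (structure_category X K)"
  using assms
  by (auto simp: subcategory_def Hom_structure_category Arr_structure_category; blast)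

section \<open>Full subcategories\<close>

lemma Hom_full_subcategory_on:
  "Hom (full_subcategory_on C X) A B = (if A \<in> X \<and> B \<in> X then Hom C A B else {})"
  by (auto simp: Hom_def full_subcategory_on_def)

lemma full_subcategory_on_simps [simp]:
  "Obj (full_subcategory_on C X) = Obj C \<inter> X"
  "Dom (full_subcategory_on C X) = Dom C"
  "Cod (full_subcategory_on C X) = Cod C"
  "Ident (full_subcategory_on C X) = Ident C"
  "Comp (full_subcategory_on C X) = Comp C"
  by (simp_all add: full_subcategory_on_def)

lemma full_subcategory_full_subcategory_on:
  assumes "category C"
  shows "full_subcategory (full_subcategory_on C X) C"
proof -
  interpret C: category C by fact
  have "category (full_subcategory_on C X)"
    by standard
      (auto simp: Hom_full_subcategory_on C.Ident_in C.Comp_in C.Ident_left C.Ident_right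
        intro: C.Comp_assoc split: if_splits,
       auto simp: full_subcategory_on_def C.Dom_in C.Cod_in)
  then show ?thesis
    using assms by (auto simp: full_subcategory_def subcategory_def Hom_full_subcategory_on)
qed

lemma full_subcategoryD:
  assumes "full_subcategory D C"
  shows "category D" "category C" "Obj D \<subseteq> Obj C"
    "\<And>A B. \<lbrakk>A \<in> Obj D; B \<in> Obj D\<rbrakk> \<Longrightarrow> Hom D A B = Hom C A B"
    "\<And>A. A \<in> Obj D \<Longrightarrow> Ident D A = Ident C A"
    "\<And>f g A B E. \<lbrakk>f \<in> Hom D A B; g \<in> Hom D B E\<rbrakk> \<Longrightarrow> g \<bullet>\<^bsub>D\<^esub> f = g \<bullet>\<^bsub>C\<^esub> f"
  using assms by (auto simp: full_subcategory_def subcategory_def Hom_def)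

section \<open>Restricting continuous diagrams to finite subsets\<close>

lemma poset_diagramD:
  assumes "poset_diagram C P leq D d"
  shows "poset_on P leq"
    and "p \<in> P \<Longrightarrow> D p \<in> Obj C"
    and "\<lbrakk>p \<in> P; q \<in> P; leq p q\<rbrakk> \<Longrightarrow> d p q \<in> Hom C (D p) (D q)"
    and "p \<in> P \<Longrightarrow> d p p = Ident C (D p)"
    and "\<lbrakk>p \<in> P; q \<in> P; r \<in> P; leq p q; leq q r\<rbrakk> \<Longrightarrow> d p r = d q r \<bullet>\<^bsub>C\<^esub> d p q"
  using assms unfolding poset_diagram_def by blast+

lemma poset_diagram_subset:
  assumes "poset_diagram C P leq D d" "Q \<subseteq> P"
  shows "poset_diagram C Q leq D d"
proof -
  have "poset_on Q leq"
    using poset_diagramD(1)[OF assms(1)] assms(2) unfolding poset_on_def by blast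
  moreover note PD = poset_diagramD(2-)[OF assms(1)] and QP = subsetD[OF assms(2)]
  ultimately show ?thesis
    unfolding poset_diagram_def by (auto intro: PD QP)
qed

text \<open>By continuity the value at \<open>Z\<close> is the colimit of the values at the finite subsets of \<open>Z\<close>, so
  that a cocone over the finite sets extends uniquely to all small sets.\<close>

lemma continuous_diagram_colimit_Fpow:
  assumes cat: "category C"
    and fin: "\<And>Z. finite Z \<Longrightarrow> Z \<subseteq> W \<Longrightarrow> Z \<in> P"
    and P: "P \<subseteq> Pow W"
    and cont: "continuous_diagram C P (\<subseteq>) D d"
    and colim: "is_colimit C P (\<subseteq>) D d B b"
  shows "is_colimit C (Fpow W) (\<subseteq>) D d B b"
proof -
  interpret C: category C by fact
  have diag: "poset_diagram C P (\<subseteq>) D d" using cont by (simp add: continuous_diagram_def)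
  have d_hom: "d X Z \<in> Hom C (D X) (D Z)" if "X \<in> P" "Z \<in> P" "X \<subseteq> Z" for X Z
    using poset_diagramD[OF diag] that by blast
  have d_id: "d X X = Ident C (D X)" if "X \<in> P" for X
    using poset_diagramD[OF diag] that by blast
  have d_comp: "d X Z = d Y Z \<bullet>\<^bsub>C\<^esub> d X Y" if "X \<in> P" "Y \<in> P" "Z \<in> P" "X \<subseteq> Y" "Y \<subseteq> Z" for X Y Z
    using poset_diagramD[OF diag] that by blast
  have FP: "Fpow Z \<subseteq> P" if "Z \<subseteq> W" for Z
    using that fin by (auto simp: Fpow_def)
  have stage: "is_colimit C (Fpow Z) (\<subseteq>) D d (D Z) (\<lambda>X. d X Z)" if Z: "Z \<in> P" for Z
  proof -
    have "Z \<subseteq> W" using P Z by auto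
    moreover have "directed_on (Fpow Z) (\<subseteq>)"
      unfolding directed_on_def
    proof (intro conjI ballI)
      fix x y assume "x \<in> Fpow Z" "y \<in> Fpow Z"
      then show "\<exists>z\<in>Fpow Z. x \<subseteq> z \<and> y \<subseteq> z"
        by (intro bexI[of _ "x \<union> y"]) (auto simp: Fpow_def)
    qed (auto simp: Fpow_def)
    moreover have "is_lub_in P (\<subseteq>) (Fpow Z) Z"
      unfolding is_lub_in_def
    proof (intro conjI ballI impI)
      \<comment> \<open>An upper bound of the finite subsets contains every singleton, so
        \<open>Z\<close> is their supremum in \<open>P\<close>.\<close>
      fix u assume u: "\<forall>x\<in>Fpow Z. x \<subseteq> u"
      show "Z \<subseteq> u"
      proof
        fix z assume "z \<in> Z"
        then have "{z} \<in> Fpow Z" by (simp add: Fpow_def)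
        then show "z \<in> u" using u by blast
      qed
    qed (use Z in \<open>auto simp: Fpow_def\<close>)
    ultimately show ?thesis
      using cont FP unfolding continuous_diagram_def by blast
  qed
  have cc: "is_cocone C P (\<subseteq>) D d B b" using colim by (simp add: is_colimit_def)
  then have b_hom: "b Z \<in> Hom C (D Z) B" if "Z \<in> P" for Z
    using that by (simp add: is_cocone_def)
  have b_comp: "b Z \<bullet>\<^bsub>C\<^esub> d X Z = b X" if "X \<in> P" "Z \<in> P" "X \<subseteq> Z" for X Z
    using that cc by (simp add: is_cocone_def)
  show "is_colimit C (Fpow W) (\<subseteq>) D d B b"
    unfolding is_colimit_def
  proof (intro conjI allI impI)
    show "is_cocone C (Fpow W) (\<subseteq>) D d B b"
      using cc FP[of W] unfolding is_cocone_def by blast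
  next
    fix B' b' assume c': "is_cocone C (Fpow W) (\<subseteq>) D d B' b'"
    have cZ: "is_cocone C (Fpow Z) (\<subseteq>) D d B' b'" if "Z \<in> P" for Z
    proof -
      have "Fpow Z \<subseteq> Fpow W" using that P by (auto simp: Fpow_def)
      then show ?thesis using c' unfolding is_cocone_def by blast
    qed
    have ex1: "\<exists>!h. h \<in> Hom C (D Z) B' \<and> (\<forall>X\<in>Fpow Z. h \<bullet>\<^bsub>C\<^esub> d X Z = b' X)" if "Z \<in> P" for Z
      using stage[OF that] cZ[OF that] unfolding is_colimit_def by blast
    \<comment> \<open>The colimit property at \<open>Z\<close> leaves one candidate for the value of
      the extended cocone; its compatibility can therefore be checked by uniqueness, on finite
      subsets only.\<close>
    define h where "h Z = (THE h. h \<in> Hom C (D Z) B' \<and> (\<forall>X\<in>Fpow Z. h \<bullet>\<^bsub>C\<^esub> d X Z = b' X))" for Z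
    have h: "h Z \<in> Hom C (D Z) B'" "\<And>X. X \<in> Fpow Z \<Longrightarrow> h Z \<bullet>\<^bsub>C\<^esub> d X Z = b' X" if "Z \<in> P" for Z
      using theI'[OF ex1[OF that]] by (auto simp: h_def)
    have h_unique: "k = h Z"
      if "Z \<in> P" "k \<in> Hom C (D Z) B'" "\<And>X. X \<in> Fpow Z \<Longrightarrow> k \<bullet>\<^bsub>C\<^esub> d X Z = b' X" for k Z
      using ex1[OF that(1)] h[OF that(1)] that(2,3) by blast
    have FPZ: "X \<in> P \<and> X \<subseteq> Z" if "Z \<in> P" "X \<in> Fpow Z" for X Z
      using that P FP[of Z] by (auto simp: Fpow_def)
    have h_fin: "h Z = b' Z" if "Z \<in> Fpow W" for Z
    proof -
      have Z: "Z \<in> P" "Z \<in> Fpow Z" using that FP[of W] by (auto simp: Fpow_def)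
      then have "h Z \<bullet>\<^bsub>C\<^esub> d Z Z = b' Z" using h by blast
      then show ?thesis using h(1)[OF Z(1)] d_id[OF Z(1)] C.Ident_right by simp
    qed
    have "is_cocone C P (\<subseteq>) D d B' h"
      unfolding is_cocone_def
    proof (intro conjI ballI impI)
      show "B' \<in> Obj C" using c' by (simp add: is_cocone_def)
      fix Z assume Z: "Z \<in> P"
      then show "h Z \<in> Hom C (D Z) B'" by (rule h)
      fix Z' assume Z': "Z' \<in> P" "Z \<subseteq> Z'"
      show "h Z' \<bullet>\<^bsub>C\<^esub> d Z Z' = h Z"
      proof (rule h_unique[OF Z])
        show "h Z' \<bullet>\<^bsub>C\<^esub> d Z Z' \<in> Hom C (D Z) B'"
          using C.Comp_in d_hom h(1) Z Z' by blast
        fix X assume X: "X \<in> Fpow Z"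
        then have X': "X \<in> P" "X \<subseteq> Z" "X \<in> Fpow Z'" using FPZ[OF Z X] X Z'(2) by (auto simp: Fpow_def)
        have "(h Z' \<bullet>\<^bsub>C\<^esub> d Z Z') \<bullet>\<^bsub>C\<^esub> d X Z = h Z' \<bullet>\<^bsub>C\<^esub> (d Z Z' \<bullet>\<^bsub>C\<^esub> d X Z)"
          using C.Comp_assoc d_hom h(1) Z Z' X' by blast
        also have "\<dots> = b' X" using d_comp[of X Z Z', symmetric] Z Z' X' h(2) by simp
        finally show "(h Z' \<bullet>\<^bsub>C\<^esub> d Z Z') \<bullet>\<^bsub>C\<^esub> d X Z = b' X" .
      qed
    qed
    then have ex: "\<exists>!k. k \<in> Hom C B B' \<and> (\<forall>Z\<in>P. k \<bullet>\<^bsub>C\<^esub> b Z = h Z)"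
      using colim by (simp add: is_colimit_def)
    \<comment> \<open>For a map out of \<open>B\<close> the equations at all members of
      \<open>P\<close> and those at the finite sets are equivalent, so existence and uniqueness are
      transferred together.\<close>
    have iff: "(\<forall>Z\<in>P. k \<bullet>\<^bsub>C\<^esub> b Z = h Z) \<longleftrightarrow> (\<forall>Z\<in>Fpow W. k \<bullet>\<^bsub>C\<^esub> b Z = b' Z)"
      if k: "k \<in> Hom C B B'" for k
    proof (intro iffI ballI)
      fix Z assume "\<forall>Z\<in>P. k \<bullet>\<^bsub>C\<^esub> b Z = h Z" and "Z \<in> Fpow W"
      then show "k \<bullet>\<^bsub>C\<^esub> b Z = b' Z" using h_fin FP[of W] by auto
    next
      fix Z assume *: "\<forall>Z\<in>Fpow W. k \<bullet>\<^bsub>C\<^esub> b Z = b' Z" and Z: "Z \<in> P"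
      show "k \<bullet>\<^bsub>C\<^esub> b Z = h Z"
      proof (rule h_unique[OF Z])
        show "k \<bullet>\<^bsub>C\<^esub> b Z \<in> Hom C (D Z) B'" using C.Comp_in k b_hom Z by blast
        fix X assume X: "X \<in> Fpow Z"
        then have X': "X \<in> P" "X \<subseteq> Z" "X \<in> Fpow W" using FPZ[OF Z X] X Z P by (auto simp: Fpow_def)
        have "(k \<bullet>\<^bsub>C\<^esub> b Z) \<bullet>\<^bsub>C\<^esub> d X Z = k \<bullet>\<^bsub>C\<^esub> (b Z \<bullet>\<^bsub>C\<^esub> d X Z)"
          using C.Comp_assoc d_hom b_hom k Z X' by blast
        also have "\<dots> = b' X" using b_comp Z X' * by simp
        finally show "(k \<bullet>\<^bsub>C\<^esub> b Z) \<bullet>\<^bsub>C\<^esub> d X Z = b' X" .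
      qed
    qed
    have "k \<in> Hom C B B' \<and> (\<forall>Z\<in>P. k \<bullet>\<^bsub>C\<^esub> b Z = h Z) \<longleftrightarrow>
        k \<in> Hom C B B' \<and> (\<forall>Z\<in>Fpow W. k \<bullet>\<^bsub>C\<^esub> b Z = b' Z)" for k
      using iff[of k] by (rule conj_cong[OF refl])
    with ex show "\<exists>!k. k \<in> Hom C B B' \<and> (\<forall>Z\<in>Fpow W. k \<bullet>\<^bsub>C\<^esub> b Z = b' Z)"
      by (simp only:)
  qed
qed

section \<open>Lattices\<close>

text \<open>The order records of HOL-Algebra carry their own equality \<open>eq\<close>; once it is
  \<open>=\<close>, the congruence axioms disappear and only bounds of pairs remain.\<close>

lemma latticeI:
  fixes L (structure)
  assumes eq: "eq L = (=)"
    and refl: "\<And>x. x \<in> carrier L \<Longrightarrow> x \<sqsubseteq> x"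
    and antisym: "\<And>x y. \<lbrakk>x \<in> carrier L; y \<in> carrier L; x \<sqsubseteq> y; y \<sqsubseteq> x\<rbrakk> \<Longrightarrow> x = y"
    and trans: "\<And>x y z. \<lbrakk>x \<in> carrier L; y \<in> carrier L; z \<in> carrier L; x \<sqsubseteq> y; y \<sqsubseteq> z\<rbrakk> \<Longrightarrow> x \<sqsubseteq> z"
    and lub: "\<And>x y. \<lbrakk>x \<in> carrier L; y \<in> carrier L\<rbrakk> \<Longrightarrow> \<exists>s\<in>carrier L. x \<sqsubseteq> s \<and> y \<sqsubseteq> s \<and>
      (\<forall>u\<in>carrier L. x \<sqsubseteq> u \<longrightarrow> y \<sqsubseteq> u \<longrightarrow> s \<sqsubseteq> u)"
    and glb: "\<And>x y. \<lbrakk>x \<in> carrier L; y \<in> carrier L\<rbrakk> \<Longrightarrow> \<exists>s\<in>carrier L. s \<sqsubseteq> x \<and> s \<sqsubseteq> y \<and>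
      (\<forall>u\<in>carrier L. u \<sqsubseteq> x \<longrightarrow> u \<sqsubseteq> y \<longrightarrow> u \<sqsubseteq> s)"
  shows "lattice L"
proof unfold_locales
  fix x y assume xy: "x \<in> carrier L" "y \<in> carrier L"
  show "\<exists>s. least L s (Upper L {x, y})"
    using lub[OF xy] xy by (auto simp: least_def Upper_def)
  show "\<exists>s. greatest L s (Lower L {x, y})"
    using glb[OF xy] xy by (auto simp: greatest_def Lower_def)
qed (simp_all add: eq refl, (use antisym trans in blast)+)

lemma (in lattice) join_eqI:
  assumes "x \<in> carrier L" "y \<in> carrier L" "s \<in> carrier L" "x \<sqsubseteq> s" "y \<sqsubseteq> s"
    and "\<And>u. \<lbrakk>u \<in> carrier L; x \<sqsubseteq> u; y \<sqsubseteq> u\<rbrakk> \<Longrightarrow> s \<sqsubseteq> u"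
  shows "x \<squnion> y = s"
  using assms(1-5) by (intro le_antisym join_le assms(6)) (auto intro: join_left join_right)

lemma (in lattice) meet_eqI:
  assumes "x \<in> carrier L" "y \<in> carrier L" "s \<in> carrier L" "s \<sqsubseteq> x" "s \<sqsubseteq> y"
    and "\<And>u. \<lbrakk>u \<in> carrier L; u \<sqsubseteq> x; u \<sqsubseteq> y\<rbrakk> \<Longrightarrow> u \<sqsubseteq> s"
  shows "x \<sqinter> y = s"
  using assms(1-5) by (intro le_antisym meet_le assms(6)) (auto intro: meet_left meet_right)

lemma weak_partial_order_bottomI:
  fixes L (structure)
  assumes "lattice L" "z \<in> carrier L" "\<And>x. x \<in> carrier L \<Longrightarrow> z \<sqsubseteq> x"
  shows "weak_partial_order_bottom L" "\<bottom> = z"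
proof -
  interpret lattice L by fact
  show "weak_partial_order_bottom L"
    by unfold_locales (use assms in \<open>auto simp: least_def\<close>)
  then interpret weak_partial_order_bottom L .
  show "\<bottom> = z" using assms by (intro le_antisym) auto
qed

lemma zero_lattice_homD:
  assumes "f \<in> zero_lattice_hom L M"
  shows "x \<in> carrier L \<Longrightarrow> f x \<in> carrier M"
    and "f \<bottom>\<^bsub>L\<^esub> = \<bottom>\<^bsub>M\<^esub>"
    and "\<lbrakk>x \<in> carrier L; y \<in> carrier L\<rbrakk> \<Longrightarrow> f (x \<squnion>\<^bsub>L\<^esub> y) = f x \<squnion>\<^bsub>M\<^esub> f y"
    and "\<lbrakk>x \<in> carrier L; y \<in> carrier L\<rbrakk> \<Longrightarrow> f (x \<sqinter>\<^bsub>L\<^esub> y) = f x \<sqinter>\<^bsub>M\<^esub> f y"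
  using assms by (auto simp: zero_lattice_hom_def)

text \<open>Homomorphisms are defined by the operations, and the order is recovered from
  \<open>x \<sqinter> y = x\<close>. Despite its name, \<open>le_iff_join\<close> is the
  characterization of the order by meets.\<close>

lemma zero_lattice_hom_mono:
  assumes "lattice L" "lattice M" "f \<in> zero_lattice_hom L M"
    and "x \<in> carrier L" "y \<in> carrier L" "x \<sqsubseteq>\<^bsub>L\<^esub> y"
  shows "f x \<sqsubseteq>\<^bsub>M\<^esub> f y"
proof -
  interpret L: lattice L by fact
  interpret M: lattice M by fact
  have "x \<sqinter>\<^bsub>L\<^esub> y = x" using assms L.le_iff_join by metis
  then have "f x \<sqinter>\<^bsub>M\<^esub> f y = f x" using zero_lattice_homD(4)[OF assms(3)] assms by metis
  then show ?thesis using zero_lattice_homD(1)[OF assms(3)] assms M.le_iff_join by metis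
qed

lemma zero_lattice_hom_ident:
  assumes "sc_modular_lattice L"
  shows "(\<lambda>x\<in>carrier L. x) \<in> zero_lattice_hom L L"
proof -
  interpret sc_modular_lattice L by fact
  show ?thesis by (auto simp: zero_lattice_hom_def)
qed

lemma zero_lattice_hom_compose:
  assumes "sc_modular_lattice L" "f \<in> zero_lattice_hom L M" "g \<in> zero_lattice_hom M N"
  shows "compose (carrier L) g f \<in> zero_lattice_hom L N"
proof -
  interpret sc_modular_lattice L by fact
  show ?thesis
    using zero_lattice_homD[OF assms(2)] zero_lattice_homD[OF assms(3)]
    by (auto simp: zero_lattice_hom_def compose_eq)
qed

section \<open>The category of sectionally complemented modular lattices\<close>

abbreviation arrow_map :: "'a \<times> 'b \<times> 'c \<Rightarrow> 'b" where
  "arrow_map \<phi> \<equiv> fst (snd \<phi>)"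

lemma category_SCML: "category (SCML \<kappa>)"
  unfolding SCML_def
  by (rule category_structure_category)
    (auto intro: zero_lattice_hom_ident zero_lattice_hom_compose zero_lattice_homD(1))

lemma category_SCML_surj: "category (SCML_surj \<kappa>)"
  unfolding SCML_surj_def
proof (rule category_structure_category)
  fix A B D f g
  assume "A \<in> {L. sc_modular_lattice L \<and> |carrier L| <o \<kappa>}"
    and f: "f \<in> {f \<in> zero_lattice_hom A B. f ` carrier A = carrier B}"
    and g: "g \<in> {f \<in> zero_lattice_hom B D. f ` carrier B = carrier D}"
  moreover have "compose (carrier A) g f ` carrier A = g ` f ` carrier A"
    by (auto simp: compose_def)
  ultimately show "compose (carrier A) g f \<in> {f \<in> zero_lattice_hom A D. f ` carrier A = carrier D}"
    by (auto intro: zero_lattice_hom_compose)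
qed (auto intro: zero_lattice_hom_ident zero_lattice_homD(1))

lemma subcategory_SCML_surj: "subcategory (SCML_surj \<kappa>) (SCML \<kappa>)"
  using category_SCML category_SCML_surj unfolding SCML_def SCML_surj_def
  by (intro subcategory_structure_category) auto

lemma Obj_SCML: "L \<in> Obj (SCML \<kappa>) \<longleftrightarrow> sc_modular_lattice L \<and> |carrier L| <o \<kappa>"
  by (simp add: SCML_def)

text \<open>Replaces an arrow by its underlying map: the triple is rebuilt from
  \<open>arrow_map \<phi>\<close>, and extensionality reduces equality of arrows to agreement on the
  carrier.\<close>

lemma Hom_SCML:
  "\<phi> \<in> Hom (SCML \<kappa>) A B \<longleftrightarrow> A \<in> Obj (SCML \<kappa>) \<and> B \<in> Obj (SCML \<kappa>) \<and>
     \<phi> = (A, arrow_map \<phi>, B) \<and> arrow_map \<phi> \<in> zero_lattice_hom A B \<and>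
     arrow_map \<phi> \<in> extensional (carrier A)"
  unfolding SCML_def Hom_structure_category by auto

lemma Hom_SCML_surj:
  "\<phi> \<in> Hom (SCML_surj \<kappa>) A B \<longleftrightarrow>
     \<phi> \<in> Hom (SCML \<kappa>) A B \<and> arrow_map \<phi> ` carrier A = carrier B"
  unfolding SCML_surj_def SCML_def Hom_structure_category by auto

lemma Ident_SCML: "Ident (SCML \<kappa>) A = (A, \<lambda>x\<in>carrier A. x, A)"
  by (simp add: SCML_def)

lemma Comp_SCML:
  assumes "\<phi> \<in> Hom (SCML \<kappa>) A B" "\<psi> \<in> Hom (SCML \<kappa>) B' D"
  shows "\<psi> \<bullet>\<^bsub>SCML \<kappa>\<^esub> \<phi> = (A, compose (carrier A) (arrow_map \<psi>) (arrow_map \<phi>), D)"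
proof -
  obtain f g where "\<phi> = (A, f, B)" "\<psi> = (B', g, D)"
    using assms by (auto simp: Hom_SCML)
  then show ?thesis by (simp add: SCML_def)
qed

section \<open>Directed colimits of lattices\<close>

text \<open>The colimit is realized on sets of codes of pairs (index, element), \<open>j\<close> being the coding.\<close>

locale directed_lattice_system =
  fixes P :: "'p set" and leq :: "'p \<Rightarrow> 'p \<Rightarrow> bool"
    and D :: "'p \<Rightarrow> 'e gorder" and m :: "'p \<Rightarrow> 'p \<Rightarrow> 'e \<Rightarrow> 'e"
    and j :: "'p \<times> 'e \<Rightarrow> 'f"
  assumes directed: "directed_on P leq"
    and poset: "poset_on P leq"
    and lat: "p \<in> P \<Longrightarrow> sc_modular_lattice (D p)"
    and hom: "\<lbrakk>p \<in> P; q \<in> P; leq p q\<rbrakk> \<Longrightarrow> m p q \<in> zero_lattice_hom (D p) (D q)"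
    and ident: "\<lbrakk>p \<in> P; x \<in> carrier (D p)\<rbrakk> \<Longrightarrow> m p p x = x"
    and comp: "\<lbrakk>p \<in> P; q \<in> P; r \<in> P; leq p q; leq q r; x \<in> carrier (D p)\<rbrakk>
      \<Longrightarrow> m q r (m p q x) = m p r x"
    and inj: "inj_on j (SIGMA p:P. carrier (D p))"
begin

lemma leq_refl: "p \<in> P \<Longrightarrow> leq p p"
  and leq_trans: "\<lbrakk>p \<in> P; q \<in> P; r \<in> P; leq p q; leq q r\<rbrakk> \<Longrightarrow> leq p r"
  using poset unfolding poset_on_def by blast+

lemma upper2:
  assumes "p \<in> P" "q \<in> P"
  obtains r where "r \<in> P" "leq p r" "leq q r"
  using directed assms unfolding directed_on_def by blast

lemma lat_lattice: "p \<in> P \<Longrightarrow> lattice (D p)"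
  using lat sc_modular_lattice.axioms(1) by blast

lemma m_closed: "\<lbrakk>p \<in> P; q \<in> P; leq p q; x \<in> carrier (D p)\<rbrakk> \<Longrightarrow> m p q x \<in> carrier (D q)"
  using zero_lattice_homD(1)[OF hom] by blast

lemma m_mono:
  "\<lbrakk>p \<in> P; q \<in> P; leq p q; x \<in> carrier (D p); y \<in> carrier (D p); x \<sqsubseteq>\<^bsub>D p\<^esub> y\<rbrakk>
    \<Longrightarrow> m p q x \<sqsubseteq>\<^bsub>D q\<^esub> m p q y"
  using zero_lattice_hom_mono[OF lat_lattice lat_lattice hom] by blast

text \<open>The class of \<open>(p, x)\<close> in the usual directed colimit, moved into type
  \<open>'f\<close> by \<open>j\<close>. In the application \<open>'f\<close> is the universe type
  \<open>'u\<close>, so germs have the same type \<open>'u set\<close> as the lattice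
  elements.\<close>

definition germ :: "'p \<Rightarrow> 'e \<Rightarrow> 'f set" where
  "germ p x = j ` {(q, y). q \<in> P \<and> y \<in> carrier (D q) \<and>
     (\<exists>r\<in>P. leq p r \<and> leq q r \<and> m p r x = m q r y)}"

text \<open>Becoming equal at a later stage is transitive because \<open>P\<close> is directed, so
  germs are equivalence classes; injectivity of \<open>j\<close> keeps different classes
  apart.\<close>

lemma germ_eq_iff:
  assumes p: "p \<in> P" "x \<in> carrier (D p)" and q: "q \<in> P" "y \<in> carrier (D q)"
  shows "germ p x = germ q y \<longleftrightarrow> (\<exists>r\<in>P. leq p r \<and> leq q r \<and> m p r x = m q r y)"
    (is "_ \<longleftrightarrow> ?R")
proof -
  define E where "E p x = {(q, y). q \<in> P \<and> y \<in> carrier (D q) \<and>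
     (\<exists>r\<in>P. leq p r \<and> leq q r \<and> m p r x = m q r y)}" for p x
  have sub: "E p x \<subseteq> (SIGMA p:P. carrier (D p))" for p x by (auto simp: E_def)
  have germ: "germ p x = j ` E p x" for p x by (simp add: germ_def E_def)
  have 1: "germ p x = germ q y \<longleftrightarrow> E p x = E q y"
    unfolding germ using inj_on_image_eq_iff[OF inj sub sub] .
  have le: "E p x \<subseteq> E q y"
    if "p \<in> P" "x \<in> carrier (D p)" "q \<in> P" "y \<in> carrier (D q)"
      and r: "r \<in> P" "leq p r" "leq q r" "m p r x = m q r y" for p x q y r
  proof
    fix e assume "e \<in> E p x"
    then obtain s z t where e: "e = (s, z)" "s \<in> P" "z \<in> carrier (D s)" "t \<in> P"
      "leq p t" "leq s t" "m p t x = m s t z" by (auto simp: E_def)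
    \<comment> \<open>Above \<open>r\<close>, where \<open>x\<close> and \<open>y\<close> agree, and
      above \<open>t\<close>, where \<open>x\<close> and \<open>z\<close> agree, all three images
      coincide.\<close>
    obtain u where u: "u \<in> P" "leq r u" "leq t u" using upper2 r(1) e(4) by blast
    have "m q u y = m r u (m q r y)" using comp[of q r u y] that u by simp
    also have "\<dots> = m r u (m p r x)" using r by simp
    also have "\<dots> = m p u x" using comp[of p r u x] that u by simp
    also have "\<dots> = m t u (m p t x)" using comp[of p t u x] that u e by simp
    also have "\<dots> = m s u z" using comp[of s t u z] that u e by simp
    finally have "m q u y = m s u z" .
    moreover have "leq q u" "leq s u"
      using leq_trans[of q r u] leq_trans[of s t u] e u r that by auto
    ultimately show "e \<in> E q y" using e u by (auto simp: E_def)
  qed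
  have 2: "E p x = E q y \<longleftrightarrow> ?R"
  proof
    have "(q, y) \<in> E q y" using q leq_refl by (auto simp: E_def)
    moreover assume "E p x = E q y"
    ultimately have "(q, y) \<in> E p x" by simp
    then show ?R by (auto simp: E_def)
  next
    assume ?R
    then obtain r where r: "r \<in> P" "leq p r" "leq q r" "m p r x = m q r y" by blast
    show "E p x = E q y"
      using le[OF p q r] le[OF q p r(1) r(3) r(2) r(4)[symmetric]] by blast
  qed
  from 1 2 show ?thesis by simp
qed

text \<open>The order asks for comparable representatives at one stage; \<open>germ_le_iff\<close>
  removes the dependence on the representatives.\<close>

definition colim :: "'f set gorder" where
  "colim = \<lparr>carrier = (\<lambda>(p, x). germ p x) ` (SIGMA p:P. carrier (D p)), eq = (=),
     le = (\<lambda>I J. \<exists>p\<in>P. \<exists>x\<in>carrier (D p). \<exists>y\<in>carrier (D p).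
        I = germ p x \<and> J = germ p y \<and> x \<sqsubseteq>\<^bsub>D p\<^esub> y)\<rparr>"

lemma germ_in: "\<lbrakk>p \<in> P; x \<in> carrier (D p)\<rbrakk> \<Longrightarrow> germ p x \<in> carrier colim"
  by (auto simp: colim_def)

lemma germ_m:
  assumes "p \<in> P" "q \<in> P" "leq p q" "x \<in> carrier (D p)"
  shows "germ q (m p q x) = germ p x"
  using assms m_closed leq_refl
  by (subst germ_eq_iff) (auto intro!: bexI[of _ q] simp: ident)

lemma colimE:
  assumes "I \<in> carrier colim"
  obtains p x where "p \<in> P" "x \<in> carrier (D p)" "I = germ p x"
  using assms by (auto simp: colim_def)

text \<open>Representatives may be taken beyond any prescribed stage. Hence finitely many germs live
  at one common stage, which is all that finitary axioms need.\<close>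

lemma colimE_above:
  assumes "I \<in> carrier colim" "p \<in> P"
  obtains q x where "q \<in> P" "leq p q" "x \<in> carrier (D q)" "I = germ q x"
proof -
  obtain r y where r: "r \<in> P" "y \<in> carrier (D r)" "I = germ r y" by (rule colimE[OF assms(1)])
  obtain q where q: "q \<in> P" "leq p q" "leq r q" using upper2[OF assms(2) r(1)] .
  show ?thesis using that[OF q(1,2) m_closed[OF r(1) q(1,3) r(2)]] germ_m r q by simp
qed

lemma colimE2:
  assumes "I \<in> carrier colim" "J \<in> carrier colim"
  obtains p x y where "p \<in> P" "x \<in> carrier (D p)" "y \<in> carrier (D p)"
    "I = germ p x" "J = germ p y"
proof -
  obtain r z where r: "r \<in> P" "z \<in> carrier (D r)" "I = germ r z" by (rule colimE[OF assms(1)])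
  obtain p y where p: "p \<in> P" "leq r p" "y \<in> carrier (D p)" "J = germ p y"
    by (rule colimE_above[OF assms(2) r(1)])
  show ?thesis
    using that[OF p(1) m_closed[OF r(1) p(1,2) r(2)] p(3)] germ_m[OF r(1) p(1,2) r(2)] r p by simp
qed

lemma colimE3:
  assumes "I \<in> carrier colim" "J \<in> carrier colim" "K \<in> carrier colim"
  obtains p x y z where "p \<in> P" "x \<in> carrier (D p)" "y \<in> carrier (D p)" "z \<in> carrier (D p)"
    "I = germ p x" "J = germ p y" "K = germ p z"
proof -
  obtain r x y where r: "r \<in> P" "x \<in> carrier (D r)" "y \<in> carrier (D r)" "I = germ r x" "J = germ r y"
    by (rule colimE2[OF assms(1,2)])
  obtain p z where p: "p \<in> P" "leq r p" "z \<in> carrier (D p)" "K = germ p z"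
    by (rule colimE_above[OF assms(3) r(1)])
  show ?thesis
    using that[OF p(1) m_closed[OF r(1) p(1,2) r(2)] m_closed[OF r(1) p(1,2) r(3)] p(3)]
      germ_m[OF r(1) p(1,2)] r p by simp
qed

text \<open>The order may be witnessed by other representatives \<open>a\<close>, \<open>b\<close>
  at some \<open>r\<close>. Beyond the stages where \<open>x\<close> meets \<open>a\<close> and
  \<open>y\<close> meets \<open>b\<close>, the monotone transition maps carry the inequality of
  \<open>a\<close> and \<open>b\<close> over to \<open>x\<close> and \<open>y\<close>.\<close>

lemma germ_le_iff:
  assumes p: "p \<in> P" "x \<in> carrier (D p)" "y \<in> carrier (D p)"
  shows "germ p x \<sqsubseteq>\<^bsub>colim\<^esub> germ p y \<longleftrightarrow> (\<exists>q\<in>P. leq p q \<and> m p q x \<sqsubseteq>\<^bsub>D q\<^esub> m p q y)"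
proof
  assume "\<exists>q\<in>P. leq p q \<and> m p q x \<sqsubseteq>\<^bsub>D q\<^esub> m p q y"
  then obtain q where q: "q \<in> P" "leq p q" "m p q x \<sqsubseteq>\<^bsub>D q\<^esub> m p q y" by blast
  have "germ p x = germ q (m p q x)" "germ p y = germ q (m p q y)"
    using germ_m p q by simp_all
  then show "germ p x \<sqsubseteq>\<^bsub>colim\<^esub> germ p y"
    using q m_closed[OF p(1) q(1,2)] p unfolding colim_def by (simp; blast)
next
  assume "germ p x \<sqsubseteq>\<^bsub>colim\<^esub> germ p y"
  then obtain r a b where r: "r \<in> P" "a \<in> carrier (D r)" "b \<in> carrier (D r)"
    "germ p x = germ r a" "germ p y = germ r b" "a \<sqsubseteq>\<^bsub>D r\<^esub> b"
    by (auto simp: colim_def)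
  obtain s where s: "s \<in> P" "leq p s" "leq r s" "m p s x = m r s a"
    using r(4) germ_eq_iff p r by auto
  obtain t where t: "t \<in> P" "leq p t" "leq r t" "m p t y = m r t b"
    using r(5) germ_eq_iff p r by auto
  obtain u where u: "u \<in> P" "leq s u" "leq t u" using upper2[OF s(1) t(1)] .
  have "m p u x = m s u (m p s x)" using comp[of p s u x] p s u by simp
  also have "\<dots> = m r u a" using comp[of r s u a] s r u by simp
  finally have x: "m p u x = m r u a" .
  have "m p u y = m t u (m p t y)" using comp[of p t u y] p t u by simp
  also have "\<dots> = m r u b" using comp[of r t u b] t r u by simp
  finally have "m p u y = m r u b" .
  then have "m p u x \<sqsubseteq>\<^bsub>D u\<^esub> m p u y"
    using x m_mono[OF r(1) u(1) _ r(2,3,6)] leq_trans[OF r(1) s(1) u(1) s(3) u(2)] by simp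
  then show "\<exists>q\<in>P. leq p q \<and> m p q x \<sqsubseteq>\<^bsub>D q\<^esub> m p q y"
    using u leq_trans[OF p(1) s(1) u(1) s(2) u(2)] by blast
qed

lemma germ_mono:
  assumes p: "p \<in> P" "x \<in> carrier (D p)" "y \<in> carrier (D p)" "x \<sqsubseteq>\<^bsub>D p\<^esub> y"
  shows "germ p x \<sqsubseteq>\<^bsub>colim\<^esub> germ p y"
  using assms by (auto simp: colim_def)

text \<open>Antisymmetry, transitivity and the two bound properties each combine two inequalities,
  which must be realized at the same stage.\<close>

lemma common_stage:
  assumes p: "p \<in> P" "x \<in> carrier (D p)" "y \<in> carrier (D p)" "x' \<in> carrier (D p)" "y' \<in> carrier (D p)"
    and le: "germ p x \<sqsubseteq>\<^bsub>colim\<^esub> germ p y" "germ p x' \<sqsubseteq>\<^bsub>colim\<^esub> germ p y'"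
  obtains q where "q \<in> P" "leq p q" "m p q x \<sqsubseteq>\<^bsub>D q\<^esub> m p q y" "m p q x' \<sqsubseteq>\<^bsub>D q\<^esub> m p q y'"
proof -
  obtain s where s: "s \<in> P" "leq p s" "m p s x \<sqsubseteq>\<^bsub>D s\<^esub> m p s y"
    using le(1) germ_le_iff p by blast
  obtain t where t: "t \<in> P" "leq p t" "m p t x' \<sqsubseteq>\<^bsub>D t\<^esub> m p t y'"
    using le(2) germ_le_iff p by blast
  obtain u where u: "u \<in> P" "leq s u" "leq t u" using upper2[OF s(1) t(1)] .
  have "m s u (m p s x) \<sqsubseteq>\<^bsub>D u\<^esub> m s u (m p s y)"
    using m_mono[OF s(1) u(1) u(2)] m_closed p s by blast
  moreover have "m t u (m p t x') \<sqsubseteq>\<^bsub>D u\<^esub> m t u (m p t y')"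
    using m_mono[OF t(1) u(1) u(3)] m_closed p t by blast
  ultimately show ?thesis
    using that[OF u(1) leq_trans[OF p(1) s(1) u(1) s(2) u(2)]] comp p s t u by simp
qed

lemma germ_join_least:
  assumes p: "p \<in> P" "x \<in> carrier (D p)" "y \<in> carrier (D p)" and u: "u \<in> carrier colim"
    and le: "germ p x \<sqsubseteq>\<^bsub>colim\<^esub> u" "germ p y \<sqsubseteq>\<^bsub>colim\<^esub> u"
  shows "germ p (x \<squnion>\<^bsub>D p\<^esub> y) \<sqsubseteq>\<^bsub>colim\<^esub> u"
proof -
  obtain q z where q: "q \<in> P" "leq p q" "z \<in> carrier (D q)" "u = germ q z"
    by (rule colimE_above[OF u p(1)])
  note mc = m_closed[OF p(1) q(1,2)]
  interpret p: lattice "D p" using lat_lattice p by blast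
  have "germ q (m p q x) \<sqsubseteq>\<^bsub>colim\<^esub> germ q z" "germ q (m p q y) \<sqsubseteq>\<^bsub>colim\<^esub> germ q z"
    using le q p germ_m[OF p(1) q(1,2)] by auto
  then obtain r where r: "r \<in> P" "leq q r" "m q r (m p q x) \<sqsubseteq>\<^bsub>D r\<^esub> m q r z"
    "m q r (m p q y) \<sqsubseteq>\<^bsub>D r\<^esub> m q r z"
    using common_stage[OF q(1) mc[OF p(2)] q(3) mc[OF p(3)] q(3)] by blast
  interpret r: lattice "D r" using lat_lattice r by blast
  have "m q r (m p q (x \<squnion>\<^bsub>D p\<^esub> y)) = m q r (m p q x) \<squnion>\<^bsub>D r\<^esub> m q r (m p q y)"
    using zero_lattice_homD(3)[OF hom[OF p(1) q(1,2)]] zero_lattice_homD(3)[OF hom[OF q(1) r(1,2)]] mc p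
    by simp
  also have "\<dots> \<sqsubseteq>\<^bsub>D r\<^esub> m q r z"
    using r m_closed[OF q(1) r(1,2)] mc p q by (intro r.join_le) auto
  finally have "germ q (m p q (x \<squnion>\<^bsub>D p\<^esub> y)) \<sqsubseteq>\<^bsub>colim\<^esub> germ q z"
    using r q mc p by (subst germ_le_iff) auto
  then show ?thesis using germ_m[OF p(1) q(1,2)] p q by simp
qed

lemma germ_meet_greatest:
  assumes p: "p \<in> P" "x \<in> carrier (D p)" "y \<in> carrier (D p)" and u: "u \<in> carrier colim"
    and le: "u \<sqsubseteq>\<^bsub>colim\<^esub> germ p x" "u \<sqsubseteq>\<^bsub>colim\<^esub> germ p y"
  shows "u \<sqsubseteq>\<^bsub>colim\<^esub> germ p (x \<sqinter>\<^bsub>D p\<^esub> y)"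
proof -
  obtain q z where q: "q \<in> P" "leq p q" "z \<in> carrier (D q)" "u = germ q z"
    by (rule colimE_above[OF u p(1)])
  note mc = m_closed[OF p(1) q(1,2)]
  interpret p: lattice "D p" using lat_lattice p by blast
  have "germ q z \<sqsubseteq>\<^bsub>colim\<^esub> germ q (m p q x)" "germ q z \<sqsubseteq>\<^bsub>colim\<^esub> germ q (m p q y)"
    using le q p germ_m[OF p(1) q(1,2)] by auto
  then obtain r where r: "r \<in> P" "leq q r" "m q r z \<sqsubseteq>\<^bsub>D r\<^esub> m q r (m p q x)"
    "m q r z \<sqsubseteq>\<^bsub>D r\<^esub> m q r (m p q y)"
    using common_stage[OF q(1) q(3) mc[OF p(2)] q(3) mc[OF p(3)]] by blast
  interpret r: lattice "D r" using lat_lattice r by blast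
  have "m q r z \<sqsubseteq>\<^bsub>D r\<^esub> m q r (m p q x) \<sqinter>\<^bsub>D r\<^esub> m q r (m p q y)"
    using r m_closed[OF q(1) r(1,2)] mc p q by (intro r.meet_le) auto
  also have "m q r (m p q x) \<sqinter>\<^bsub>D r\<^esub> m q r (m p q y) = m q r (m p q (x \<sqinter>\<^bsub>D p\<^esub> y))"
    using zero_lattice_homD(4)[OF hom[OF p(1) q(1,2)]] zero_lattice_homD(4)[OF hom[OF q(1) r(1,2)]] mc p
    by simp
  finally have "germ q z \<sqsubseteq>\<^bsub>colim\<^esub> germ q (m p q (x \<sqinter>\<^bsub>D p\<^esub> y))"
    using r q mc p by (subst germ_le_iff) auto
  then show ?thesis using germ_m[OF p(1) q(1,2)] p q by simp
qed

lemma lattice_colim: "lattice colim"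
proof (rule latticeI)
  show "eq colim = (=)" by (simp add: colim_def)
next
  fix I assume "I \<in> carrier colim"
  then obtain p x where p: "p \<in> P" "x \<in> carrier (D p)" "I = germ p x" by (rule colimE)
  interpret p: lattice "D p" using lat_lattice p by blast
  show "I \<sqsubseteq>\<^bsub>colim\<^esub> I" using p germ_mono by simp
next
  fix I J assume IJ: "I \<in> carrier colim" "J \<in> carrier colim" "I \<sqsubseteq>\<^bsub>colim\<^esub> J" "J \<sqsubseteq>\<^bsub>colim\<^esub> I"
  obtain p x y where p: "p \<in> P" "x \<in> carrier (D p)" "y \<in> carrier (D p)"
    "I = germ p x" "J = germ p y" by (rule colimE2[OF IJ(1,2)])
  obtain q where q: "q \<in> P" "leq p q" "m p q x \<sqsubseteq>\<^bsub>D q\<^esub> m p q y" "m p q y \<sqsubseteq>\<^bsub>D q\<^esub> m p q x"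
    using common_stage[OF p(1,2,3) p(3,2)] IJ p by blast
  interpret q: lattice "D q" using lat_lattice q by blast
  have "m p q x = m p q y" using q m_closed[OF p(1) q(1,2)] p by (intro q.le_antisym) auto
  then show "I = J" using germ_m[OF p(1) q(1,2)] p by metis
next
  fix I J K assume IJ: "I \<in> carrier colim" "J \<in> carrier colim" "K \<in> carrier colim"
    "I \<sqsubseteq>\<^bsub>colim\<^esub> J" "J \<sqsubseteq>\<^bsub>colim\<^esub> K"
  obtain p x y z where p: "p \<in> P" "x \<in> carrier (D p)" "y \<in> carrier (D p)" "z \<in> carrier (D p)"
    "I = germ p x" "J = germ p y" "K = germ p z" by (rule colimE3[OF IJ(1,2,3)])
  obtain q where q: "q \<in> P" "leq p q" "m p q x \<sqsubseteq>\<^bsub>D q\<^esub> m p q y" "m p q y \<sqsubseteq>\<^bsub>D q\<^esub> m p q z"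
    using common_stage[OF p(1,2,3) p(3,4)] IJ p by blast
  interpret q: lattice "D q" using lat_lattice q by blast
  have "m p q x \<sqsubseteq>\<^bsub>D q\<^esub> m p q z"
    using q m_closed[OF p(1) q(1,2)] p q.le_trans[of "m p q x" "m p q y" "m p q z"] by auto
  then show "I \<sqsubseteq>\<^bsub>colim\<^esub> K" using p q by (auto simp: germ_le_iff)
next
  fix I J assume IJ: "I \<in> carrier colim" "J \<in> carrier colim"
  obtain p x y where p: "p \<in> P" "x \<in> carrier (D p)" "y \<in> carrier (D p)"
    "I = germ p x" "J = germ p y" by (rule colimE2[OF IJ(1,2)])
  interpret p: lattice "D p" using lat_lattice p by blast
  show "\<exists>s\<in>carrier colim. I \<sqsubseteq>\<^bsub>colim\<^esub> s \<and> J \<sqsubseteq>\<^bsub>colim\<^esub> s \<and>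
      (\<forall>u\<in>carrier colim. I \<sqsubseteq>\<^bsub>colim\<^esub> u \<longrightarrow> J \<sqsubseteq>\<^bsub>colim\<^esub> u \<longrightarrow> s \<sqsubseteq>\<^bsub>colim\<^esub> u)"
    using p germ_join_least[OF p(1-3)]
    by (intro bexI[of _ "germ p (x \<squnion>\<^bsub>D p\<^esub> y)"])
      (auto intro: germ_in germ_mono p.join_left p.join_right)
  show "\<exists>s\<in>carrier colim. s \<sqsubseteq>\<^bsub>colim\<^esub> I \<and> s \<sqsubseteq>\<^bsub>colim\<^esub> J \<and>
      (\<forall>u\<in>carrier colim. u \<sqsubseteq>\<^bsub>colim\<^esub> I \<longrightarrow> u \<sqsubseteq>\<^bsub>colim\<^esub> J \<longrightarrow> u \<sqsubseteq>\<^bsub>colim\<^esub> s)"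
    using p germ_meet_greatest[OF p(1-3)]
    by (intro bexI[of _ "germ p (x \<sqinter>\<^bsub>D p\<^esub> y)"])
      (auto intro: germ_in germ_mono p.meet_left p.meet_right)
qed

lemma germ_join:
  assumes p: "p \<in> P" "x \<in> carrier (D p)" "y \<in> carrier (D p)"
  shows "germ p (x \<squnion>\<^bsub>D p\<^esub> y) = germ p x \<squnion>\<^bsub>colim\<^esub> germ p y"
proof -
  interpret lattice colim by (rule lattice_colim)
  interpret p: lattice "D p" using lat_lattice p by blast
  show ?thesis
    using p germ_join_least[OF p]
    by (intro join_eqI[symmetric]) (auto intro: germ_in germ_mono p.join_left p.join_right)
qed

lemma germ_meet:
  assumes p: "p \<in> P" "x \<in> carrier (D p)" "y \<in> carrier (D p)"
  shows "germ p (x \<sqinter>\<^bsub>D p\<^esub> y) = germ p x \<sqinter>\<^bsub>colim\<^esub> germ p y"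
proof -
  interpret lattice colim by (rule lattice_colim)
  interpret p: lattice "D p" using lat_lattice p by blast
  show ?thesis
    using p germ_meet_greatest[OF p]
    by (intro meet_eqI[symmetric]) (auto intro: germ_in germ_mono p.meet_left p.meet_right)
qed

text \<open>Transition maps preserve bottom, so all stages have the same bottom germ, and it can be
  compared with any germ beyond \<open>p\<close>.\<close>

lemma germ_bottom:
  assumes p: "p \<in> P"
  shows "germ p \<bottom>\<^bsub>D p\<^esub> = \<bottom>\<^bsub>colim\<^esub>" and "weak_partial_order_bottom colim"
proof -
  interpret p: sc_modular_lattice "D p" using lat p by blast
  have le: "germ p \<bottom>\<^bsub>D p\<^esub> \<sqsubseteq>\<^bsub>colim\<^esub> I" if I: "I \<in> carrier colim" for I
  proof -
    obtain q x where q: "q \<in> P" "leq p q" "x \<in> carrier (D q)" "I = germ q x"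
      by (rule colimE_above[OF I p])
    interpret q: sc_modular_lattice "D q" using lat q by blast
    have "germ p \<bottom>\<^bsub>D p\<^esub> = germ q \<bottom>\<^bsub>D q\<^esub>"
      using germ_m[OF p q(1,2) p.bottom_closed] zero_lattice_homD(2)[OF hom[OF p q(1,2)]] by simp
    also have "\<dots> \<sqsubseteq>\<^bsub>colim\<^esub> I" using q germ_mono by simp
    finally show ?thesis .
  qed
  show "germ p \<bottom>\<^bsub>D p\<^esub> = \<bottom>\<^bsub>colim\<^esub>" "weak_partial_order_bottom colim"
    using weak_partial_order_bottomI[OF lattice_colim germ_in[OF p p.bottom_closed] le] by simp_all
qed

text \<open>Both axioms concern finitely many elements. Their premise is an inequality of germs,
  which holds for the representatives only from some stage \<open>q\<close> on; there the axiom of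
  \<open>D q\<close> applies and is pushed forward by \<open>germ\<close>.\<close>

lemma sc_modular_lattice_colim: "sc_modular_lattice colim"
proof -
  obtain p0 where p0: "p0 \<in> P" using directed by (auto simp: directed_on_def)
  interpret lattice colim by (rule lattice_colim)
  interpret weak_partial_order_bottom colim using germ_bottom(2)[OF p0] .
  show ?thesis
  proof
    fix I J K assume IJ: "I \<in> carrier colim" "J \<in> carrier colim" "K \<in> carrier colim"
      "I \<sqsubseteq>\<^bsub>colim\<^esub> K"
    obtain p x y z where p: "p \<in> P" "x \<in> carrier (D p)" "y \<in> carrier (D p)" "z \<in> carrier (D p)"
      "I = germ p x" "J = germ p y" "K = germ p z" by (rule colimE3[OF IJ(1,2,3)])
    obtain q where q: "q \<in> P" "leq p q" "m p q x \<sqsubseteq>\<^bsub>D q\<^esub> m p q z"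
      using germ_le_iff IJ p by blast
    note mc = m_closed[OF p(1) q(1,2)]
    interpret q: sc_modular_lattice "D q" using lat q by blast
    have "m p q x \<squnion>\<^bsub>D q\<^esub> (m p q y \<sqinter>\<^bsub>D q\<^esub> m p q z) = (m p q x \<squnion>\<^bsub>D q\<^esub> m p q y) \<sqinter>\<^bsub>D q\<^esub> m p q z"
      using q mc p by (intro q.modular) auto
    then have "germ q (m p q x) \<squnion>\<^bsub>colim\<^esub> (germ q (m p q y) \<sqinter>\<^bsub>colim\<^esub> germ q (m p q z)) =
      (germ q (m p q x) \<squnion>\<^bsub>colim\<^esub> germ q (m p q y)) \<sqinter>\<^bsub>colim\<^esub> germ q (m p q z)"
      using q mc p by (simp flip: germ_join germ_meet)
    then show "I \<squnion>\<^bsub>colim\<^esub> J \<sqinter>\<^bsub>colim\<^esub> K = (I \<squnion>\<^bsub>colim\<^esub> J) \<sqinter>\<^bsub>colim\<^esub> K"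
      using germ_m[OF p(1) q(1,2)] p by simp
  next
    fix I J assume IJ: "I \<in> carrier colim" "J \<in> carrier colim" "I \<sqsubseteq>\<^bsub>colim\<^esub> J"
    obtain p x y where p: "p \<in> P" "x \<in> carrier (D p)" "y \<in> carrier (D p)"
      "I = germ p x" "J = germ p y" by (rule colimE2[OF IJ(1,2)])
    obtain q where q: "q \<in> P" "leq p q" "m p q x \<sqsubseteq>\<^bsub>D q\<^esub> m p q y"
      using germ_le_iff IJ p by blast
    note mc = m_closed[OF p(1) q(1,2)]
    interpret q: sc_modular_lattice "D q" using lat q by blast
    obtain z where z: "z \<in> carrier (D q)" "m p q x \<squnion>\<^bsub>D q\<^esub> z = m p q y" "m p q x \<sqinter>\<^bsub>D q\<^esub> z = \<bottom>\<^bsub>D q\<^esub>"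
      using q.sectional_complement[OF mc mc q(3)] p by blast
    have "I \<squnion>\<^bsub>colim\<^esub> germ q z = J" "I \<sqinter>\<^bsub>colim\<^esub> germ q z = \<bottom>\<^bsub>colim\<^esub>"
      using germ_join[OF q(1) mc z(1)] germ_meet[OF q(1) mc z(1)] germ_bottom(1)[OF q(1)]
        z p germ_m[OF p(1) q(1,2)] by metis+
    then show "\<exists>z\<in>carrier colim. I \<squnion>\<^bsub>colim\<^esub> z = J \<and> I \<sqinter>\<^bsub>colim\<^esub> z = \<bottom>\<^bsub>colim\<^esub>"
      using germ_in q z by blast
  qed
qed

lemma germ_hom: "p \<in> P \<Longrightarrow> germ p \<in> zero_lattice_hom (D p) colim"
  by (auto simp: zero_lattice_hom_def germ_in germ_join germ_meet germ_bottom)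

text \<open>The existence half of the universal property. The description of \<open>k\<close> is
  unambiguous: two representatives of a germ agree at a later stage \<open>r\<close>, and the cocone
  condition \<open>coc\<close> equates their values.\<close>

lemma germ_hom_lift:
  assumes B: "sc_modular_lattice B"
    and \<beta>: "\<And>p. p \<in> P \<Longrightarrow> \<beta> p \<in> zero_lattice_hom (D p) B"
    and coc: "\<And>p q x. \<lbrakk>p \<in> P; q \<in> P; leq p q; x \<in> carrier (D p)\<rbrakk> \<Longrightarrow> \<beta> q (m p q x) = \<beta> p x"
  obtains k where "k \<in> zero_lattice_hom colim B" "\<And>p x. \<lbrakk>p \<in> P; x \<in> carrier (D p)\<rbrakk> \<Longrightarrow> k (germ p x) = \<beta> p x"
proof -
  define k where "k I = (THE z. \<exists>p\<in>P. \<exists>x\<in>carrier (D p). I = germ p x \<and> z = \<beta> p x)" for I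
  have k: "k (germ p x) = \<beta> p x" if p: "p \<in> P" "x \<in> carrier (D p)" for p x
    unfolding k_def
  proof (rule the_equality)
    show "\<exists>p'\<in>P. \<exists>x'\<in>carrier (D p'). germ p x = germ p' x' \<and> \<beta> p x = \<beta> p' x'"
      using p by blast
    fix z assume "\<exists>p'\<in>P. \<exists>x'\<in>carrier (D p'). germ p x = germ p' x' \<and> z = \<beta> p' x'"
    then obtain p' x' where p': "p' \<in> P" "x' \<in> carrier (D p')" "germ p x = germ p' x'" "z = \<beta> p' x'"
      by blast
    then obtain r where r: "r \<in> P" "leq p r" "leq p' r" "m p r x = m p' r x'"
      using germ_eq_iff p by blast
    show "z = \<beta> p x"
      using coc[OF p(1) r(1,2) p(2)] coc[OF p'(1) r(1,3) p'(2)] r p' by simp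
  qed
  obtain p0 where p0: "p0 \<in> P" using directed by (auto simp: directed_on_def)
  interpret p0: sc_modular_lattice "D p0" using lat p0 by blast
  interpret colim: sc_modular_lattice colim by (rule sc_modular_lattice_colim)
  have "k \<in> zero_lattice_hom colim B"
    unfolding zero_lattice_hom_def
  proof (intro CollectI conjI ballI)
    show "k \<in> carrier colim \<rightarrow> carrier B"
      using k zero_lattice_homD(1)[OF \<beta>] by (fastforce elim: colimE)
    show "k \<bottom>\<^bsub>colim\<^esub> = \<bottom>\<^bsub>B\<^esub>"
      using k[OF p0 p0.bottom_closed] germ_bottom(1)[OF p0] zero_lattice_homD(2)[OF \<beta>[OF p0]] by simp
    fix I J assume IJ: "I \<in> carrier colim" "J \<in> carrier colim"
    obtain p x y where p: "p \<in> P" "x \<in> carrier (D p)" "y \<in> carrier (D p)"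
      "I = germ p x" "J = germ p y" by (rule colimE2[OF IJ(1,2)])
    interpret p: sc_modular_lattice "D p" using lat p by blast
    show "k (I \<squnion>\<^bsub>colim\<^esub> J) = k I \<squnion>\<^bsub>B\<^esub> k J" "k (I \<sqinter>\<^bsub>colim\<^esub> J) = k I \<sqinter>\<^bsub>B\<^esub> k J"
      using p k zero_lattice_homD(3,4)[OF \<beta>[OF p(1)]] by (simp_all flip: germ_join germ_meet)
  qed
  then show ?thesis using that k by blast
qed

lemma card_of_colim: "|carrier colim| \<le>o |SIGMA p:P. carrier (D p)|"
  unfolding colim_def by (simp add: card_of_image)

end

section \<open>Elements and identifications in a categorical colimit of lattices\<close>

lemma Cinfinite_universe:
  assumes "\<kappa> = |UNIV :: 'u set|" "natLeq <o \<kappa>"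
  shows "Cinfinite \<kappa>"
  using assms natLeq_cinfinite cinfinite_mono[of natLeq \<kappa>] ordLess_imp_ordLeq by (auto simp: card_of_Card_order)

text \<open>The abstract colimit \<open>B\<close> is compared with \<open>colim\<close>: its
  universal property gives \<open>h\<close> from \<open>B\<close> to \<open>colim\<close>, the lift
  gives \<open>k\<close> back, and \<open>k \<circ> h\<close> is the identity. Hence each
  \<open>y = k (h y)\<close> comes from a representative of the germ \<open>h y\<close>, and
  elements identified in \<open>B\<close> have, via \<open>h\<close>, equal germs.\<close>

lemma SCML_directed_colimit:
  fixes \<kappa> :: "'u rel" and D :: "'p \<Rightarrow> 'u set gorder"
  assumes \<kappa>: "\<kappa> = |UNIV :: 'u set|" "natLeq <o \<kappa>" "regularCard \<kappa>"
    and P: "|P| <o \<kappa>" "directed_on P leq"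
    and diag: "poset_diagram (SCML \<kappa>) P leq D d"
    and colim: "is_colimit (SCML \<kappa>) P leq D d B b"
  shows "y \<in> carrier B \<Longrightarrow> \<exists>p\<in>P. \<exists>x\<in>carrier (D p). y = arrow_map (b p) x"
    and "\<lbrakk>p \<in> P; x \<in> carrier (D p); x' \<in> carrier (D p); arrow_map (b p) x = arrow_map (b p) x'\<rbrakk>
      \<Longrightarrow> \<exists>q\<in>P. leq p q \<and> arrow_map (d p q) x = arrow_map (d p q) x'"
proof -
  interpret C: category "SCML \<kappa> :: ('u set gorder, 'u set lattice_arrow) category"
    by (rule category_SCML)
  have inf: "Cinfinite \<kappa>" by (rule Cinfinite_universe) (rule \<kappa>)+
  have obj: "sc_modular_lattice (D p)" "|carrier (D p)| <o \<kappa>" if "p \<in> P" for p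
    using poset_diagramD(2)[OF diag that] by (auto simp: Obj_SCML)
  \<comment> \<open>Regularity bounds the disjoint union of fewer than \<open>\<kappa>\<close> small
    carriers. The bound serves twice: for the coding \<open>j\<close> into \<open>'u\<close>, and
    for the membership of \<open>colim\<close> in the category.\<close>
  have "stable \<kappa>" using inf regularCard_stable \<kappa>(3) by (auto simp: cinfinite_def)
  then have sigma: "|SIGMA p:P. carrier (D p)| <o \<kappa>" by (rule stable_elim) (use P obj in auto)
  then obtain j :: "'p \<times> 'u set \<Rightarrow> 'u" where j: "inj_on j (SIGMA p:P. carrier (D p))"
    using card_of_ordLeq[of "SIGMA p:P. carrier (D p)" "UNIV :: 'u set"] ordLess_imp_ordLeq \<kappa>(1) by blast
  note dH = poset_diagramD(3)[OF diag]
  interpret directed_lattice_system P leq D "\<lambda>p q. arrow_map (d p q)" j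
  proof (rule directed_lattice_system.intro)
    show "directed_on P leq" "poset_on P leq" "inj_on j (SIGMA p:P. carrier (D p))"
      using P(2) poset_diagramD(1)[OF diag] j by auto
    show "sc_modular_lattice (D p)" if "p \<in> P" for p using obj that by blast
    show "arrow_map (d p q) \<in> zero_lattice_hom (D p) (D q)" if "p \<in> P" "q \<in> P" "leq p q" for p q
      using dH[OF that] by (simp add: Hom_SCML)
    show "arrow_map (d p p) x = x" if "p \<in> P" "x \<in> carrier (D p)" for p x
      using poset_diagramD(4)[OF diag that(1)] that by (simp add: Ident_SCML)
    show "arrow_map (d q r) (arrow_map (d p q) x) = arrow_map (d p r) x"
      if "p \<in> P" "q \<in> P" "r \<in> P" "leq p q" "leq q r" "x \<in> carrier (D p)" for p q r x
      using poset_diagramD(5)[OF diag that(1-5)] Comp_SCML[OF dH[OF that(1,2,4)] dH[OF that(2,3,5)]] that(6)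
      by (simp add: compose_eq)
  qed
  have L: "colim \<in> Obj (SCML \<kappa>)"
    using sc_modular_lattice_colim ordLeq_ordLess_trans[OF card_of_colim sigma] by (simp add: Obj_SCML)
  define c where "c p = (D p, restrict (germ p) (carrier (D p)), colim)" for p
  have cH: "c p \<in> Hom (SCML \<kappa>) (D p) colim" if "p \<in> P" for p
  proof -
    interpret p: sc_modular_lattice "D p" using lat that by blast
    have "restrict (germ p) (carrier (D p)) \<in> zero_lattice_hom (D p) colim"
      using germ_hom[OF that] by (auto simp: zero_lattice_hom_def)
    then show ?thesis
      unfolding Hom_SCML using L poset_diagramD(2)[OF diag that] by (auto simp: c_def)
  qed
  have "is_cocone (SCML \<kappa>) P leq D d colim c"
    unfolding is_cocone_def
  proof (intro conjI ballI impI)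
    fix p q assume pq: "p \<in> P" "q \<in> P" "leq p q"
    have "compose (carrier (D p)) (restrict (germ q) (carrier (D q))) (arrow_map (d p q)) =
      restrict (germ p) (carrier (D p))"
      using germ_m[OF pq] m_closed[OF pq] by (simp add: compose_def restrict_def fun_eq_iff)
    then show "c q \<bullet>\<^bsub>SCML \<kappa>\<^esub> d p q = c p"
      unfolding Comp_SCML[OF dH[OF pq] cH[OF pq(2)]] by (simp add: c_def)
  qed (use L cH in auto)
  then obtain h where h: "h \<in> Hom (SCML \<kappa>) B colim" "\<And>p. p \<in> P \<Longrightarrow> h \<bullet>\<^bsub>SCML \<kappa>\<^esub> b p = c p"
    using colim unfolding is_colimit_def by blast
  have cc: "is_cocone (SCML \<kappa>) P leq D d B b" using colim by (simp add: is_colimit_def)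
  have bH: "b p \<in> Hom (SCML \<kappa>) (D p) B" if "p \<in> P" for p
    using cc that by (simp add: is_cocone_def)
  have hb: "arrow_map h (arrow_map (b p) x) = germ p x" if "p \<in> P" "x \<in> carrier (D p)" for p x
  proof -
    have "compose (carrier (D p)) (arrow_map h) (arrow_map (b p)) = restrict (germ p) (carrier (D p))"
      using h(2)[OF that(1)] Comp_SCML[OF bH[OF that(1)] h(1)] by (simp add: c_def)
    from fun_cong[OF this, of x] show ?thesis using that(2) by (simp add: compose_eq)
  qed
  show "\<exists>q\<in>P. leq p q \<and> arrow_map (d p q) x = arrow_map (d p q) x'"
    if "p \<in> P" "x \<in> carrier (D p)" "x' \<in> carrier (D p)" "arrow_map (b p) x = arrow_map (b p) x'"
  proof -
    have "germ p x = germ p x'" using hb that by metis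
    then show ?thesis using germ_eq_iff that by blast
  qed
  have B: "sc_modular_lattice B" using cc by (simp add: is_cocone_def Obj_SCML)
  have \<beta>: "arrow_map (b p) \<in> zero_lattice_hom (D p) B" if "p \<in> P" for p
    using bH[OF that] by (simp add: Hom_SCML)
  have coc: "arrow_map (b q) (arrow_map (d p q) x) = arrow_map (b p) x"
    if pq: "p \<in> P" "q \<in> P" "leq p q" and x: "x \<in> carrier (D p)" for p q x
  proof -
    have "b q \<bullet>\<^bsub>SCML \<kappa>\<^esub> d p q = b p" using cc pq by (simp add: is_cocone_def)
    then have "arrow_map (b p) = compose (carrier (D p)) (arrow_map (b q)) (arrow_map (d p q))"
      unfolding Comp_SCML[OF dH[OF pq] bH[OF pq(2)]] by (metis fst_conv snd_conv)
    then show ?thesis using x by (simp add: compose_eq)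
  qed
  obtain k where k: "k \<in> zero_lattice_hom colim B"
    "\<And>p x. \<lbrakk>p \<in> P; x \<in> carrier (D p)\<rbrakk> \<Longrightarrow> k (germ p x) = arrow_map (b p) x"
    using germ_hom_lift[OF B \<beta> coc] by blast
  define k' where "k' = (colim, restrict k (carrier colim), B)"
  interpret colim: sc_modular_lattice colim by (rule sc_modular_lattice_colim)
  have k'H: "k' \<in> Hom (SCML \<kappa>) colim B"
  proof -
    have "restrict k (carrier colim) \<in> zero_lattice_hom colim B"
      using k(1) by (auto simp: zero_lattice_hom_def)
    then show ?thesis
      unfolding Hom_SCML using L cc by (auto simp: k'_def is_cocone_def)
  qed
  have k'h: "k' \<bullet>\<^bsub>SCML \<kappa>\<^esub> h = Ident (SCML \<kappa>) B"
  proof -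
    \<comment> \<open>The composite and the identity both fix the colimit cocone \<open>b\<close>,
      so uniqueness for the cocone \<open>b\<close> itself identifies them.\<close>
    have "\<exists>!e. e \<in> Hom (SCML \<kappa>) B B \<and> (\<forall>p\<in>P. e \<bullet>\<^bsub>SCML \<kappa>\<^esub> b p = b p)"
      using colim cc unfolding is_colimit_def by blast
    moreover have "k' \<bullet>\<^bsub>SCML \<kappa>\<^esub> h \<in> Hom (SCML \<kappa>) B B" using C.Comp_in[OF h(1) k'H] .
    moreover have "(k' \<bullet>\<^bsub>SCML \<kappa>\<^esub> h) \<bullet>\<^bsub>SCML \<kappa>\<^esub> b p = b p" if p: "p \<in> P" for p
    proof -
      have "(k' \<bullet>\<^bsub>SCML \<kappa>\<^esub> h) \<bullet>\<^bsub>SCML \<kappa>\<^esub> b p = k' \<bullet>\<^bsub>SCML \<kappa>\<^esub> c p"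
        using C.Comp_assoc[OF bH[OF p] h(1) k'H] h(2)[OF p] by simp
      also have "\<dots> = (D p, compose (carrier (D p)) (arrow_map k') (arrow_map (c p)), B)"
        by (rule Comp_SCML[OF cH[OF p] k'H])
      also have "compose (carrier (D p)) (arrow_map k') (arrow_map (c p)) = arrow_map (b p)"
        using k(2)[OF p] germ_in[OF p] bH[OF p]
        by (intro extensionalityI[of _ "carrier (D p)"])
          (auto simp: compose_eq k'_def c_def Hom_SCML)
      also have "(D p, arrow_map (b p), B) = b p" using bH[OF p] by (simp add: Hom_SCML)
      finally show ?thesis .
    qed
    moreover have "Ident (SCML \<kappa>) B \<in> Hom (SCML \<kappa>) B B"
      using C.Ident_in cc by (simp add: is_cocone_def)
    moreover have "Ident (SCML \<kappa>) B \<bullet>\<^bsub>SCML \<kappa>\<^esub> b p = b p" if "p \<in> P" for p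
      using C.Ident_left bH that by blast
    ultimately show ?thesis by blast
  qed
  have h_hom: "arrow_map h \<in> zero_lattice_hom B colim" using h(1) by (simp add: Hom_SCML)
  have kh: "k (arrow_map h y) = y" if "y \<in> carrier B" for y
  proof -
    have "compose (carrier B) (restrict k (carrier colim)) (arrow_map h) = (\<lambda>y\<in>carrier B. y)"
      using k'h Comp_SCML[OF h(1) k'H]
      by (simp add: Ident_SCML k'_def)
    from fun_cong[OF this, of y] show ?thesis
      using zero_lattice_homD(1)[OF h_hom that] that by (simp add: compose_eq)
  qed
  show "\<exists>p\<in>P. \<exists>x\<in>carrier (D p). y = arrow_map (b p) x" if y: "y \<in> carrier B"
  proof -
    have "arrow_map h y \<in> carrier colim"
      using zero_lattice_homD(1)[OF h_hom y] .
    then obtain p x where "p \<in> P" "x \<in> carrier (D p)" "arrow_map h y = germ p x" by (rule colimE)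
    then show ?thesis using kh[OF y] k(2) by metis
  qed
qed

section \<open>Cardinal bounds for families of finite sets, and weak presentability\<close>

lemma finite_ordLess_Cinfinite:
  assumes "Cinfinite r" "finite X"
  shows "|X| <o r"
  using assms by (intro Cfinite_ordLess_Cinfinite) (auto simp: cfinite_def Field_card_of card_of_card_order_on)

text \<open>Sets with \<open>n + 1\<close> elements arise by inserting a point into a set with
  \<open>n\<close> elements, so each level stays below \<open>r\<close>. Uncountability and
  regularity of \<open>r\<close> then control the union of the countably many levels.\<close>

lemma card_of_Fpow_ordLess:
  fixes r :: "'b rel"
  assumes r: "Cinfinite r" "regularCard r" "natLeq <o r" and W: "|W| <o r"
  shows "|Fpow W| <o r"
proof -
  have st: "stable r" using r regularCard_stable by (auto simp: cinfinite_def)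
  define F where "F n = {X \<in> Fpow W. card X = n}" for n
  have F: "|F n| <o r" for n
  proof (induction n)
    case 0
    have "F 0 = {{}}" by (auto simp: F_def Fpow_def)
    then show ?case using finite_ordLess_Cinfinite[OF r(1), of "{{}} :: 'a set set"] by simp
  next
    case (Suc n)
    have "F (Suc n) \<subseteq> (\<lambda>(a, X). insert a X) ` (W \<times> F n)"
    proof
      fix X assume "X \<in> F (Suc n)"
      then have X: "X \<subseteq> W" "finite X" "card X = Suc n" by (auto simp: F_def Fpow_def)
      then obtain a Y where "X = insert a Y" "a \<notin> Y" "card Y = n"
        by (metis card_Suc_eq)
      then show "X \<in> (\<lambda>(a, X). insert a X) ` (W \<times> F n)"
        using X by (auto simp: F_def Fpow_def intro!: image_eqI[of _ _ "(a, Y)"])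
    qed
    then have "|F (Suc n)| \<le>o |W \<times> F n|"
      using card_of_mono1 card_of_image ordLeq_transitive by blast
    moreover have "|W \<times> F n| <o r"
      by (rule stable_elim[OF st W]) (rule Suc)
    ultimately show ?case using ordLeq_ordLess_trans by blast
  qed
  have "Fpow W = (\<Union>n. F n)" by (auto simp: F_def)
  moreover have "|\<Union>n. F n| <o r"
    using card_of_UNION_ordLess_infinite_Field_regularCard[OF r(2,1)] F
      ordIso_ordLess_trans[OF card_of_nat r(3)] by blast
  ultimately show ?thesis by simp
qed

text \<open>Finiteness of the members takes the place of regularity: over an infinite index set the
  union is no larger than the index set.\<close>

lemma card_of_UNION_finite_ordLess:
  assumes r: "Cinfinite r" and I: "|I| <o r" and F: "\<And>i. i \<in> I \<Longrightarrow> finite (F i)"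
  shows "|\<Union>i\<in>I. F i| <o r"
proof (cases "finite I")
  case True
  then show ?thesis using F finite_ordLess_Cinfinite[OF r] by blast
next
  case False
  have "|F i| \<le>o |I|" if "i \<in> I" for i
    using F[OF that] False finite_ordLess_Cinfinite[of "|I|" "F i"] ordLess_imp_ordLeq
    by (auto simp: cinfinite_def Field_card_of card_of_card_order_on)
  then have "|\<Union>i\<in>I. F i| \<le>o |I|"
    using card_of_UNION_ordLeq_infinite[OF False, of I F] card_of_refl ordIso_imp_ordLeq by blast
  then show ?thesis using I ordLeq_ordLess_trans by blast
qed

lemma weakly_presented_SCML:
  fixes \<kappa> :: "'u rel" and lam :: "'l rel"
  assumes \<kappa>: "\<kappa> = |UNIV :: 'u set|" "natLeq <o \<kappa>" "regularCard \<kappa>"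
    and lam: "Cinfinite lam"
    and A: "A \<in> Obj (SCML \<kappa>)" "|carrier A| <o lam"
  shows "weakly_presented \<kappa> lam (SCML \<kappa> :: ('u set gorder, 'u set lattice_arrow) category) A"
  unfolding weakly_presented_def
proof (intro conjI allI impI, fact, elim conjE)
  fix W :: "'u set" and D d B b f
  let ?P = "small_subsets lam W"
  assume W: "|W| <o \<kappa>"
    and cont: "continuous_diagram (SCML \<kappa> :: ('u set gorder, 'u set lattice_arrow) category) ?P (\<subseteq>) D d"
    and colim: "is_colimit (SCML \<kappa>) ?P (\<subseteq>) D d B b"
    and f: "f \<in> Hom (SCML \<kappa>) A B"
  have fin: "Z \<in> ?P" if "finite Z" "Z \<subseteq> W" for Z
    using that finite_ordLess_Cinfinite[OF lam] by (simp add: small_subsets_def)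
  have PW: "?P \<subseteq> Pow W" by (auto simp: small_subsets_def)
  have FP: "Fpow W \<subseteq> ?P" using fin by (auto simp: Fpow_def)
  have diag: "poset_diagram (SCML \<kappa>) ?P (\<subseteq>) D d"
    using cont by (simp add: continuous_diagram_def)
  define \<mu> where "\<mu> X Y = arrow_map (d X Y)" for X Y
  define \<beta> where "\<beta> X = arrow_map (b X)" for X
  define \<phi> where "\<phi> = arrow_map f"
  have dH: "d X Y \<in> Hom (SCML \<kappa>) (D X) (D Y)" if "X \<in> ?P" "Y \<in> ?P" "X \<subseteq> Y" for X Y
    using poset_diagramD(3)[OF diag that] .
  have cc: "is_cocone (SCML \<kappa>) ?P (\<subseteq>) D d B b" using colim by (simp add: is_colimit_def)
  have bH: "b X \<in> Hom (SCML \<kappa>) (D X) B" if "X \<in> ?P" for X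
    using cc that by (simp add: is_cocone_def)
  have lat: "sc_modular_lattice (D X)" if "X \<in> ?P" for X
    using poset_diagramD(2)[OF diag that] by (simp add: Obj_SCML)
  have \<mu>: "\<mu> X Y \<in> zero_lattice_hom (D X) (D Y)" if "X \<in> ?P" "Y \<in> ?P" "X \<subseteq> Y" for X Y
    using dH[OF that] by (simp add: Hom_SCML \<mu>_def)
  have \<beta>: "\<beta> X \<in> zero_lattice_hom (D X) B" if "X \<in> ?P" for X
    using bH[OF that] by (simp add: Hom_SCML \<beta>_def)
  have \<phi>: "\<phi> \<in> zero_lattice_hom A B" "f = (A, \<phi>, B)" "\<phi> \<in> extensional (carrier A)"
    using f by (simp_all add: Hom_SCML \<phi>_def)
  have \<mu>\<mu>: "\<mu> Y Z (\<mu> X Y x) = \<mu> X Z x"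
    if "X \<in> ?P" "Y \<in> ?P" "Z \<in> ?P" "X \<subseteq> Y" "Y \<subseteq> Z" "x \<in> carrier (D X)" for X Y Z x
    using poset_diagramD(5)[OF diag that(1-5)] Comp_SCML[OF dH[OF that(1,2,4)] dH[OF that(2,3,5)]] that(6)
    by (simp add: compose_eq \<mu>_def)
  have \<beta>\<mu>: "\<beta> Y (\<mu> X Y x) = \<beta> X x"
    if XY: "X \<in> ?P" "Y \<in> ?P" "X \<subseteq> Y" and x: "x \<in> carrier (D X)" for X Y x
  proof -
    have "b Y \<bullet>\<^bsub>SCML \<kappa>\<^esub> d X Y = b X" using cc XY by (simp add: is_cocone_def)
    then have "arrow_map (b X) = compose (carrier (D X)) (arrow_map (b Y)) (arrow_map (d X Y))"
      unfolding Comp_SCML[OF dH[OF XY] bH[OF XY(2)]] by (metis fst_conv snd_conv)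
    then show ?thesis using x by (simp add: compose_eq \<mu>_def \<beta>_def)
  qed
  have \<kappa>inf: "Cinfinite \<kappa>" by (rule Cinfinite_universe) (rule \<kappa>)+
  have F: "|Fpow W| <o \<kappa>" by (rule card_of_Fpow_ordLess) (rule \<kappa>inf \<kappa> W)+
  have Fdir: "directed_on (Fpow W) (\<subseteq>)"
    unfolding directed_on_def
  proof (intro conjI ballI)
    fix x y assume "x \<in> Fpow W" "y \<in> Fpow W"
    then show "\<exists>z\<in>Fpow W. x \<subseteq> z \<and> y \<subseteq> z"
      by (intro bexI[of _ "x \<union> y"]) (auto simp: Fpow_def)
  qed (auto simp: Fpow_def)
  have Fcolim: "is_colimit (SCML \<kappa>) (Fpow W) (\<subseteq>) D d B b"
    by (rule continuous_diagram_colimit_Fpow[OF category_SCML fin PW cont colim])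
  note Fstage = SCML_directed_colimit[OF \<kappa> F Fdir poset_diagram_subset[OF diag FP] Fcolim,
      folded \<mu>_def \<beta>_def]
  interpret A: sc_modular_lattice A using A by (simp add: Obj_SCML)
  \<comment> \<open>Each value of \<open>\<phi>\<close> gets a finite support \<open>X a\<close> and
    a representative \<open>x a\<close> there. These choices need not respect the operations; the
    stage is enlarged below until they do.\<close>
  have "\<forall>a\<in>carrier A. \<exists>X x. X \<in> Fpow W \<and> x \<in> carrier (D X) \<and> \<phi> a = \<beta> X x"
    using Fstage(1) zero_lattice_homD(1)[OF \<phi>(1)] by blast
  then obtain X x where X: "\<And>a. a \<in> carrier A \<Longrightarrow> X a \<in> Fpow W"
    and x: "\<And>a. a \<in> carrier A \<Longrightarrow> x a \<in> carrier (D (X a))" "\<And>a. a \<in> carrier A \<Longrightarrow> \<phi> a = \<beta> (X a) (x a)"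
    by metis
  have XP: "X a \<in> ?P" if "a \<in> carrier A" for a using X FP that by blast
  \<comment> \<open>The agreement is reached at a finite \<open>Y\<close> and persists at every
    small \<open>Z\<close> above it. Persistence is what later permits a union of infinitely many
    such \<open>Y\<close>.\<close>
  have eventually_eq: "\<exists>Y\<in>Fpow W. U \<subseteq> Y \<and> (\<forall>Z\<in>?P. Y \<subseteq> Z \<longrightarrow> \<mu> U Z u = \<mu> U Z v)"
    if U: "U \<in> Fpow W" "u \<in> carrier (D U)" "v \<in> carrier (D U)" "\<beta> U u = \<beta> U v" for U u v
  proof -
    obtain Y where Y: "Y \<in> Fpow W" "U \<subseteq> Y" "\<mu> U Y u = \<mu> U Y v" using Fstage(2)[OF U] by blast
    have "\<mu> U Z u = \<mu> U Z v" if "Z \<in> ?P" "Y \<subseteq> Z" for Z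
      using \<mu>\<mu>[of U Y Z u] \<mu>\<mu>[of U Y Z v] U Y subsetD[OF FP U(1)] subsetD[OF FP Y(1)] that by simp
    then show ?thesis using Y by blast
  qed
  \<comment> \<open>One format for all operations, with \<open>a''\<close> as the element that
    should be the result at stage \<open>Z\<close>. The inclusion clause records that
    \<open>x a\<close> can be transported to \<open>Z\<close>, so the supports are absorbed without
    a separate union.\<close>
  define preserved where "preserved op a a' a'' Z \<longleftrightarrow> X a \<subseteq> Z \<and>
      \<mu> (X a'') Z (x a'') = op Z (\<mu> (X a) Z (x a)) (\<mu> (X a') Z (x a'))" for op a a' a'' Z
  have two: "\<exists>Y\<in>Fpow W. \<forall>Z\<in>?P. Y \<subseteq> Z \<longrightarrow> preserved op a a' a'' Z"
    if a: "a \<in> carrier A" "a' \<in> carrier A" "a'' \<in> carrier A"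
      and closed: "\<And>U u v. \<lbrakk>U \<in> ?P; u \<in> carrier (D U); v \<in> carrier (D U)\<rbrakk> \<Longrightarrow> op U u v \<in> carrier (D U)"
      and \<beta>op: "\<And>U u v. \<lbrakk>U \<in> ?P; u \<in> carrier (D U); v \<in> carrier (D U)\<rbrakk> \<Longrightarrow> \<beta> U (op U u v) = opB (\<beta> U u) (\<beta> U v)"
      and \<mu>op: "\<And>U V u v. \<lbrakk>U \<in> ?P; V \<in> ?P; U \<subseteq> V; u \<in> carrier (D U); v \<in> carrier (D U)\<rbrakk>
        \<Longrightarrow> \<mu> U V (op U u v) = op V (\<mu> U V u) (\<mu> U V v)"
      and \<phi>op: "\<phi> a'' = opB (\<phi> a) (\<phi> a')"
    for a a' a'' op opB
  proof -
    \<comment> \<open>At \<open>U\<close> all three representatives are present. The two sides have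
      the same image in \<open>B\<close>, since \<open>\<phi>\<close> and \<open>\<beta> U\<close>
      respect the operation, so \<open>eventually_eq\<close> applies to them.\<close>
    define U where "U = X a \<union> X a' \<union> X a''"
    have U: "U \<in> Fpow W" "U \<in> ?P" "X a \<subseteq> U" "X a' \<subseteq> U" "X a'' \<subseteq> U"
      using X[OF a(1)] X[OF a(2)] X[OF a(3)] FP by (auto simp: U_def Fpow_def intro!: fin)
    define e where "e c = \<mu> (X c) U (x c)" for c
    have e: "e c \<in> carrier (D U)" "\<beta> U (e c) = \<phi> c" if "c \<in> carrier A" "X c \<subseteq> U" for c
      using zero_lattice_homD(1)[OF \<mu>[OF XP[OF that(1)] U(2) that(2)] x(1)[OF that(1)]]
        \<beta>\<mu>[OF XP[OF that(1)] U(2) that(2) x(1)[OF that(1)]] x(2)[OF that(1)] by (simp_all add: e_def)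
    note ea = e[OF a(1) U(3)] and ea' = e[OF a(2) U(4)] and ea'' = e[OF a(3) U(5)]
    have "\<beta> U (e a'') = \<beta> U (op U (e a) (e a'))"
      by (simp only: \<beta>op[OF U(2) ea(1) ea'(1)] ea(2) ea'(2) ea''(2) \<phi>op)
    from eventually_eq[OF U(1) ea''(1) closed[OF U(2) ea(1) ea'(1)] this]
    obtain Y where Y: "Y \<in> Fpow W" and Y': "U \<subseteq> Y \<and>
      (\<forall>Z\<in>?P. Y \<subseteq> Z \<longrightarrow> \<mu> U Z (e a'') = \<mu> U Z (op U (e a) (e a')))" ..
    have UY: "U \<subseteq> Y" using Y' ..
    have "\<mu> (X a'') Z (x a'') = op Z (\<mu> (X a) Z (x a)) (\<mu> (X a') Z (x a'))" if Z: "Z \<in> ?P" "Y \<subseteq> Z" for Z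
    proof -
      have UZ: "U \<subseteq> Z" using UY Z(2) by (rule subset_trans)
      have tr: "\<mu> U Z (e c) = \<mu> (X c) Z (x c)" if "c \<in> carrier A" "X c \<subseteq> U" for c
        unfolding e_def using \<mu>\<mu>[OF XP[OF that(1)] U(2) Z(1) that(2) UZ x(1)[OF that(1)]] .
      have "\<mu> (X a'') Z (x a'') = \<mu> U Z (e a'')" by (rule tr[OF a(3) U(5), symmetric])
      also have "\<dots> = \<mu> U Z (op U (e a) (e a'))" by (rule mp[OF bspec[OF conjunct2[OF Y'] Z(1)] Z(2)])
      also have "\<dots> = op Z (\<mu> U Z (e a)) (\<mu> U Z (e a'))" by (rule \<mu>op[OF U(2) Z(1) UZ ea(1) ea'(1)])
      finally show ?thesis by (simp only: tr[OF a(1) U(3)] tr[OF a(2) U(4)])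
    qed
    then have "preserved op a a' a'' Z" if "Z \<in> ?P" "Y \<subseteq> Z" for Z
      unfolding preserved_def using that subset_trans[OF U(3) subset_trans[OF UY that(2)]] by (intro conjI)
    then show ?thesis by (intro bexI[OF _ Y] ballI impI)
  qed
  have lat_ops: "u \<squnion>\<^bsub>D U\<^esub> v \<in> carrier (D U)" "u \<sqinter>\<^bsub>D U\<^esub> v \<in> carrier (D U)" "\<bottom>\<^bsub>D U\<^esub> \<in> carrier (D U)"
    if "U \<in> ?P" "u \<in> carrier (D U)" "v \<in> carrier (D U)" for U u v
  proof -
    interpret U: sc_modular_lattice "D U" using lat that by blast
    show "u \<squnion>\<^bsub>D U\<^esub> v \<in> carrier (D U)" "u \<sqinter>\<^bsub>D U\<^esub> v \<in> carrier (D U)" "\<bottom>\<^bsub>D U\<^esub> \<in> carrier (D U)"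
      using that by simp_all
  qed
  \<comment> \<open>Bottom is treated as a constant binary operation, so that the same argument
    covers it.\<close>
  define good where "good a a' Z \<longleftrightarrow>
      preserved (\<lambda>Z. join (D Z)) a a' (a \<squnion>\<^bsub>A\<^esub> a') Z \<and>
      preserved (\<lambda>Z. meet (D Z)) a a' (a \<sqinter>\<^bsub>A\<^esub> a') Z \<and>
      preserved (\<lambda>Z u v. \<bottom>\<^bsub>D Z\<^esub>) a a' \<bottom>\<^bsub>A\<^esub> Z" for a a' Z
  have "\<exists>Y\<in>Fpow W. \<forall>Z\<in>?P. Y \<subseteq> Z \<longrightarrow> good a a' Z" if a: "a \<in> carrier A" "a' \<in> carrier A" for a a'
  proof -
    have "\<exists>Y\<in>Fpow W. \<forall>Z\<in>?P. Y \<subseteq> Z \<longrightarrow> preserved (\<lambda>Z. join (D Z)) a a' (a \<squnion>\<^bsub>A\<^esub> a') Z"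
      by (rule two[OF a, where opB = "join B"])
        (simp_all add: a lat_ops zero_lattice_homD(3)[OF \<phi>(1)] zero_lattice_homD(3)[OF \<beta>]
          zero_lattice_homD(3)[OF \<mu>])
    then obtain Y1 where Y1: "Y1 \<in> Fpow W"
      "\<forall>Z\<in>?P. Y1 \<subseteq> Z \<longrightarrow> preserved (\<lambda>Z. join (D Z)) a a' (a \<squnion>\<^bsub>A\<^esub> a') Z" by blast
    have "\<exists>Y\<in>Fpow W. \<forall>Z\<in>?P. Y \<subseteq> Z \<longrightarrow> preserved (\<lambda>Z. meet (D Z)) a a' (a \<sqinter>\<^bsub>A\<^esub> a') Z"
      by (rule two[OF a, where opB = "meet B"])
        (simp_all add: a lat_ops zero_lattice_homD(4)[OF \<phi>(1)] zero_lattice_homD(4)[OF \<beta>]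
          zero_lattice_homD(4)[OF \<mu>])
    then obtain Y2 where Y2: "Y2 \<in> Fpow W"
      "\<forall>Z\<in>?P. Y2 \<subseteq> Z \<longrightarrow> preserved (\<lambda>Z. meet (D Z)) a a' (a \<sqinter>\<^bsub>A\<^esub> a') Z" by blast
    have "\<exists>Y\<in>Fpow W. \<forall>Z\<in>?P. Y \<subseteq> Z \<longrightarrow> preserved (\<lambda>Z u v. \<bottom>\<^bsub>D Z\<^esub>) a a' \<bottom>\<^bsub>A\<^esub> Z"
      by (rule two[OF a, where opB = "\<lambda>u v. \<bottom>\<^bsub>B\<^esub>"])
        (simp_all add: a lat_ops(3) zero_lattice_homD(2)[OF \<phi>(1)] zero_lattice_homD(2)[OF \<beta>]
          zero_lattice_homD(2)[OF \<mu>])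
    then obtain Y3 where Y3: "Y3 \<in> Fpow W"
      "\<forall>Z\<in>?P. Y3 \<subseteq> Z \<longrightarrow> preserved (\<lambda>Z u v. \<bottom>\<^bsub>D Z\<^esub>) a a' \<bottom>\<^bsub>A\<^esub> Z" by blast
    show ?thesis
    proof (intro bexI[of _ "Y1 \<union> Y2 \<union> Y3"] ballI impI)
      show "Y1 \<union> Y2 \<union> Y3 \<in> Fpow W" using Y1 Y2 Y3 by (auto simp: Fpow_def)
      fix Z assume Z: "Z \<in> ?P" "Y1 \<union> Y2 \<union> Y3 \<subseteq> Z"
      then show "good a a' Z" unfolding good_def using Y1(2) Y2(2) Y3(2) by simp
    qed
  qed
  then have "\<forall>a\<in>carrier A. \<exists>F. \<forall>a'\<in>carrier A. F a' \<in> Fpow W \<and> (\<forall>Z\<in>?P. F a' \<subseteq> Z \<longrightarrow> good a a' Z)"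
    by (intro ballI bchoice) blast
  then obtain Y where "\<forall>a\<in>carrier A. \<forall>a'\<in>carrier A. Y a a' \<in> Fpow W \<and>
      (\<forall>Z\<in>?P. Y a a' \<subseteq> Z \<longrightarrow> good a a' Z)"
    by (rule exE[OF bchoice]) blast
  then have Y: "\<And>a a'. \<lbrakk>a \<in> carrier A; a' \<in> carrier A\<rbrakk> \<Longrightarrow> Y a a' \<in> Fpow W"
    "\<And>a a' Z. \<lbrakk>a \<in> carrier A; a' \<in> carrier A; Z \<in> ?P; Y a a' \<subseteq> Z\<rbrakk> \<Longrightarrow> good a a' Z"
    by blast+
  \<comment> \<open>One stage for all pairs at once: a union of fewer than \<open>lam\<close> finite
    sets, hence again an index of the diagram.\<close>
  define Z where "Z = (\<Union>a\<in>carrier A. \<Union>a'\<in>carrier A. Y a a')"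
  have Z: "Z \<in> ?P"
  proof -
    have "|\<Union>(a, a')\<in>carrier A \<times> carrier A. Y a a'| <o lam"
    proof (rule card_of_UNION_finite_ordLess[OF lam])
      show "|carrier A \<times> carrier A| <o lam"
      proof (cases "finite (carrier A)")
        case True
        then show ?thesis by (intro finite_ordLess_Cinfinite[OF lam] finite_cartesian_product)
      next
        case False
        then show ?thesis by (rule ordIso_ordLess_trans[OF card_of_Times_same_infinite A(2)])
      qed
    qed (use Y(1) in \<open>auto simp: Fpow_def\<close>)
    moreover have "Z = (\<Union>(a, a')\<in>carrier A \<times> carrier A. Y a a')" by (auto simp: Z_def)
    moreover have "Z \<subseteq> W" using Y(1) by (force simp: Z_def Fpow_def)
    ultimately show ?thesis by (simp add: small_subsets_def)
  qed
  have good: "good a a' Z" if "a \<in> carrier A" "a' \<in> carrier A" for a a'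
    by (rule Y(2)[OF that Z]) (use that in \<open>auto simp: Z_def\<close>)
  have XZ: "X a \<subseteq> Z" if "a \<in> carrier A" for a using good[OF that that] by (simp add: good_def preserved_def)
  define g where "g = (A, \<lambda>a\<in>carrier A. \<mu> (X a) Z (x a), D Z)"
  have mem: "\<mu> (X a) Z (x a) \<in> carrier (D Z)" if "a \<in> carrier A" for a
    using zero_lattice_homD(1)[OF \<mu>[OF XP Z XZ]] x that by blast
  \<comment> \<open>Joins and meets are preserved by \<open>good\<close> at each pair; preservation
    of bottom is read off from \<open>good\<close> at the pair consisting of bottom twice.\<close>
  have gH: "g \<in> Hom (SCML \<kappa>) A (D Z)"
    using A(1) poset_diagramD(2)[OF diag Z] mem good[unfolded good_def preserved_def]
      good[OF A.bottom_closed A.bottom_closed, unfolded good_def preserved_def]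
    by (simp add: Hom_SCML g_def zero_lattice_hom_def)
  have "f = b Z \<bullet>\<^bsub>SCML \<kappa>\<^esub> g"
  proof -
    have "compose (carrier A) (\<beta> Z) (arrow_map g) = \<phi>"
      using \<phi>(3) \<beta>\<mu>[OF XP Z XZ] x
      by (intro extensionalityI[of _ "carrier A"]) (auto simp: compose_eq g_def)
    then show ?thesis
      using Comp_SCML[OF gH bH[OF Z]] \<phi>(2) by (simp add: \<beta>_def)
  qed
  then show "\<exists>Z\<in>?P. \<exists>g\<in>Hom (SCML \<kappa>) A (D Z). f = b Z \<bullet>\<^bsub>SCML \<kappa>\<^esub> g"
    using Z gH by blast
qed

section \<open>Principal right ideals of regular rings\<close>

context rng
begin

lemma l_null [simp]: "x \<in> carrier R \<Longrightarrow> \<zero> \<otimes> x = \<zero>"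
proof -
  assume x: "x \<in> carrier R"
  then have "\<zero> \<otimes> x \<oplus> \<zero> \<otimes> x = \<zero> \<otimes> x \<oplus> \<zero>"
    using distrib_right[of \<zero> \<zero> x] by (simp add: mult_closed)
  then show ?thesis using x by (simp add: mult_closed del: r_zero)
qed

lemma r_null [simp]: "x \<in> carrier R \<Longrightarrow> x \<otimes> \<zero> = \<zero>"
proof -
  assume x: "x \<in> carrier R"
  then have "x \<otimes> \<zero> \<oplus> x \<otimes> \<zero> = x \<otimes> \<zero> \<oplus> \<zero>"
    using distrib_left[of \<zero> \<zero> x] by (simp add: mult_closed)
  then show ?thesis using x by (simp add: mult_closed del: r_zero)
qed

lemma l_minus: "\<lbrakk>x \<in> carrier R; y \<in> carrier R\<rbrakk> \<Longrightarrow> (\<ominus> x) \<otimes> y = \<ominus> (x \<otimes> y)"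
proof -
  assume xy: "x \<in> carrier R" "y \<in> carrier R"
  then have "(\<ominus> x) \<otimes> y \<oplus> x \<otimes> y = \<zero>"
    using distrib_right[of "\<ominus> x" x y] by (simp add: l_neg)
  then show ?thesis using xy by (intro minus_equality[symmetric]) (simp_all add: mult_closed)
qed

lemma r_minus: "\<lbrakk>x \<in> carrier R; y \<in> carrier R\<rbrakk> \<Longrightarrow> x \<otimes> (\<ominus> y) = \<ominus> (x \<otimes> y)"
proof -
  assume xy: "x \<in> carrier R" "y \<in> carrier R"
  then have "x \<otimes> (\<ominus> y) \<oplus> x \<otimes> y = \<zero>"
    using distrib_left[of "\<ominus> y" y x] by (simp add: l_neg)
  then show ?thesis using xy by (intro minus_equality[symmetric]) (simp_all add: mult_closed)
qed

lemma diff_mult: "\<lbrakk>x \<in> carrier R; y \<in> carrier R; z \<in> carrier R\<rbrakk> \<Longrightarrow> (x \<ominus> y) \<otimes> z = x \<otimes> z \<ominus> y \<otimes> z"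
  and mult_diff: "\<lbrakk>x \<in> carrier R; y \<in> carrier R; z \<in> carrier R\<rbrakk> \<Longrightarrow> z \<otimes> (x \<ominus> y) = z \<otimes> x \<ominus> z \<otimes> y"
  by (simp_all add: minus_eq distrib_left distrib_right l_minus r_minus)

lemma diff_self [simp]: "x \<in> carrier R \<Longrightarrow> x \<ominus> x = \<zero>"
  by (simp add: minus_eq r_neg)

lemma diff_add_cancel: "\<lbrakk>x \<in> carrier R; y \<in> carrier R\<rbrakk> \<Longrightarrow> (y \<ominus> x) \<oplus> x = y"
  by (simp add: minus_eq a_assoc l_neg)

lemma add_diff_cancel: "\<lbrakk>x \<in> carrier R; y \<in> carrier R\<rbrakk> \<Longrightarrow> x \<oplus> (y \<ominus> x) = y"
  using diff_add_cancel[of x y] a_comm[of x "y \<ominus> x"] by simp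

lemma add_diff_left: "\<lbrakk>x \<in> carrier R; y \<in> carrier R\<rbrakk> \<Longrightarrow> (x \<oplus> y) \<ominus> x = y"
  by (simp add: minus_eq a_comm[of x y] a_assoc r_neg)

lemma add_diff_right: "\<lbrakk>x \<in> carrier R; y \<in> carrier R\<rbrakk> \<Longrightarrow> (x \<oplus> y) \<ominus> y = x"
  by (simp add: minus_eq a_assoc r_neg)

lemma diff_add_diff: "\<lbrakk>x \<in> carrier R; y \<in> carrier R; z \<in> carrier R\<rbrakk> \<Longrightarrow> (x \<ominus> y) \<oplus> (y \<ominus> z) = x \<ominus> z"
  by (simp add: minus_eq a_assoc r_neg1)

lemma diff_eq_zero_iff: "\<lbrakk>x \<in> carrier R; y \<in> carrier R\<rbrakk> \<Longrightarrow> x \<ominus> y = \<zero> \<longleftrightarrow> x = y"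
  using diff_add_cancel[of y x] by auto

lemma principal_right_idealI: "\<lbrakk>r \<in> carrier R; y = x \<otimes> r\<rbrakk> \<Longrightarrow> y \<in> principal_right_ideal R x"
  by (auto simp: principal_right_ideal_def)

lemma principal_right_idealE:
  assumes "y \<in> principal_right_ideal R x"
  obtains r where "r \<in> carrier R" "y = x \<otimes> r"
  using assms by (auto simp: principal_right_ideal_def)

lemma principal_right_ideal_subset: "x \<in> carrier R \<Longrightarrow> principal_right_ideal R x \<subseteq> carrier R"
  by (auto simp: principal_right_ideal_def mult_closed)

lemma principal_right_ideal_add:
  assumes "x \<in> carrier R" "a \<in> principal_right_ideal R x" "b \<in> principal_right_ideal R x"
  shows "a \<oplus> b \<in> principal_right_ideal R x"
  using assms by (fastforce simp: principal_right_ideal_def simp flip: distrib_left)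

lemma principal_right_ideal_diff:
  assumes "x \<in> carrier R" "a \<in> principal_right_ideal R x" "b \<in> principal_right_ideal R x"
  shows "a \<ominus> b \<in> principal_right_ideal R x"
  using assms by (fastforce simp: principal_right_ideal_def simp flip: mult_diff)

lemma principal_right_ideal_mult:
  assumes "x \<in> carrier R" "a \<in> principal_right_ideal R x" "r \<in> carrier R"
  shows "a \<otimes> r \<in> principal_right_ideal R x"
  using assms by (force simp: principal_right_ideal_def mult_assoc mult_closed)

lemma principal_right_ideal_mono:
  assumes "x \<in> carrier R" "y \<in> principal_right_ideal R x"
  shows "principal_right_ideal R y \<subseteq> principal_right_ideal R x"
  using assms principal_right_ideal_mult by (auto simp: principal_right_ideal_def[of R y])

lemma zero_mem_principal_right_ideal: "x \<in> carrier R \<Longrightarrow> \<zero> \<in> principal_right_ideal R x"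
  by (rule principal_right_idealI[of \<zero>]) simp_all

lemma principal_right_ideal_zero: "principal_right_ideal R \<zero> = {\<zero>}"
  by (force simp: principal_right_ideal_def)

text \<open>The next two predicates express \<open>gR = xR + yR\<close> and \<open>mR = xR \<inter> yR\<close> by ring equations, so that
  ring homomorphisms visibly preserve them. For the intersection, \<open>e = xb\<close> and \<open>f = yb'\<close> are idempotent
  generators of \<open>xR\<close> and \<open>yR\<close>, and \<open>m = f - w(f - ef)\<close> fixes every element fixed by \<open>e\<close> and \<open>f\<close>.\<close>

definition join_gen :: "'a \<Rightarrow> 'a \<Rightarrow> 'a \<Rightarrow> bool" where
  "join_gen x y g \<longleftrightarrow> (\<exists>r\<in>carrier R. \<exists>s\<in>carrier R. \<exists>t\<in>carrier R. \<exists>u\<in>carrier R.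
     x = g \<otimes> r \<and> y = g \<otimes> s \<and> g = x \<otimes> t \<oplus> y \<otimes> u)"

definition meet_gen :: "'a \<Rightarrow> 'a \<Rightarrow> 'a \<Rightarrow> bool" where
  "meet_gen x y m \<longleftrightarrow> (\<exists>b\<in>carrier R. \<exists>b'\<in>carrier R. \<exists>w\<in>carrier R. \<exists>r\<in>carrier R. \<exists>s\<in>carrier R.
     x \<otimes> b \<otimes> x = x \<and> y \<otimes> b' \<otimes> y = y \<and> m = x \<otimes> r \<and> m = y \<otimes> s \<and>
     m = y \<otimes> b' \<ominus> w \<otimes> (y \<otimes> b' \<ominus> x \<otimes> b \<otimes> (y \<otimes> b')))"

definition sum_set :: "'a set \<Rightarrow> 'a set \<Rightarrow> 'a set" where
  "sum_set A B = {a \<oplus> b |a b. a \<in> A \<and> b \<in> B}"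

lemma principal_right_ideal_join_gen:
  assumes R: "x \<in> carrier R" "y \<in> carrier R" "g \<in> carrier R" and "join_gen x y g"
  shows "principal_right_ideal R g = sum_set (principal_right_ideal R x) (principal_right_ideal R y)"
proof -
  obtain r s t u where *: "r \<in> carrier R" "s \<in> carrier R" "t \<in> carrier R" "u \<in> carrier R"
    "x = g \<otimes> r" "y = g \<otimes> s" "g = x \<otimes> t \<oplus> y \<otimes> u"
    using assms(4) unfolding join_gen_def by blast
  have xy: "x \<in> principal_right_ideal R g" "y \<in> principal_right_ideal R g"
    using * principal_right_idealI by blast+
  show ?thesis
  proof
    show "sum_set (principal_right_ideal R x) (principal_right_ideal R y) \<subseteq> principal_right_ideal R g"
      using principal_right_ideal_add[OF R(3)] principal_right_ideal_mono[OF R(3) xy(1)]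
        principal_right_ideal_mono[OF R(3) xy(2)] unfolding sum_set_def by blast
    show "principal_right_ideal R g \<subseteq> sum_set (principal_right_ideal R x) (principal_right_ideal R y)"
    proof
      fix z assume "z \<in> principal_right_ideal R g"
      then obtain q where q: "q \<in> carrier R" "z = g \<otimes> q" by (rule principal_right_idealE)
      have "z = (x \<otimes> t \<oplus> y \<otimes> u) \<otimes> q" using q(2) *(7) by simp
      also have "\<dots> = x \<otimes> (t \<otimes> q) \<oplus> y \<otimes> (u \<otimes> q)"
        using *(1-4) R q(1) by (simp add: distrib_right mult_assoc mult_closed)
      finally show "z \<in> sum_set (principal_right_ideal R x) (principal_right_ideal R y)"
        using *(1-4) q(1) mult_closed unfolding sum_set_def principal_right_ideal_def by blast
    qed
  qed
qed

lemma principal_right_ideal_meet_gen: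
  assumes R: "x \<in> carrier R" "y \<in> carrier R" "m \<in> carrier R" and "meet_gen x y m"
  shows "principal_right_ideal R m = principal_right_ideal R x \<inter> principal_right_ideal R y"
proof -
  obtain b b' w r s where *: "b \<in> carrier R" "b' \<in> carrier R" "w \<in> carrier R" "r \<in> carrier R" "s \<in> carrier R"
    "x \<otimes> b \<otimes> x = x" "y \<otimes> b' \<otimes> y = y" "m = x \<otimes> r" "m = y \<otimes> s"
    "m = y \<otimes> b' \<ominus> w \<otimes> (y \<otimes> b' \<ominus> x \<otimes> b \<otimes> (y \<otimes> b'))"
    using assms(4) unfolding meet_gen_def by blast
  have m: "m \<in> principal_right_ideal R x" "m \<in> principal_right_ideal R y"
    using * principal_right_idealI by blast+
  show ?thesis
  proof
    show "principal_right_ideal R m \<subseteq> principal_right_ideal R x \<inter> principal_right_ideal R y"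
      using principal_right_ideal_mono R m by blast
    show "principal_right_ideal R x \<inter> principal_right_ideal R y \<subseteq> principal_right_ideal R m"
    proof
      fix z assume z: "z \<in> principal_right_ideal R x \<inter> principal_right_ideal R y"
      then obtain p q where pq: "p \<in> carrier R" "z = x \<otimes> p" "q \<in> carrier R" "z = y \<otimes> q"
        by (blast elim: principal_right_idealE)
      have zR: "z \<in> carrier R" using pq R by (simp add: mult_closed)
      have ez: "x \<otimes> b \<otimes> z = z" using *(1,6) pq(1,2) R(1) mult_assoc[of "x \<otimes> b" x p] by (simp add: mult_closed)
      have fz: "y \<otimes> b' \<otimes> z = z" using *(2,7) pq(3,4) R(2) mult_assoc[of "y \<otimes> b'" y q] by (simp add: mult_closed)
      have "m \<otimes> z = y \<otimes> b' \<otimes> z \<ominus> w \<otimes> (y \<otimes> b' \<otimes> z \<ominus> x \<otimes> b \<otimes> (y \<otimes> b' \<otimes> z))"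
        unfolding *(10) using *(1-3) R(1,2) zR by (simp add: diff_mult mult_closed mult_assoc)
      also have "\<dots> = z" unfolding fz ez using zR *(3) by (simp add: minus_eq r_neg)
      finally show "z \<in> principal_right_ideal R m" using zR principal_right_idealI by metis
    qed
  qed
qed

end

section \<open>Generators of sums, intersections and complements in regular rings\<close>

context regular_rng
begin

text \<open>Without a unit it is the equation \<open>x = x(bx)\<close> that puts \<open>x\<close>
  into its own right ideal.\<close>

lemma self_mem: "x \<in> carrier R \<Longrightarrow> x \<in> principal_right_ideal R x"
  using regular[of x] by (metis mult_assoc mult_closed principal_right_idealI)

lemma principal_right_ideal_subset_iff:
  "\<lbrakk>x \<in> carrier R; y \<in> carrier R\<rbrakk> \<Longrightarrow>
    principal_right_ideal R y \<subseteq> principal_right_ideal R x \<longleftrightarrow> y \<in> principal_right_ideal R x"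
  using self_mem principal_right_ideal_mono by blast

text \<open>The aim is a common left identity \<open>g\<close> of \<open>x\<close> and
  \<open>y\<close> lying in \<open>xR + yR\<close>. The idempotent \<open>e = xb\<close> serves
  \<open>x\<close>, and \<open>y' = y - ey\<close> is what it misses of \<open>y\<close>. With
  \<open>y'cy' = y'\<close>, the element \<open>g = e + y'v\<close> repairs this, provided that
  \<open>v\<close> kills \<open>x\<close>.\<close>

lemma ex_join_gen:
  assumes x: "x \<in> carrier R" and y: "y \<in> carrier R"
  obtains g where "g \<in> carrier R" "join_gen x y g"
proof -
  obtain b where b: "b \<in> carrier R" "x \<otimes> b \<otimes> x = x" using regular x by blast
  define e where "e = x \<otimes> b"
  define y' where "y' = y \<ominus> e \<otimes> y"
  have e: "e \<in> carrier R" "e \<otimes> x = x" using x b by (simp_all add: e_def mult_closed)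
  have y': "y' \<in> carrier R" using e y by (simp add: y'_def mult_closed)
  obtain c where c: "c \<in> carrier R" "y' \<otimes> c \<otimes> y' = y'" using regular y' by blast
  \<comment> \<open>Subtracting \<open>ce\<close> gives \<open>vx = 0\<close>, while
    \<open>vy = cy'\<close> still recovers \<open>y'\<close> as \<open>y'vy\<close>.\<close>
  define v where "v = c \<ominus> c \<otimes> e"
  define g where "g = e \<oplus> y' \<otimes> v"
  have v: "v \<in> carrier R" using c e by (simp add: v_def mult_closed)
  have g: "g \<in> carrier R" using e y' v by (simp add: g_def mult_closed)
  have "v \<otimes> x = \<zero>" using c e x by (simp add: v_def diff_mult mult_assoc mult_closed)
  then have gx: "g \<otimes> x = x" using e y' v x by (simp add: g_def distrib_right mult_assoc mult_closed)
  have gy: "g \<otimes> y = y"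
  proof -
    have "v \<otimes> y = c \<otimes> y'"
      using c e y by (simp add: v_def y'_def diff_mult mult_diff mult_assoc mult_closed)
    then have "g \<otimes> y = e \<otimes> y \<oplus> y' \<otimes> c \<otimes> y'"
      using e y' v c y by (simp add: g_def distrib_right mult_assoc mult_closed)
    also have "\<dots> = y" using e y c(2) by (simp add: y'_def add_diff_cancel mult_closed)
    finally show ?thesis .
  qed
  have g_eq: "g = x \<otimes> (b \<ominus> b \<otimes> (y \<otimes> v)) \<oplus> y \<otimes> v"
  proof -
    have "g = e \<oplus> (y \<otimes> v \<ominus> e \<otimes> (y \<otimes> v))"
      using e y v by (simp add: g_def y'_def diff_mult mult_assoc mult_closed)
    also have "\<dots> = (e \<ominus> e \<otimes> (y \<otimes> v)) \<oplus> y \<otimes> v"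
      using e y v by (simp add: minus_eq a_ac mult_closed)
    also have "e \<ominus> e \<otimes> (y \<otimes> v) = x \<otimes> (b \<ominus> b \<otimes> (y \<otimes> v))"
      using x b y v by (simp add: e_def mult_diff mult_assoc mult_closed)
    finally show ?thesis .
  qed
  have "b \<ominus> b \<otimes> (y \<otimes> v) \<in> carrier R" using b y v by (simp add: mult_closed)
  \<comment> \<open>The coefficients of \<open>x\<close> and \<open>y\<close> over \<open>g\<close>
    are \<open>x\<close> and \<open>y\<close> themselves, because \<open>gx = x\<close> and
    \<open>gy = y\<close>.\<close>
  then have "join_gen x y g"
    unfolding join_gen_def using x y v gx[symmetric] gy[symmetric] g_eq by blast
  then show ?thesis using that g by blast
qed

text \<open>On \<open>fR\<close>, left multiplication by \<open>k = f - ef\<close> sends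
  \<open>z\<close> to \<open>z - ez\<close>, so its kernel there is the intersection of
  \<open>eR\<close> and \<open>fR\<close>. With \<open>kck = k\<close> and \<open>h = ck\<close> one
  has \<open>kh = k\<close>; thus \<open>m = f - fh\<close> satisfies
  \<open>m - em = k - kh = 0\<close> and lies in the intersection. The constant \<open>w\<close> of
  \<open>meet_gen\<close> is \<open>fc\<close>.\<close>

lemma ex_meet_gen:
  assumes x: "x \<in> carrier R" and y: "y \<in> carrier R"
  obtains m where "m \<in> carrier R" "meet_gen x y m"
proof -
  obtain b where b: "b \<in> carrier R" "x \<otimes> b \<otimes> x = x" using regular x by blast
  obtain b' where b': "b' \<in> carrier R" "y \<otimes> b' \<otimes> y = y" using regular y by blast
  define e where "e = x \<otimes> b"
  define f where "f = y \<otimes> b'"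
  define k where "k = f \<ominus> e \<otimes> f"
  have ef: "e \<in> carrier R" "f \<in> carrier R" using x b y b' by (simp_all add: e_def f_def mult_closed)
  have k: "k \<in> carrier R" using ef by (simp add: k_def mult_closed)
  obtain c where c: "c \<in> carrier R" "k \<otimes> c \<otimes> k = k" using regular k by blast
  define h where "h = c \<otimes> k"
  define m where "m = f \<ominus> f \<otimes> c \<otimes> k"
  have h: "h \<in> carrier R" using c k by (simp add: h_def mult_closed)
  have m: "m \<in> carrier R" using ef c k by (simp add: m_def mult_closed)
  have m_h: "m = f \<ominus> f \<otimes> h" using ef c k by (simp add: m_def h_def mult_assoc mult_closed)
  have kh: "k \<otimes> h = k" using c k by (simp add: h_def mult_assoc)
  have "m = y \<otimes> (b' \<ominus> b' \<otimes> h)"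
    using y b' h by (simp add: m_h f_def mult_diff mult_assoc mult_closed)
  moreover have "e \<otimes> m = m"
  proof -
    have "f \<ominus> f \<otimes> h \<ominus> (e \<otimes> f \<ominus> e \<otimes> f \<otimes> h) = (f \<ominus> e \<otimes> f) \<ominus> (f \<ominus> e \<otimes> f) \<otimes> h"
    proof -
      have "(f \<ominus> e \<otimes> f) \<otimes> h = f \<otimes> h \<ominus> e \<otimes> f \<otimes> h" using ef h by (simp add: diff_mult mult_closed)
      then show ?thesis using ef h by (simp add: minus_eq mult_closed minus_add minus_minus a_ac)
    qed
    also have "\<dots> = \<zero>" using kh k by (simp add: k_def[symmetric])
    also have "e \<otimes> f \<ominus> e \<otimes> f \<otimes> h = e \<otimes> m" using ef h by (simp add: m_h mult_diff mult_assoc mult_closed)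
    finally have "m \<ominus> e \<otimes> m = \<zero>" by (simp add: m_h)
    then show ?thesis using diff_eq_zero_iff[of m "e \<otimes> m"] ef m by (simp add: mult_closed)
  qed
  then have "m = x \<otimes> (b \<otimes> m)" using x b m by (simp add: e_def mult_assoc)
  moreover have "m = y \<otimes> b' \<ominus> (f \<otimes> c) \<otimes> (y \<otimes> b' \<ominus> x \<otimes> b \<otimes> (y \<otimes> b'))"
    by (simp add: m_def k_def e_def f_def)
  moreover have "f \<otimes> c \<in> carrier R" "b \<otimes> m \<in> carrier R" "b' \<ominus> b' \<otimes> h \<in> carrier R"
    using ef c b m b' h by (simp_all add: mult_closed)
  ultimately have "meet_gen x y m"
    unfolding meet_gen_def using b b' by blast
  then show ?thesis using that m by blast
qed

text \<open>\<open>k = f - ef\<close> stands in for \<open>(1 - e)f\<close>: it lies in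
  \<open>yR\<close> because \<open>x\<close> does, it satisfies \<open>ek = 0\<close>, and every
  \<open>z\<close> in \<open>yR\<close> splits as \<open>ez + kz\<close>. An element of both
  summands is fixed and also killed by \<open>e\<close>.\<close>

lemma ex_complement:
  assumes x: "x \<in> carrier R" and y: "y \<in> carrier R" and xy: "x \<in> principal_right_ideal R y"
  obtains k where "k \<in> carrier R"
    "sum_set (principal_right_ideal R x) (principal_right_ideal R k) = principal_right_ideal R y"
    "principal_right_ideal R x \<inter> principal_right_ideal R k = {\<zero>}"
proof -
  obtain b where b: "b \<in> carrier R" "x \<otimes> b \<otimes> x = x" using regular x by blast
  obtain b' where b': "b' \<in> carrier R" "y \<otimes> b' \<otimes> y = y" using regular y by blast
  define e where "e = x \<otimes> b"
  define f where "f = y \<otimes> b'"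
  define k where "k = f \<ominus> e \<otimes> f"
  have ef: "e \<in> carrier R" "f \<in> carrier R" using x b y b' by (simp_all add: e_def f_def mult_closed)
  have ex: "e \<otimes> x = x" and fy: "f \<otimes> y = y" using b b' by (simp_all add: e_def f_def)
  have k: "k \<in> carrier R" using ef by (simp add: k_def mult_closed)
  have ey: "e \<in> principal_right_ideal R y"
    using principal_right_ideal_mult[OF y xy b(1)] by (simp add: e_def)
  have fy': "f \<in> principal_right_ideal R y" using b' principal_right_idealI by (simp add: f_def)
  have ky: "k \<in> principal_right_ideal R y"
    using principal_right_ideal_diff[OF y fy' principal_right_ideal_mult[OF y ey ef(2)]]
    by (simp add: k_def)
  have ee: "e \<otimes> e = e" using ex x b ef by (simp add: e_def flip: mult_assoc)
  have ek: "e \<otimes> k = \<zero>"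
  proof -
    have "e \<otimes> k = e \<otimes> f \<ominus> e \<otimes> e \<otimes> f" using ef by (simp add: k_def mult_diff mult_assoc mult_closed)
    then show ?thesis using ee ef by (simp add: minus_eq r_neg mult_closed)
  qed
  have sum: "sum_set (principal_right_ideal R x) (principal_right_ideal R k) = principal_right_ideal R y"
  proof
    show "sum_set (principal_right_ideal R x) (principal_right_ideal R k) \<subseteq> principal_right_ideal R y"
      using principal_right_ideal_add[OF y] principal_right_ideal_mono[OF y xy]
        principal_right_ideal_mono[OF y ky] unfolding sum_set_def by blast
    show "principal_right_ideal R y \<subseteq> sum_set (principal_right_ideal R x) (principal_right_ideal R k)"
    proof
      fix z assume "z \<in> principal_right_ideal R y"
      then obtain q where q: "q \<in> carrier R" "z = y \<otimes> q" by (rule principal_right_idealE)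
      have z: "z \<in> carrier R" using y q by (simp add: mult_closed)
      have "f \<otimes> z = z" using fy ef y q by (simp flip: mult_assoc)
      then have "k \<otimes> z = z \<ominus> e \<otimes> z" using ef z by (simp add: k_def diff_mult mult_assoc mult_closed)
      then have "z = e \<otimes> z \<oplus> k \<otimes> z" using ef z by (simp add: add_diff_cancel mult_closed)
      also have "e \<otimes> z = x \<otimes> (b \<otimes> z)" using x b z by (simp add: e_def mult_assoc)
      finally show "z \<in> sum_set (principal_right_ideal R x) (principal_right_ideal R k)"
        using b z mult_closed unfolding sum_set_def principal_right_ideal_def by blast
    qed
  qed
  have "principal_right_ideal R x \<inter> principal_right_ideal R k \<subseteq> {\<zero>}"
  proof
    fix z assume "z \<in> principal_right_ideal R x \<inter> principal_right_ideal R k"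
    then obtain p q where pq: "p \<in> carrier R" "z = x \<otimes> p" "q \<in> carrier R" "z = k \<otimes> q"
      by (blast elim: principal_right_idealE)
    have "e \<otimes> z = z" using ex ef x pq(1,2) by (simp flip: mult_assoc)
    moreover have "e \<otimes> z = \<zero>" using ek ef k pq(3,4) by (simp flip: mult_assoc)
    ultimately show "z \<in> {\<zero>}" by simp
  qed
  moreover have "\<zero> \<in> principal_right_ideal R x" "\<zero> \<in> principal_right_ideal R k"
    using x k zero_mem_principal_right_ideal by simp_all
  ultimately show ?thesis using that k sum by blast
qed

end

section \<open>The lattice of principal right ideals\<close>

locale regular_ring_record = regular_rng R for R :: "'u ring" (structure)
begin

lemma carrier_LL_obj: "carrier (LL_obj R) = principal_right_ideal R ` carrier R"
  and le_LL_obj: "I \<sqsubseteq>\<^bsub>LL_obj R\<^esub> J \<longleftrightarrow> I \<subseteq> J"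
  by (simp_all add: LL_obj_def)

lemma LL_E:
  assumes "I \<in> carrier (LL_obj R)"
  obtains x where "x \<in> carrier R" "I = principal_right_ideal R x"
  using assms by (auto simp: carrier_LL_obj)

lemma LL_I: "x \<in> carrier R \<Longrightarrow> principal_right_ideal R x \<in> carrier (LL_obj R)"
  by (simp add: carrier_LL_obj)

lemma LL_sum_closed:
  assumes "I \<in> carrier (LL_obj R)" "J \<in> carrier (LL_obj R)"
  shows "sum_set I J \<in> carrier (LL_obj R)"
proof -
  obtain x where x: "x \<in> carrier R" "I = principal_right_ideal R x" by (rule LL_E[OF assms(1)])
  obtain y where y: "y \<in> carrier R" "J = principal_right_ideal R y" by (rule LL_E[OF assms(2)])
  obtain g where g: "g \<in> carrier R" "join_gen x y g" by (rule ex_join_gen[OF x(1) y(1)])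
  show ?thesis
    using LL_I[OF g(1)] principal_right_ideal_join_gen[OF x(1) y(1) g] x y by simp
qed

lemma LL_Int_closed:
  assumes "I \<in> carrier (LL_obj R)" "J \<in> carrier (LL_obj R)"
  shows "I \<inter> J \<in> carrier (LL_obj R)"
proof -
  obtain x where x: "x \<in> carrier R" "I = principal_right_ideal R x" by (rule LL_E[OF assms(1)])
  obtain y where y: "y \<in> carrier R" "J = principal_right_ideal R y" by (rule LL_E[OF assms(2)])
  obtain m where m: "m \<in> carrier R" "meet_gen x y m" by (rule ex_meet_gen[OF x(1) y(1)])
  show ?thesis
    using LL_I[OF m(1)] principal_right_ideal_meet_gen[OF x(1) y(1) m] x y by simp
qed

lemma LL_ideal:
  assumes "I \<in> carrier (LL_obj R)"
  shows "I \<subseteq> carrier R" "\<zero> \<in> I" "\<lbrakk>a \<in> I; b \<in> I\<rbrakk> \<Longrightarrow> a \<oplus> b \<in> I" "\<lbrakk>a \<in> I; b \<in> I\<rbrakk> \<Longrightarrow> a \<ominus> b \<in> I"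
proof -
  obtain x where x: "x \<in> carrier R" "I = principal_right_ideal R x" by (rule LL_E[OF assms])
  show "I \<subseteq> carrier R" using x principal_right_ideal_subset by simp
  show "a \<oplus> b \<in> I" if "a \<in> I" "b \<in> I" using that x principal_right_ideal_add by simp
  show "a \<ominus> b \<in> I" if "a \<in> I" "b \<in> I" using that x principal_right_ideal_diff by simp
  show "\<zero> \<in> I" using x zero_mem_principal_right_ideal by simp
qed

lemma LL_sum_upper:
  assumes "I \<in> carrier (LL_obj R)" "J \<in> carrier (LL_obj R)"
  shows "I \<subseteq> sum_set I J" "J \<subseteq> sum_set I J"
proof -
  show "I \<subseteq> sum_set I J"
  proof
    fix a assume "a \<in> I"
    then have "a = a \<oplus> \<zero>" using LL_ideal[OF assms(1)] by auto
    then show "a \<in> sum_set I J" using LL_ideal(2)[OF assms(2)] \<open>a \<in> I\<close> unfolding sum_set_def by blast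
  qed
  show "J \<subseteq> sum_set I J"
  proof
    fix a assume "a \<in> J"
    then have "a = \<zero> \<oplus> a" using LL_ideal[OF assms(2)] by auto
    then show "a \<in> sum_set I J" using LL_ideal(2)[OF assms(1)] \<open>a \<in> J\<close> unfolding sum_set_def by blast
  qed
qed

lemma LL_sum_least:
  assumes "K \<in> carrier (LL_obj R)" "I \<subseteq> K" "J \<subseteq> K"
  shows "sum_set I J \<subseteq> K"
proof
  fix z assume "z \<in> sum_set I J"
  then obtain a b where "a \<in> I" "b \<in> J" "z = a \<oplus> b" unfolding sum_set_def by blast
  then show "z \<in> K" using assms LL_ideal(3)[OF assms(1), of a b] by auto
qed

lemma lattice_LL: "lattice (LL_obj R)"
proof (rule latticeI)
  show "eq (LL_obj R) = (=)" by (simp add: LL_obj_def)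
next
  fix I J assume IJ: "I \<in> carrier (LL_obj R)" "J \<in> carrier (LL_obj R)"
  show "\<exists>s\<in>carrier (LL_obj R). I \<sqsubseteq>\<^bsub>LL_obj R\<^esub> s \<and> J \<sqsubseteq>\<^bsub>LL_obj R\<^esub> s \<and>
      (\<forall>u\<in>carrier (LL_obj R). I \<sqsubseteq>\<^bsub>LL_obj R\<^esub> u \<longrightarrow> J \<sqsubseteq>\<^bsub>LL_obj R\<^esub> u \<longrightarrow> s \<sqsubseteq>\<^bsub>LL_obj R\<^esub> u)"
    unfolding le_LL_obj
    by (intro bexI[OF _ LL_sum_closed[OF IJ]] conjI ballI impI LL_sum_upper[OF IJ] LL_sum_least)
  show "\<exists>s\<in>carrier (LL_obj R). s \<sqsubseteq>\<^bsub>LL_obj R\<^esub> I \<and> s \<sqsubseteq>\<^bsub>LL_obj R\<^esub> J \<and>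
      (\<forall>u\<in>carrier (LL_obj R). u \<sqsubseteq>\<^bsub>LL_obj R\<^esub> I \<longrightarrow> u \<sqsubseteq>\<^bsub>LL_obj R\<^esub> J \<longrightarrow> u \<sqsubseteq>\<^bsub>LL_obj R\<^esub> s)"
    unfolding le_LL_obj
    by (intro bexI[OF _ LL_Int_closed[OF IJ]] conjI ballI impI Int_lower1 Int_lower2 Int_greatest)
qed (auto simp: le_LL_obj)

lemma join_LL:
  assumes "I \<in> carrier (LL_obj R)" "J \<in> carrier (LL_obj R)"
  shows "I \<squnion>\<^bsub>LL_obj R\<^esub> J = sum_set I J"
  by (rule lattice.join_eqI[OF lattice_LL assms LL_sum_closed[OF assms]])
    (simp_all add: le_LL_obj LL_sum_upper[OF assms] LL_sum_least)

lemma meet_LL: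
  assumes "I \<in> carrier (LL_obj R)" "J \<in> carrier (LL_obj R)"
  shows "I \<sqinter>\<^bsub>LL_obj R\<^esub> J = I \<inter> J"
  by (rule lattice.meet_eqI[OF lattice_LL assms LL_Int_closed[OF assms]])
    (simp_all add: le_LL_obj)

lemma bottom_LL: "weak_partial_order_bottom (LL_obj R)" "\<bottom>\<^bsub>LL_obj R\<^esub> = {\<zero>}"
proof -
  have "{\<zero>} \<in> carrier (LL_obj R)"
    unfolding carrier_LL_obj using principal_right_ideal_zero zero_closed by blast
  then show "weak_partial_order_bottom (LL_obj R)" "\<bottom>\<^bsub>LL_obj R\<^esub> = {\<zero>}"
    using weak_partial_order_bottomI[OF lattice_LL] LL_ideal(2) by (simp_all add: le_LL_obj)
qed

lemma sc_modular_lattice_LL: "sc_modular_lattice (LL_obj R)"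
proof -
  interpret L: lattice "LL_obj R" by (rule lattice_LL)
  interpret L: weak_partial_order_bottom "LL_obj R" by (rule bottom_LL)
  show ?thesis
  proof
    fix I J K assume IJK: "I \<in> carrier (LL_obj R)" "J \<in> carrier (LL_obj R)" "K \<in> carrier (LL_obj R)"
      and le: "I \<sqsubseteq>\<^bsub>LL_obj R\<^esub> K"
    have "sum_set I (J \<inter> K) = sum_set I J \<inter> K"
    proof
      show "sum_set I (J \<inter> K) \<subseteq> sum_set I J \<inter> K"
        using le LL_ideal(3)[OF IJK(3)] by (auto simp: sum_set_def le_LL_obj)
      show "sum_set I J \<inter> K \<subseteq> sum_set I (J \<inter> K)"
      proof
        \<comment> \<open>Dedekind's argument: \<open>a\<close> lies in \<open>I\<close> and hence
          in \<open>K\<close>, so the other summand \<open>z - a\<close> lies in \<open>K\<close> as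
          well.\<close>
        fix z assume "z \<in> sum_set I J \<inter> K"
        then obtain a b where ab: "a \<in> I" "b \<in> J" "z = a \<oplus> b" "z \<in> K" by (auto simp: sum_set_def)
        have R: "a \<in> carrier R" "b \<in> carrier R" using ab LL_ideal(1) IJK by blast+
        have "z \<ominus> a = b" using R ab(3) by (simp add: add_diff_left)
        moreover have "z \<ominus> a \<in> K" using LL_ideal(4)[OF IJK(3)] ab le by (auto simp: le_LL_obj)
        ultimately show "z \<in> sum_set I (J \<inter> K)" using ab by (auto simp: sum_set_def)
      qed
    qed
    then show "I \<squnion>\<^bsub>LL_obj R\<^esub> J \<sqinter>\<^bsub>LL_obj R\<^esub> K = (I \<squnion>\<^bsub>LL_obj R\<^esub> J) \<sqinter>\<^bsub>LL_obj R\<^esub> K"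
      using IJK by (simp add: join_LL meet_LL LL_sum_closed LL_Int_closed)
  next
    fix I J assume IJ: "I \<in> carrier (LL_obj R)" "J \<in> carrier (LL_obj R)" "I \<sqsubseteq>\<^bsub>LL_obj R\<^esub> J"
    obtain x y where xy: "x \<in> carrier R" "y \<in> carrier R" "I = principal_right_ideal R x"
      "J = principal_right_ideal R y" using IJ by (auto simp: carrier_LL_obj)
    then have "x \<in> principal_right_ideal R y" using IJ(3) self_mem by (auto simp: le_LL_obj)
    then obtain k where k: "k \<in> carrier R" "sum_set I (principal_right_ideal R k) = J"
      "I \<inter> principal_right_ideal R k = {\<zero>}"
      using ex_complement[OF xy(1,2)] xy(3,4) by blast
    then have "principal_right_ideal R k \<in> carrier (LL_obj R)" by (simp add: carrier_LL_obj)
    then show "\<exists>z\<in>carrier (LL_obj R). I \<squnion>\<^bsub>LL_obj R\<^esub> z = J \<and> I \<sqinter>\<^bsub>LL_obj R\<^esub> z = \<bottom>\<^bsub>LL_obj R\<^esub>"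
      using k IJ by (intro bexI[of _ "principal_right_ideal R k"]) (simp_all add: join_LL meet_LL bottom_LL)
  qed
qed

end

section \<open>The functor of principal right ideals\<close>

lemma rng_homD:
  assumes "f \<in> rng_hom R S"
  shows "x \<in> carrier R \<Longrightarrow> f x \<in> carrier S"
    and "\<lbrakk>x \<in> carrier R; y \<in> carrier R\<rbrakk> \<Longrightarrow> f (x \<oplus>\<^bsub>R\<^esub> y) = f x \<oplus>\<^bsub>S\<^esub> f y"
    and "\<lbrakk>x \<in> carrier R; y \<in> carrier R\<rbrakk> \<Longrightarrow> f (x \<otimes>\<^bsub>R\<^esub> y) = f x \<otimes>\<^bsub>S\<^esub> f y"
  using assms by (auto simp: rng_hom_def)

text \<open>\<open>rng_hom\<close> speaks only of sums and products, so the value at zero comes from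
  cancelling in \<open>f 0 + f 0 = f 0\<close>.\<close>

lemma rng_hom_zero:
  assumes "rng R" "rng S" "f \<in> rng_hom R S"
  shows "f \<zero>\<^bsub>R\<^esub> = \<zero>\<^bsub>S\<^esub>"
proof -
  interpret R: rng R by fact
  interpret S: rng S by fact
  note f = rng_homD[OF assms(3)]
  have "f \<zero>\<^bsub>R\<^esub> \<oplus>\<^bsub>S\<^esub> f \<zero>\<^bsub>R\<^esub> = f \<zero>\<^bsub>R\<^esub> \<oplus>\<^bsub>S\<^esub> \<zero>\<^bsub>S\<^esub>"
    using f(2)[of "\<zero>\<^bsub>R\<^esub>" "\<zero>\<^bsub>R\<^esub>"] f(1)[of "\<zero>\<^bsub>R\<^esub>"] by simp
  then show ?thesis using f(1)[of "\<zero>\<^bsub>R\<^esub>"] by (simp del: S.r_zero)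
qed

lemma rng_hom_diff:
  assumes "rng R" "rng S" "f \<in> rng_hom R S" "x \<in> carrier R" "y \<in> carrier R"
  shows "f (x \<ominus>\<^bsub>R\<^esub> y) = f x \<ominus>\<^bsub>S\<^esub> f y"
proof -
  interpret R: rng R by fact
  interpret S: rng S by fact
  note f = rng_homD[OF assms(3)]
  have "f \<zero>\<^bsub>R\<^esub> = f (\<ominus>\<^bsub>R\<^esub> y) \<oplus>\<^bsub>S\<^esub> f y"
    using f(2)[of "\<ominus>\<^bsub>R\<^esub> y" y] assms(5) by (simp add: R.l_neg)
  then have "f (\<ominus>\<^bsub>R\<^esub> y) \<oplus>\<^bsub>S\<^esub> f y = \<zero>\<^bsub>S\<^esub>" using rng_hom_zero[OF assms(1-3)] by simp
  then have "\<ominus>\<^bsub>S\<^esub> f y = f (\<ominus>\<^bsub>R\<^esub> y)" using f(1) assms(5) by (intro S.minus_equality) simp_all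
  then show ?thesis using f(2)[of x "\<ominus>\<^bsub>R\<^esub> y"] assms(4,5) by (simp add: R.minus_eq S.minus_eq)
qed

lemma rng_hom_join_gen:
  assumes "rng R" "rng S" and f: "f \<in> rng_hom R S"
    and "x \<in> carrier R" "y \<in> carrier R" "g \<in> carrier R" "rng.join_gen R x y g"
  shows "rng.join_gen S (f x) (f y) (f g)"
proof -
  interpret R: rng R by fact
  interpret S: rng S by fact
  note f' = rng_homD[OF f]
  obtain r s t u where *: "r \<in> carrier R" "s \<in> carrier R" "t \<in> carrier R" "u \<in> carrier R"
    "x = g \<otimes>\<^bsub>R\<^esub> r" "y = g \<otimes>\<^bsub>R\<^esub> s" "g = x \<otimes>\<^bsub>R\<^esub> t \<oplus>\<^bsub>R\<^esub> y \<otimes>\<^bsub>R\<^esub> u"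
    using assms(7) unfolding R.join_gen_def by blast
  have "f x = f g \<otimes>\<^bsub>S\<^esub> f r" "f y = f g \<otimes>\<^bsub>S\<^esub> f s"
    using f'(3)[OF assms(6) *(1)] f'(3)[OF assms(6) *(2)] *(5,6) by metis+
  moreover have "f (x \<otimes>\<^bsub>R\<^esub> t \<oplus>\<^bsub>R\<^esub> y \<otimes>\<^bsub>R\<^esub> u) = f x \<otimes>\<^bsub>S\<^esub> f t \<oplus>\<^bsub>S\<^esub> f y \<otimes>\<^bsub>S\<^esub> f u"
    using f' *(3,4) assms(4,5) R.mult_closed by simp
  then have "f g = f x \<otimes>\<^bsub>S\<^esub> f t \<oplus>\<^bsub>S\<^esub> f y \<otimes>\<^bsub>S\<^esub> f u" using *(7) by metis
  ultimately show ?thesis unfolding S.join_gen_def using f'(1) *(1-4) by blast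
qed

lemma rng_hom_meet_gen:
  assumes "rng R" "rng S" and f: "f \<in> rng_hom R S"
    and "x \<in> carrier R" "y \<in> carrier R" "m \<in> carrier R" "rng.meet_gen R x y m"
  shows "rng.meet_gen S (f x) (f y) (f m)"
proof -
  interpret R: rng R by fact
  interpret S: rng S by fact
  note f' = rng_homD[OF f]
  obtain b b' w r s where *: "b \<in> carrier R" "b' \<in> carrier R" "w \<in> carrier R" "r \<in> carrier R" "s \<in> carrier R"
    "x \<otimes>\<^bsub>R\<^esub> b \<otimes>\<^bsub>R\<^esub> x = x" "y \<otimes>\<^bsub>R\<^esub> b' \<otimes>\<^bsub>R\<^esub> y = y" "m = x \<otimes>\<^bsub>R\<^esub> r" "m = y \<otimes>\<^bsub>R\<^esub> s"
    "m = y \<otimes>\<^bsub>R\<^esub> b' \<ominus>\<^bsub>R\<^esub> w \<otimes>\<^bsub>R\<^esub> (y \<otimes>\<^bsub>R\<^esub> b' \<ominus>\<^bsub>R\<^esub> x \<otimes>\<^bsub>R\<^esub> b \<otimes>\<^bsub>R\<^esub> (y \<otimes>\<^bsub>R\<^esub> b'))"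
    using assms(7) unfolding R.meet_gen_def by blast
  have "f (x \<otimes>\<^bsub>R\<^esub> b \<otimes>\<^bsub>R\<^esub> x) = f x \<otimes>\<^bsub>S\<^esub> f b \<otimes>\<^bsub>S\<^esub> f x" "f (y \<otimes>\<^bsub>R\<^esub> b' \<otimes>\<^bsub>R\<^esub> y) = f y \<otimes>\<^bsub>S\<^esub> f b' \<otimes>\<^bsub>S\<^esub> f y"
    using f'(3) *(1,2) assms(4,5) R.mult_closed by simp_all
  then have "f x \<otimes>\<^bsub>S\<^esub> f b \<otimes>\<^bsub>S\<^esub> f x = f x" "f y \<otimes>\<^bsub>S\<^esub> f b' \<otimes>\<^bsub>S\<^esub> f y = f y"
    using *(6,7) by metis+
  moreover have "f m = f x \<otimes>\<^bsub>S\<^esub> f r" using f'(3)[OF assms(4) *(4)] *(8) by metis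
  moreover have "f m = f y \<otimes>\<^bsub>S\<^esub> f s" using f'(3)[OF assms(5) *(5)] *(9) by metis
  moreover have "f (y \<otimes>\<^bsub>R\<^esub> b' \<ominus>\<^bsub>R\<^esub> w \<otimes>\<^bsub>R\<^esub> (y \<otimes>\<^bsub>R\<^esub> b' \<ominus>\<^bsub>R\<^esub> x \<otimes>\<^bsub>R\<^esub> b \<otimes>\<^bsub>R\<^esub> (y \<otimes>\<^bsub>R\<^esub> b'))) =
      f y \<otimes>\<^bsub>S\<^esub> f b' \<ominus>\<^bsub>S\<^esub> f w \<otimes>\<^bsub>S\<^esub> (f y \<otimes>\<^bsub>S\<^esub> f b' \<ominus>\<^bsub>S\<^esub> f x \<otimes>\<^bsub>S\<^esub> f b \<otimes>\<^bsub>S\<^esub> (f y \<otimes>\<^bsub>S\<^esub> f b'))"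
    using f'(3) *(1-3) assms(4,5) R.mult_closed by (simp add: rng_hom_diff[OF assms(1-3)])
  then have "f m = f y \<otimes>\<^bsub>S\<^esub> f b' \<ominus>\<^bsub>S\<^esub> f w \<otimes>\<^bsub>S\<^esub> (f y \<otimes>\<^bsub>S\<^esub> f b' \<ominus>\<^bsub>S\<^esub> f x \<otimes>\<^bsub>S\<^esub> f b \<otimes>\<^bsub>S\<^esub> (f y \<otimes>\<^bsub>S\<^esub> f b'))"
    using *(10) by metis
  ultimately show ?thesis unfolding S.meet_gen_def using f'(1) *(1-5) by blast
qed

definition LL_map :: "'u ring \<Rightarrow> ('u \<Rightarrow> 'u) \<Rightarrow> 'u ring \<Rightarrow> 'u set \<Rightarrow> 'u set" where
  "LL_map R f S = arrow_map (LL_arr (R, f, S))"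

lemma LL_arr_eq: "LL_arr (R, f, S) = (LL_obj R, LL_map R f S, LL_obj S)"
  by (simp add: LL_map_def LL_arr_def)

locale regular_ring_hom = R: regular_ring_record R + S: regular_ring_record S
  for R :: "'u ring" and S :: "'u ring" +
  fixes f
  assumes f: "f \<in> rng_hom R S"
begin

lemmas f_closed = rng_homD(1)[OF f] and f_add = rng_homD(2)[OF f] and f_mult = rng_homD(3)[OF f]

text \<open>This makes the description in \<open>LL_arr\<close> independent of the generator.
  Regularity puts \<open>x\<close> into \<open>yR\<close>, and \<open>x = yr\<close> has the image
  \<open>f x = (f y)(f r)\<close>.\<close>

lemma f_principal_right_ideal_mono:
  assumes "x \<in> carrier R" "y \<in> carrier R" "principal_right_ideal R x \<subseteq> principal_right_ideal R y"
  shows "principal_right_ideal S (f x) \<subseteq> principal_right_ideal S (f y)"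
proof -
  have "x \<in> principal_right_ideal R y" using assms R.self_mem by blast
  then obtain r where r: "r \<in> carrier R" "x = y \<otimes>\<^bsub>R\<^esub> r" by (rule R.principal_right_idealE)
  then have "f x \<in> principal_right_ideal S (f y)"
    using f_mult[of y r] f_closed assms(2) S.principal_right_idealI by metis
  then show ?thesis using S.principal_right_ideal_mono f_closed assms(2) by blast
qed

lemma LL_map_principal_right_ideal:
  assumes "x \<in> carrier R"
  shows "LL_map R f S (principal_right_ideal R x) = principal_right_ideal S (f x)"
proof -
  have "(THE J. \<exists>y\<in>carrier R. principal_right_ideal R x = principal_right_ideal R y \<and>
      J = principal_right_ideal S (f y)) = principal_right_ideal S (f x)"
  proof (rule the_equality)
    show "\<exists>y\<in>carrier R. principal_right_ideal R x = principal_right_ideal R y \<and>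
      principal_right_ideal S (f x) = principal_right_ideal S (f y)"
      using assms by blast
    fix J assume "\<exists>y\<in>carrier R. principal_right_ideal R x = principal_right_ideal R y \<and>
      J = principal_right_ideal S (f y)"
    then obtain y where "y \<in> carrier R" "principal_right_ideal R x = principal_right_ideal R y"
      "J = principal_right_ideal S (f y)" by blast
    then show "J = principal_right_ideal S (f x)"
      using f_principal_right_ideal_mono[OF assms, of y] f_principal_right_ideal_mono[OF _ assms, of y]
      by simp
  qed
  then show ?thesis using R.LL_I[OF assms] by (simp add: LL_map_def LL_arr_def)
qed

lemma LL_map_extensional: "LL_map R f S \<in> extensional (carrier (LL_obj R))"
  by (simp add: LL_map_def LL_arr_def)

text \<open>Intersections are the critical point, since images of sets need not respect them. A
  generator \<open>m\<close> from \<open>ex_meet_gen\<close> comes with equations whose images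
  certify that \<open>f m\<close> generates the intersection in \<open>S\<close>; sums are treated
  likewise with \<open>ex_join_gen\<close>.\<close>

lemma LL_map_hom: "LL_map R f S \<in> zero_lattice_hom (LL_obj R) (LL_obj S)"
  unfolding zero_lattice_hom_def
proof (intro CollectI conjI ballI funcsetI)
  fix I assume "I \<in> carrier (LL_obj R)"
  then show "LL_map R f S I \<in> carrier (LL_obj S)"
    using LL_map_principal_right_ideal S.LL_I f_closed by (auto elim!: R.LL_E)
next
  show "LL_map R f S \<bottom>\<^bsub>LL_obj R\<^esub> = \<bottom>\<^bsub>LL_obj S\<^esub>"
    using LL_map_principal_right_ideal[OF R.zero_closed] rng_hom_zero[OF R.rng_axioms S.rng_axioms f]
    by (simp add: R.bottom_LL S.bottom_LL R.principal_right_ideal_zero S.principal_right_ideal_zero)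
next
  fix I J assume IJ: "I \<in> carrier (LL_obj R)" "J \<in> carrier (LL_obj R)"
  obtain x where x: "x \<in> carrier R" "I = principal_right_ideal R x" by (rule R.LL_E[OF IJ(1)])
  obtain y where y: "y \<in> carrier R" "J = principal_right_ideal R y" by (rule R.LL_E[OF IJ(2)])
  note fx = f_closed[OF x(1)] and fy = f_closed[OF y(1)]
  obtain g where g: "g \<in> carrier R" "R.join_gen x y g" by (rule R.ex_join_gen[OF x(1) y(1)])
  have "I \<squnion>\<^bsub>LL_obj R\<^esub> J = principal_right_ideal R g"
    using R.principal_right_ideal_join_gen[OF x(1) y(1) g] R.join_LL[OF IJ] x y by simp
  moreover have "principal_right_ideal S (f x) \<squnion>\<^bsub>LL_obj S\<^esub> principal_right_ideal S (f y) =
      principal_right_ideal S (f g)"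
    using S.principal_right_ideal_join_gen[OF fx fy f_closed[OF g(1)]
        rng_hom_join_gen[OF R.rng_axioms S.rng_axioms f x(1) y(1) g]]
      S.join_LL[OF S.LL_I[OF fx] S.LL_I[OF fy]] by simp
  ultimately show "LL_map R f S (I \<squnion>\<^bsub>LL_obj R\<^esub> J) = LL_map R f S I \<squnion>\<^bsub>LL_obj S\<^esub> LL_map R f S J"
    using x y g by (simp add: LL_map_principal_right_ideal)
  obtain m where m: "m \<in> carrier R" "R.meet_gen x y m" by (rule R.ex_meet_gen[OF x(1) y(1)])
  have "I \<sqinter>\<^bsub>LL_obj R\<^esub> J = principal_right_ideal R m"
    using R.principal_right_ideal_meet_gen[OF x(1) y(1) m] R.meet_LL[OF IJ] x y by simp
  moreover have "principal_right_ideal S (f x) \<sqinter>\<^bsub>LL_obj S\<^esub> principal_right_ideal S (f y) =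
      principal_right_ideal S (f m)"
    using S.principal_right_ideal_meet_gen[OF fx fy f_closed[OF m(1)]
        rng_hom_meet_gen[OF R.rng_axioms S.rng_axioms f x(1) y(1) m]]
      S.meet_LL[OF S.LL_I[OF fx] S.LL_I[OF fy]] by simp
  ultimately show "LL_map R f S (I \<sqinter>\<^bsub>LL_obj R\<^esub> J) = LL_map R f S I \<sqinter>\<^bsub>LL_obj S\<^esub> LL_map R f S J"
    using x y m by (simp add: LL_map_principal_right_ideal)
qed

lemma LL_map_surj:
  assumes "f ` carrier R = carrier S"
  shows "LL_map R f S ` carrier (LL_obj R) = carrier (LL_obj S)"
proof -
  have "LL_map R f S ` carrier (LL_obj R) = principal_right_ideal S ` f ` carrier R"
    by (auto simp: R.carrier_LL_obj LL_map_principal_right_ideal image_image)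
  then show ?thesis using assms by (simp add: S.carrier_LL_obj)
qed

end

section \<open>Cofinality\<close>

text \<open>Comparison with the disjoint sum \<open>A <+> B\<close>, which is infinite and dominates
  both factors, avoids deciding which factor is larger.\<close>

lemma card_of_Times_ordLess_Cinfinite:
  assumes r: "Cinfinite r" and A: "|A| <o r" and B: "|B| <o r"
  shows "|A \<times> B| <o r"
proof (cases "finite A \<and> finite B")
  case True
  then show ?thesis by (intro finite_ordLess_Cinfinite[OF r] finite_cartesian_product) auto
next
  case False
  define C where "C = A <+> B"
  have C: "infinite C" using False by (auto simp: C_def)
  have "|A \<times> B| \<le>o |C|"
    using card_of_Sigma_ordLeq_infinite[OF C, of A "\<lambda>_. B"] card_of_Plus1 card_of_Plus2
    unfolding C_def by blast
  moreover have "|C| <o r"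
    using card_of_Plus_ordLess_infinite_Field[of r A B] r A B by (simp add: C_def cinfinite_def)
  ultimately show ?thesis by (rule ordLeq_ordLess_trans)
qed

text \<open>The choice operator in \<open>cofinality\<close> gives a usable value only once a
  cofinal set of least cardinality is known to exist; cardinals being well-ordered provides
  one.\<close>

lemma cofinality_ordLeq:
  assumes lam: "Cinfinite lam" and K: "K \<subseteq> Field lam" "cofinal K lam"
  shows "cofinality lam \<le>o |K|"
proof -
  let ?R = "{|K| |K. K \<subseteq> Field lam \<and> cofinal K lam}"
  have "\<exists>r\<in>?R. \<forall>r'\<in>?R. r \<le>o r'"
    by (rule exists_minim_Card_order) (use K in \<open>auto simp: card_of_Card_order\<close>)
  then obtain r where r: "r \<in> ?R" "\<forall>r'\<in>?R. r \<le>o r'" ..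
  then obtain K0 where K0: "r = |K0|" "K0 \<subseteq> Field lam" "cofinal K0 lam" by blast
  have "K0 \<subseteq> Field lam \<and> cofinal K0 lam \<and>
      (\<forall>K'. K' \<subseteq> Field lam \<and> cofinal K' lam \<longrightarrow> |K0| \<le>o |K'| )"
    using K0(2,3) r(2) unfolding K0(1) by (intro conjI allI impI) (assumption+, blast)
  then have "\<forall>K'. K' \<subseteq> Field lam \<and> cofinal K' lam \<longrightarrow> cofinality lam \<le>o |K'|"
    unfolding cofinality_def by (rule someI2) (elim conjE)
  then show ?thesis using K by simp
qed

lemma cofinality_ordLeq_self:
  assumes lam: "Cinfinite lam"
  shows "cofinality lam \<le>o lam"
proof -
  \<comment> \<open>\<open>cofinal\<close> asks for strictly larger elements; an infinite cardinal
    order has no last element.\<close>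
  have "cofinal (Field lam) lam"
    unfolding cofinal_def using infinite_Card_order_limit[of lam] lam by (simp add: cinfinite_def)
  then have "cofinality lam \<le>o |Field lam|" using cofinality_ordLeq[OF lam] by blast
  then show ?thesis using card_of_Field_ordIso lam ordLeq_ordIso_trans by blast
qed

text \<open>Each \<open>A i\<close> is no larger than the initial segment of \<open>lam\<close>
  below some \<open>a i\<close>. As \<open>I\<close> is smaller than the cofinality, a single
  \<open>c\<close> bounds all \<open>a i\<close>, so the union is no larger than
  \<open>I \<times> underS lam c\<close>, a product of two sets smaller than
  \<open>lam\<close>.\<close>

lemma card_of_UNION_ordLess_cofinality:
  assumes lam: "Cinfinite lam" and I: "|I| <o cofinality lam" and A: "\<And>i. i \<in> I \<Longrightarrow> |A i| <o lam"
  shows "|\<Union>i\<in>I. A i| <o lam"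
proof -
  have co: "Card_order lam" and wo: "Well_order lam" using lam card_order_on_well_order_on by blast+
  have "\<exists>a\<in>Field lam. |A i| \<le>o |underS lam a|" if i: "i \<in> I" for i
  proof -
    obtain a where a: "a \<in> Field lam" "|A i| =o Restr lam (underS lam a)"
      using A[OF i] ordLess_iff_ordIso_Restr[OF wo card_of_Well_order] by blast
    have "|Field |A i| | \<le>o |Field (Restr lam (underS lam a))|"
      using card_of_mono2 a(2) ordIso_imp_ordLeq by blast
    moreover have "|Field (Restr lam (underS lam a))| \<le>o |underS lam a|"
      by (rule card_of_mono1) (rule Field_Restr_subset)
    ultimately show ?thesis using a(1) ordLeq_transitive by (auto simp: Field_card_of)
  qed
  then obtain a where a: "\<And>i. i \<in> I \<Longrightarrow> a i \<in> Field lam" "\<And>i. i \<in> I \<Longrightarrow> |A i| \<le>o |underS lam (a i)|"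
    by metis
  have "\<not> cofinal (a ` I) lam"
  proof
    assume "cofinal (a ` I) lam"
    then have "cofinality lam \<le>o |a ` I|" using cofinality_ordLeq[OF lam, of "a ` I"] a(1) by blast
    then have "cofinality lam \<le>o |I|" using card_of_image ordLeq_transitive by blast
    then show False using I not_ordLess_ordLeq by blast
  qed
  then obtain c where c: "c \<in> Field lam" "\<And>i. i \<in> I \<Longrightarrow> \<not> (c \<noteq> a i \<and> (c, a i) \<in> lam)"
    unfolding cofinal_def by blast
  have wr: "wo_rel lam" using wo by (simp add: wo_rel_def)
  have "|A i| \<le>o |underS lam c|" if i: "i \<in> I" for i
  proof -
    have "(a i, c) \<in> lam"
      using wo_rel.in_notinI[OF wr _ a(1)[OF i] c(1)] c(2)[OF i] by blast
    then have "underS lam (a i) \<subseteq> underS lam c"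
      using underS_incr[of lam "a i" c] wo_rel.TRANS[OF wr] wo_rel.ANTISYM[OF wr] by blast
    then show ?thesis using a(2)[OF i] card_of_mono1 ordLeq_transitive by blast
  qed
  then have "|SIGMA i:I. A i| \<le>o |I \<times> underS lam c|" by (intro card_of_Sigma_mono1 ballI)
  moreover have "|I \<times> underS lam c| <o lam"
    by (rule card_of_Times_ordLess_Cinfinite[OF lam
        ordLess_ordLeq_trans[OF I cofinality_ordLeq_self[OF lam]] card_of_underS[OF co c(1)]])
  ultimately show ?thesis
    by (rule ordLeq_ordLess_trans[OF ordLeq_transitive[OF card_of_UNION_Sigma]])
qed

section \<open>Quotients\<close>

text \<open>Every axiom is an equation between images and is pulled back to \<open>R\<close>. The
  value at zero is assumed because \<open>S\<close> is not yet known to be a group, so cancellation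
  cannot supply it.\<close>

lemma rng_image:
  fixes R (structure) and S :: "('b, 'd) ring_scheme"
  assumes R: "rng R" and f: "f \<in> rng_hom R S" "f ` carrier R = carrier S" "f \<zero>\<^bsub>R\<^esub> = \<zero>\<^bsub>S\<^esub>"
  shows "rng S"
proof -
  interpret rng R by (rule R)
  note f1 = rng_homD[OF f(1)]
  have pre: "\<exists>x\<in>carrier R. u = f x" if "u \<in> carrier S" for u using f(2) that by auto
  have hom: "f x \<oplus>\<^bsub>S\<^esub> f y = f (x \<oplus> y)" "f x \<otimes>\<^bsub>S\<^esub> f y = f (x \<otimes> y)"
    if "x \<in> carrier R" "y \<in> carrier R" for x y using f1 that by simp_all
  note zero = f(3)[symmetric]
  show ?thesis
  proof (intro rng.intro rng_axioms.intro abelian_groupI)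
    fix u v assume uv: "u \<in> carrier S" "v \<in> carrier S"
    obtain x where x: "x \<in> carrier R" "u = f x" using pre[OF uv(1)] by (elim bexE)
    obtain y where y: "y \<in> carrier R" "v = f y" using pre[OF uv(2)] by (elim bexE)
    note * = x(1) y(1) x(2) y(2)
    show "u \<oplus>\<^bsub>S\<^esub> v \<in> carrier S" "u \<otimes>\<^bsub>S\<^esub> v \<in> carrier S" "u \<oplus>\<^bsub>S\<^esub> v = v \<oplus>\<^bsub>S\<^esub> u"
      using * f1(1) by (simp_all add: hom mult_closed a_comm)
    fix w assume w: "w \<in> carrier S"
    obtain z where z: "z \<in> carrier R" "w = f z" using pre[OF w] by (elim bexE)
    show "u \<oplus>\<^bsub>S\<^esub> v \<oplus>\<^bsub>S\<^esub> w = u \<oplus>\<^bsub>S\<^esub> (v \<oplus>\<^bsub>S\<^esub> w)" "u \<otimes>\<^bsub>S\<^esub> v \<otimes>\<^bsub>S\<^esub> w = u \<otimes>\<^bsub>S\<^esub> (v \<otimes>\<^bsub>S\<^esub> w)"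
      "(u \<oplus>\<^bsub>S\<^esub> v) \<otimes>\<^bsub>S\<^esub> w = u \<otimes>\<^bsub>S\<^esub> w \<oplus>\<^bsub>S\<^esub> v \<otimes>\<^bsub>S\<^esub> w" "w \<otimes>\<^bsub>S\<^esub> (u \<oplus>\<^bsub>S\<^esub> v) = w \<otimes>\<^bsub>S\<^esub> u \<oplus>\<^bsub>S\<^esub> w \<otimes>\<^bsub>S\<^esub> v"
      using * z by (simp_all add: hom mult_closed a_assoc mult_assoc distrib_left distrib_right)
  next
    show "\<zero>\<^bsub>S\<^esub> \<in> carrier S" using f1(1) by (simp add: zero)
    fix u assume u: "u \<in> carrier S"
    obtain x where x: "x \<in> carrier R" "u = f x" using pre[OF u] by (elim bexE)
    show "\<zero>\<^bsub>S\<^esub> \<oplus>\<^bsub>S\<^esub> u = u" using x by (simp add: zero hom)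
    have "f (\<ominus> x) \<oplus>\<^bsub>S\<^esub> u = \<zero>\<^bsub>S\<^esub>" using x by (simp add: zero hom l_neg)
    then show "\<exists>y\<in>carrier S. y \<oplus>\<^bsub>S\<^esub> u = \<zero>\<^bsub>S\<^esub>" using f1(1) x(1) by blast
  qed
qed

text \<open>The quotient lives on a set of coset representatives, so that it is again a ring on the
  same type.\<close>

lemma (in rng) quotient_exists:
  assumes I: "I \<subseteq> carrier R" "\<zero> \<in> I" "\<And>a b. \<lbrakk>a \<in> I; b \<in> I\<rbrakk> \<Longrightarrow> a \<ominus> b \<in> I"
    "\<And>a r. \<lbrakk>a \<in> I; r \<in> carrier R\<rbrakk> \<Longrightarrow> a \<otimes> r \<in> I" "\<And>a r. \<lbrakk>a \<in> I; r \<in> carrier R\<rbrakk> \<Longrightarrow> r \<otimes> a \<in> I"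
  obtains Q :: "'a ring" and \<pi> where "rng Q" "\<pi> \<in> rng_hom R Q" "\<pi> \<in> extensional (carrier R)"
    "\<pi> ` carrier R = carrier Q"
    "\<And>x y. \<lbrakk>x \<in> carrier R; y \<in> carrier R\<rbrakk> \<Longrightarrow> \<pi> x = \<pi> y \<longleftrightarrow> x \<ominus> y \<in> I"
proof -
  define rep where "rep x = (SOME y. y \<in> carrier R \<and> x \<ominus> y \<in> I)" for x
  have rep: "rep x \<in> carrier R" "x \<ominus> rep x \<in> I" if "x \<in> carrier R" for x
  proof -
    have "x \<in> carrier R \<and> x \<ominus> x \<in> I" using that I(2) by simp
    then have "rep x \<in> carrier R \<and> x \<ominus> rep x \<in> I" unfolding rep_def by (rule someI)
    then show "rep x \<in> carrier R" "x \<ominus> rep x \<in> I" by auto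
  qed
  have shift: "(x \<ominus> u) \<ominus> (x \<ominus> y) = y \<ominus> u" "(x \<ominus> u) \<ominus> (y \<ominus> u) = x \<ominus> y"
    if "x \<in> carrier R" "y \<in> carrier R" "u \<in> carrier R" for x y u
    using that add_diff_left[of "x \<ominus> y" "y \<ominus> u"] add_diff_right[of "x \<ominus> y" "y \<ominus> u"]
    by (simp_all add: diff_add_diff)
  have sym: "y \<ominus> x \<in> I" if "x \<in> carrier R" "y \<in> carrier R" "x \<ominus> y \<in> I" for x y
    using I(3)[OF I(2) that(3)] that by (simp add: minus_eq minus_add a_ac)
  have rep_eq: "rep x = rep y \<longleftrightarrow> x \<ominus> y \<in> I" if R: "x \<in> carrier R" "y \<in> carrier R" for x y
  proof
    assume "rep x = rep y"
    then show "x \<ominus> y \<in> I" using I(3)[OF rep(2)[OF R(1)]  rep(2)[OF R(2)]] shift(2) rep(1) R by simp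
  next
    assume *: "x \<ominus> y \<in> I"
    \<comment> \<open>For congruent \<open>x\<close> and \<open>y\<close> the two predicates under
      \<open>SOME\<close> hold for the same \<open>u\<close>, so the same representative is
      chosen.\<close>
    have "x \<ominus> u \<in> I \<longleftrightarrow> y \<ominus> u \<in> I" if "u \<in> carrier R" for u
      using shift(1)[OF R that] shift(1)[OF R(2,1) that] I(3) * sym[OF R *] by metis
    then show "rep x = rep y" unfolding rep_def by (metis (no_types, lifting))
  qed
  define Q where "Q = \<lparr>carrier = rep ` carrier R, mult = \<lambda>x y. rep (x \<otimes> y), one = undefined,
    zero = rep \<zero>, add = \<lambda>x y. rep (x \<oplus> y)\<rparr>"
  define \<pi> where "\<pi> = restrict rep (carrier R)"
  have add: "rep (x \<oplus> y) = rep (rep x \<oplus> rep y)" if R: "x \<in> carrier R" "y \<in> carrier R" for x y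
  proof -
    have "(x \<oplus> y) \<ominus> (rep x \<oplus> rep y) = (x \<ominus> rep x) \<ominus> (rep y \<ominus> y)"
      using R rep(1) by (simp add: minus_eq minus_add a_ac minus_minus)
    also have "\<dots> \<in> I" using I(3) rep R sym[OF R(2) rep(1)] by blast
    finally show ?thesis using rep_eq rep R by simp
  qed
  have mult: "rep (x \<otimes> y) = rep (rep x \<otimes> rep y)" if R: "x \<in> carrier R" "y \<in> carrier R" for x y
  proof -
    \<comment> \<open>The error is split so that the first term calls for closure of
      \<open>I\<close> under right multiplication and the second for closure under left
      multiplication.\<close>
    have "x \<otimes> y \<ominus> rep x \<otimes> rep y = (x \<ominus> rep x) \<otimes> y \<ominus> rep x \<otimes> (rep y \<ominus> y)"
      using R rep(1) by (simp add: diff_mult mult_diff mult_closed)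
        (simp add: minus_eq minus_add a_ac minus_minus mult_closed r_neg1 r_neg2)
    also have "\<dots> \<in> I"
      using I(3) I(4)[OF rep(2)[OF R(1)] R(2)] I(5)[OF sym[OF R(2) rep(1) rep(2)] rep(1)[OF R(1)]] R by blast
    finally show ?thesis using rep_eq rep R mult_closed by simp
  qed
  have hom: "\<pi> \<in> rng_hom R Q"
    by (auto simp: rng_hom_def Q_def \<pi>_def mult_closed intro: add mult)
  have surj: "\<pi> ` carrier R = carrier Q" by (auto simp: \<pi>_def Q_def)
  have "rng Q" by (rule rng_image[OF rng_axioms hom surj]) (simp add: \<pi>_def Q_def)
  then show ?thesis using that hom surj rep_eq by (simp add: \<pi>_def)
qed

text \<open>For projectability this is applied twice with two surjections in exchanged roles; as
  they identify the same pairs, the two factors are mutually inverse.\<close>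

lemma zero_lattice_hom_factor:
  assumes L: "lattice L" "weak_partial_order_bottom L"
    and p: "p \<in> zero_lattice_hom L M" "p ` carrier L = carrier M"
    and q: "q \<in> zero_lattice_hom L N"
    and ker: "\<And>x y. \<lbrakk>x \<in> carrier L; y \<in> carrier L; p x = p y\<rbrakk> \<Longrightarrow> q x = q y"
  obtains h where "h \<in> zero_lattice_hom M N" "h \<in> extensional (carrier M)"
    "\<And>x. x \<in> carrier L \<Longrightarrow> h (p x) = q x"
proof -
  interpret lattice L by fact
  interpret weak_partial_order_bottom L by fact
  note pD = zero_lattice_homD[OF p(1)] and qD = zero_lattice_homD[OF q]
  define h where "h = (\<lambda>y\<in>carrier M. q (SOME x. x \<in> carrier L \<and> p x = y))"
  have h: "h (p x) = q x" if x: "x \<in> carrier L" for x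
  proof -
    have "x \<in> carrier L \<and> p x = p x" using x by simp
    then have "(SOME x'. x' \<in> carrier L \<and> p x' = p x) \<in> carrier L \<and> p (SOME x'. x' \<in> carrier L \<and> p x' = p x) = p x"
      by (rule someI)
    then show ?thesis unfolding h_def using pD(1)[OF x] ker[OF _ x] by auto
  qed
  have "h \<in> zero_lattice_hom M N"
    unfolding zero_lattice_hom_def
  proof (intro CollectI conjI ballI funcsetI)
    fix y assume "y \<in> carrier M"
    then obtain x where "x \<in> carrier L" "y = p x" using p(2) by blast
    then show "h y \<in> carrier N" using h qD(1) by simp
  next
    show "h \<bottom>\<^bsub>M\<^esub> = \<bottom>\<^bsub>N\<^esub>" using h[OF bottom_closed] pD(2) qD(2) by simp
  next
    fix y y' assume "y \<in> carrier M" "y' \<in> carrier M"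
    then obtain x x' where x: "x \<in> carrier L" "y = p x" "x' \<in> carrier L" "y' = p x'"
      using p(2) by blast
    show "h (y \<squnion>\<^bsub>M\<^esub> y') = h y \<squnion>\<^bsub>N\<^esub> h y'" "h (y \<sqinter>\<^bsub>M\<^esub> y') = h y \<sqinter>\<^bsub>N\<^esub> h y'"
      using x h pD(3,4) qD(3,4) join_closed[OF x(1,3)] meet_closed[OF x(1,3)] by metis+
  qed
  then show ?thesis using that h by (simp add: h_def)
qed

section \<open>Kernels of homomorphisms out of the lattice of principal right ideals\<close>

locale LL_hom = regular_ring_record R + S: sc_modular_lattice S
  for R :: "'u ring" (structure) and S :: "'e gorder" +
  fixes \<phi> :: "'u set \<Rightarrow> 'e"
  assumes \<phi>: "\<phi> \<in> zero_lattice_hom (LL_obj R) S"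
begin

abbreviation pri :: "'u \<Rightarrow> 'u set" where "pri \<equiv> principal_right_ideal R"

definition kernel_ideal :: "'u set" where
  "kernel_ideal = {x \<in> carrier R. \<phi> (pri x) = \<bottom>\<^bsub>S\<^esub>}"

lemmas \<phi>D = zero_lattice_homD[OF \<phi>]

lemma \<phi>_closed: "x \<in> carrier R \<Longrightarrow> \<phi> (pri x) \<in> carrier S"
  using \<phi>D(1) LL_I by blast

lemma \<phi>_mono:
  "\<lbrakk>I \<in> carrier (LL_obj R); J \<in> carrier (LL_obj R); I \<subseteq> J\<rbrakk> \<Longrightarrow> \<phi> I \<sqsubseteq>\<^bsub>S\<^esub> \<phi> J"
  using zero_lattice_hom_mono[OF lattice_LL S.lattice_axioms \<phi>] le_LL_obj by blast

lemma le_bottom: "\<lbrakk>s \<in> carrier S; s \<sqsubseteq>\<^bsub>S\<^esub> \<bottom>\<^bsub>S\<^esub>\<rbrakk> \<Longrightarrow> s = \<bottom>\<^bsub>S\<^esub>"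
  using S.le_antisym S.bottom_lower S.bottom_closed by blast

lemma bottom_join: "s \<in> carrier S \<Longrightarrow> s \<squnion>\<^bsub>S\<^esub> \<bottom>\<^bsub>S\<^esub> = s"
  by (rule S.join_eqI) auto

text \<open>Translates an additive decomposition in the ring into an inequality in \<open>S\<close>;
  the closure properties of the kernel and the criterion \<open>\<phi>_le_iff\<close> rest on
  it.\<close>

lemma pri_le_sum:
  assumes "x \<in> carrier R" "y \<in> carrier R" "z \<in> sum_set (pri x) (pri y)"
  shows "\<phi> (pri z) \<sqsubseteq>\<^bsub>S\<^esub> \<phi> (pri x) \<squnion>\<^bsub>S\<^esub> \<phi> (pri y)"
proof -
  note xy = LL_I[OF assms(1)] LL_I[OF assms(2)]
  have sum: "sum_set (pri x) (pri y) \<in> carrier (LL_obj R)" by (rule LL_sum_closed[OF xy])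
  then obtain g where g: "g \<in> carrier R" "sum_set (pri x) (pri y) = pri g" by (rule LL_E)
  have z: "z \<in> carrier R" using LL_ideal(1)[OF sum] assms(3) by blast
  have "pri z \<subseteq> sum_set (pri x) (pri y)" using principal_right_ideal_mono g assms(3) by simp
  then have "\<phi> (pri z) \<sqsubseteq>\<^bsub>S\<^esub> \<phi> (sum_set (pri x) (pri y))" by (rule \<phi>_mono[OF LL_I[OF z] sum])
  then show ?thesis using \<phi>D(3)[OF xy] join_LL[OF xy] by simp
qed

text \<open>Formulated for all of \<open>xR + yR\<close>, so that differences, right multiples and
  the splitting in \<open>kernel_ideal_left_mult\<close> are instances.\<close>

lemma kernel_ideal_sum:
  assumes "x \<in> kernel_ideal" "y \<in> kernel_ideal" "z \<in> sum_set (pri x) (pri y)"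
  shows "z \<in> kernel_ideal"
proof -
  have R: "x \<in> carrier R" "y \<in> carrier R" using assms by (auto simp: kernel_ideal_def)
  have z: "z \<in> carrier R"
    using LL_ideal(1)[OF LL_sum_closed[OF LL_I[OF R(1)] LL_I[OF R(2)]]] assms(3) by blast
  have "\<phi> (pri z) \<sqsubseteq>\<^bsub>S\<^esub> \<bottom>\<^bsub>S\<^esub>"
    using pri_le_sum[OF R assms(3)] assms(1,2) bottom_join[OF S.bottom_closed] by (simp add: kernel_ideal_def)
  then show ?thesis using le_bottom \<phi>_closed z by (simp add: kernel_ideal_def)
qed

lemma kernel_ideal_mem:
  assumes "x \<in> kernel_ideal" "z \<in> pri x"
  shows "z \<in> kernel_ideal"
proof (rule kernel_ideal_sum[OF assms(1) assms(1)])
  have "x \<in> carrier R" using assms(1) by (simp add: kernel_ideal_def)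
  then show "z \<in> sum_set (pri x) (pri x)" using LL_sum_upper(1) LL_I assms(2) by blast
qed

text \<open>If \<open>xR\<close> and \<open>rxR\<close> are disjoint, then \<open>(x + rx)R\<close> is the graph of left multiplication by \<open>r\<close> on
  \<open>xR\<close>; it is disjoint from \<open>rxR\<close>, and together with \<open>xR\<close> it generates \<open>rxR\<close>.\<close>

lemma kernel_ideal_disjoint_mult:
  assumes x: "x \<in> kernel_ideal" and r: "r \<in> carrier R" and disj: "pri x \<inter> pri (r \<otimes> x) = {\<zero>}"
  shows "r \<otimes> x \<in> kernel_ideal"
proof -
  have xR: "x \<in> carrier R" and \<phi>x: "\<phi> (pri x) = \<bottom>\<^bsub>S\<^esub>" using x by (auto simp: kernel_ideal_def)
  define y where "y = r \<otimes> x"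
  define g where "g = x \<oplus> y"
  have y: "y \<in> carrier R" using r xR by (simp add: y_def mult_closed)
  have g: "g \<in> carrier R" using xR y by (simp add: g_def)
  have "pri g \<inter> pri y = {\<zero>}"
  proof
    show "{\<zero>} \<subseteq> pri g \<inter> pri y" using zero_mem_principal_right_ideal g y by simp
    show "pri g \<inter> pri y \<subseteq> {\<zero>}"
    proof
      fix z assume "z \<in> pri g \<inter> pri y"
      then obtain s t where st: "s \<in> carrier R" "z = g \<otimes> s" "t \<in> carrier R" "z = y \<otimes> t"
        by (blast elim: principal_right_idealE)
      have z: "z \<in> carrier R" using st(1,2) g by (simp add: mult_closed)
      have gs: "g \<otimes> s = x \<otimes> s \<oplus> y \<otimes> s" using xR y st by (simp add: g_def distrib_right)
      have "x \<otimes> s = z \<ominus> y \<otimes> s"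
        unfolding st(2) gs using xR y st(1) by (simp add: add_diff_right mult_closed)
      also have "\<dots> \<in> pri y"
        using principal_right_ideal_diff[OF y] st(1,3,4) principal_right_idealI by blast
      finally have "x \<otimes> s \<in> pri x \<inter> pri y" using st(1) principal_right_idealI by blast
      then have xs: "x \<otimes> s = \<zero>" using disj by (simp add: y_def)
      \<comment> \<open>Since \<open>y = rx\<close>, the relation \<open>xs = 0\<close> passes to
        \<open>ys = 0\<close>, and both summands of \<open>z = gs\<close> vanish.\<close>
      then have "y \<otimes> s = \<zero>" using r xR st(1) by (simp add: y_def mult_assoc)
      then show "z \<in> {\<zero>}" using gs xs st(2) by simp
    qed
  qed
  then have "\<phi> (pri g) \<sqinter>\<^bsub>S\<^esub> \<phi> (pri y) = \<bottom>\<^bsub>S\<^esub>"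
    using \<phi>D(4)[OF LL_I[OF g] LL_I[OF y]] meet_LL[OF LL_I[OF g] LL_I[OF y]] \<phi>D(2) by (simp add: bottom_LL)
  moreover have "\<phi> (pri y) \<sqsubseteq>\<^bsub>S\<^esub> \<phi> (pri g)"
  proof -
    have "y = g \<ominus> x" unfolding g_def using add_diff_left[OF xR y] by simp
    also have "\<dots> = g \<oplus> (\<ominus> x)" by (simp add: minus_eq)
    finally have "y = g \<oplus> (\<ominus> x)" .
    moreover have "\<ominus> x \<in> pri x"
      using principal_right_ideal_diff[OF xR zero_mem_principal_right_ideal[OF xR] self_mem[OF xR]] xR
      by (simp add: minus_eq)
    ultimately have "y \<in> sum_set (pri g) (pri x)"
      using self_mem[OF g] unfolding sum_set_def by blast
    then show ?thesis using pri_le_sum[OF g xR] \<phi>x bottom_join \<phi>_closed[OF g] by simp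
  qed
  \<comment> \<open>As \<open>\<phi> (pri y)\<close> lies below \<open>\<phi> (pri g)\<close>, their
    meet is \<open>\<phi> (pri y)\<close>, and that meet is bottom.\<close>
  ultimately have "\<phi> (pri y) = \<bottom>\<^bsub>S\<^esub>"
    using S.meet_eqI[OF \<phi>_closed[OF g] \<phi>_closed[OF y] \<phi>_closed[OF y]] \<phi>_closed[OF y] by auto
  then show ?thesis using y by (simp add: kernel_ideal_def y_def)
qed

text \<open>The disjoint case applies after removing the component of \<open>r\<close> along
  \<open>e = xb\<close>: \<open>r' = r - er\<close> has \<open>er' = 0\<close>, whereas
  \<open>e\<close> fixes \<open>xR\<close> pointwise, so \<open>xR\<close> and \<open>r'xR\<close>
  meet in zero. The removed part \<open>erx\<close> already lies in \<open>xR\<close>.\<close>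

lemma kernel_ideal_left_mult:
  assumes x: "x \<in> kernel_ideal" and r: "r \<in> carrier R"
  shows "r \<otimes> x \<in> kernel_ideal"
proof -
  have xR: "x \<in> carrier R" using x by (auto simp: kernel_ideal_def)
  obtain b where b: "b \<in> carrier R" "x \<otimes> b \<otimes> x = x" using regular xR by blast
  define e where "e = x \<otimes> b"
  define r' where "r' = r \<ominus> e \<otimes> r"
  have e: "e \<in> carrier R" "e \<otimes> x = x" using xR b by (simp_all add: e_def mult_closed)
  have r': "r' \<in> carrier R" using e r by (simp add: r'_def mult_closed)
  have ee: "e \<otimes> e = e" using e xR b(1) by (simp add: e_def flip: mult_assoc)
  have er': "e \<otimes> r' = \<zero>"
  proof -
    have "e \<otimes> r' = e \<otimes> r \<ominus> e \<otimes> e \<otimes> r" using e r by (simp add: r'_def mult_diff mult_assoc mult_closed)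
    then show ?thesis using ee e r by (simp add: mult_closed)
  qed
  have "pri x \<inter> pri (r' \<otimes> x) = {\<zero>}"
  proof
    show "{\<zero>} \<subseteq> pri x \<inter> pri (r' \<otimes> x)" using zero_mem_principal_right_ideal xR r' mult_closed by simp
    show "pri x \<inter> pri (r' \<otimes> x) \<subseteq> {\<zero>}"
    proof
      fix z assume "z \<in> pri x \<inter> pri (r' \<otimes> x)"
      then obtain s t where st: "s \<in> carrier R" "z = x \<otimes> s" "t \<in> carrier R" "z = r' \<otimes> x \<otimes> t"
        by (blast elim: principal_right_idealE)
      have "e \<otimes> z = z" using e st(1,2) xR by (simp flip: mult_assoc)
      moreover have "e \<otimes> z = \<zero>" using er' e r' xR st(3,4) by (simp add: mult_closed flip: mult_assoc)
      ultimately show "z \<in> {\<zero>}" by simp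
    qed
  qed
  then have r'x: "r' \<otimes> x \<in> kernel_ideal" by (rule kernel_ideal_disjoint_mult[OF x r'])
  have "r' \<otimes> x = r \<otimes> x \<ominus> e \<otimes> r \<otimes> x" using e r xR by (simp add: r'_def diff_mult mult_closed)
  then have "r \<otimes> x = e \<otimes> r \<otimes> x \<oplus> r' \<otimes> x"
    using add_diff_cancel[of "e \<otimes> r \<otimes> x" "r \<otimes> x"] e r xR by (simp add: mult_closed)
  moreover have "e \<otimes> r \<otimes> x \<in> pri x"
    using principal_right_idealI[of "b \<otimes> r \<otimes> x" _ x] b r xR by (simp add: e_def mult_assoc mult_closed)
  moreover have "r' \<otimes> x \<in> pri (r' \<otimes> x)" using self_mem r' xR mult_closed by simp
  ultimately have "r \<otimes> x \<in> sum_set (pri x) (pri (r' \<otimes> x))" unfolding sum_set_def by blast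
  then show ?thesis by (rule kernel_ideal_sum[OF x r'x])
qed

lemma kernel_ideal_diff:
  assumes "x \<in> kernel_ideal" "y \<in> kernel_ideal"
  shows "x \<ominus> y \<in> kernel_ideal"
proof (rule kernel_ideal_sum[OF assms])
  have R: "x \<in> carrier R" "y \<in> carrier R" using assms by (auto simp: kernel_ideal_def)
  have "\<ominus> y \<in> pri y"
    using principal_right_ideal_diff[OF R(2) zero_mem_principal_right_ideal[OF R(2)] self_mem[OF R(2)]] R
    by (simp add: minus_eq)
  then show "x \<ominus> y \<in> sum_set (pri x) (pri y)"
    using self_mem[OF R(1)] unfolding sum_set_def minus_eq by blast
qed

lemma kernel_ideal_zero: "\<zero> \<in> kernel_ideal"
  using \<phi>D(2) by (simp add: kernel_ideal_def bottom_LL principal_right_ideal_zero)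

text \<open>Forward, \<open>xR\<close> is split into its intersection with \<open>yR\<close> and a
  relative complement \<open>K\<close>. Since \<open>K\<close> meets \<open>yR\<close> in zero while
  \<open>\<phi> K\<close> lies below \<open>\<phi> (pri y)\<close>, the value
  \<open>\<phi> K\<close> is bottom, and the \<open>K\<close>-part of \<open>x\<close> is the
  required error. Conversely \<open>x\<close> is the sum of \<open>yr\<close> and a kernel
  element.\<close>

lemma \<phi>_le_iff:
  assumes x: "x \<in> carrier R" and y: "y \<in> carrier R"
  shows "\<phi> (pri x) \<sqsubseteq>\<^bsub>S\<^esub> \<phi> (pri y) \<longleftrightarrow> (\<exists>r\<in>carrier R. x \<ominus> y \<otimes> r \<in> kernel_ideal)"
proof
  assume le: "\<phi> (pri x) \<sqsubseteq>\<^bsub>S\<^esub> \<phi> (pri y)"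
  interpret L: sc_modular_lattice "LL_obj R" by (rule sc_modular_lattice_LL)
  note X = LL_I[OF x] and Y = LL_I[OF y]
  have XY: "pri x \<inter> pri y \<in> carrier (LL_obj R)" by (rule LL_Int_closed[OF X Y])
  have "pri x \<inter> pri y \<sqsubseteq>\<^bsub>LL_obj R\<^esub> pri x" by (simp add: le_LL_obj)
  from L.sectional_complement[OF XY X this] obtain K where K: "K \<in> carrier (LL_obj R)"
    "(pri x \<inter> pri y) \<squnion>\<^bsub>LL_obj R\<^esub> K = pri x" "(pri x \<inter> pri y) \<sqinter>\<^bsub>LL_obj R\<^esub> K = \<bottom>\<^bsub>LL_obj R\<^esub>" by blast
  obtain k where k: "k \<in> carrier R" "K = pri k" by (rule LL_E[OF K(1)])
  have KX: "K \<subseteq> pri x" using LL_sum_upper(2)[OF XY K(1)] K(2) join_LL[OF XY K(1)] by simp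
  have "\<phi> K \<sqsubseteq>\<^bsub>S\<^esub> \<phi> (pri y)"
    using S.le_trans[OF \<phi>_mono[OF K(1) X KX] le] \<phi>D(1) K(1) X Y by blast
  then have "\<phi> K = \<phi> K \<sqinter>\<^bsub>S\<^esub> \<phi> (pri y)" using S.le_iff_join \<phi>D(1) K(1) Y by blast
  also have "\<dots> = \<phi> (K \<inter> pri y)" using \<phi>D(4)[OF K(1) Y] meet_LL[OF K(1) Y] by simp
  also have "K \<inter> pri y = pri x \<inter> pri y \<inter> K" using KX by blast
  also have "\<dots> = \<bottom>\<^bsub>LL_obj R\<^esub>" using K(3) meet_LL[OF XY K(1)] by simp
  also have "\<phi> \<dots> = \<bottom>\<^bsub>S\<^esub>" by (rule \<phi>D(2))
  finally have kI: "k \<in> kernel_ideal" using k by (simp add: kernel_ideal_def)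
  have "x \<in> sum_set (pri x \<inter> pri y) K" using K(2) join_LL[OF XY K(1)] self_mem[OF x] by simp
  then obtain a c where ac: "a \<in> pri x \<inter> pri y" "c \<in> K" "x = a \<oplus> c" unfolding sum_set_def by blast
  obtain r where r: "r \<in> carrier R" "a = y \<otimes> r" using ac(1) by (blast elim: principal_right_idealE)
  have c: "c \<in> kernel_ideal" using kernel_ideal_mem[OF kI] ac(2) k by simp
  then have cR: "c \<in> carrier R" by (simp add: kernel_ideal_def)
  have aR: "a \<in> carrier R" using y r by (simp add: mult_closed)
  have "x \<ominus> y \<otimes> r = c"
    unfolding ac(3) r(2)[symmetric] by (rule add_diff_left[OF aR cR])
  then show "\<exists>r\<in>carrier R. x \<ominus> y \<otimes> r \<in> kernel_ideal" using r(1) c by metis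
next
  assume "\<exists>r\<in>carrier R. x \<ominus> y \<otimes> r \<in> kernel_ideal"
  then obtain r where r: "r \<in> carrier R" "x \<ominus> y \<otimes> r \<in> kernel_ideal" by blast
  define u where "u = x \<ominus> y \<otimes> r"
  have u: "u \<in> carrier R" "\<phi> (pri u) = \<bottom>\<^bsub>S\<^esub>" using r(2) by (simp_all add: kernel_ideal_def u_def)
  have "x = y \<otimes> r \<oplus> u" using add_diff_cancel[of "y \<otimes> r" x] x y r(1) by (simp add: u_def mult_closed)
  moreover have "y \<otimes> r \<in> pri y" using r(1) principal_right_idealI by blast
  ultimately have "x \<in> sum_set (pri y) (pri u)" using self_mem[OF u(1)] unfolding sum_set_def by blast
  then show "\<phi> (pri x) \<sqsubseteq>\<^bsub>S\<^esub> \<phi> (pri y)"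
    using pri_le_sum[OF y u(1)] u(2) bottom_join \<phi>_closed[OF y] by simp
qed

end

section \<open>The larder\<close>

lemma Obj_Reg: "R \<in> Obj (Reg \<kappa>) \<longleftrightarrow> regular_rng R \<and> |carrier R| <o \<kappa>"
  by (simp add: Reg_def)

lemma Hom_Reg:
  "\<phi> \<in> Hom (Reg \<kappa>) A B \<longleftrightarrow> A \<in> Obj (Reg \<kappa>) \<and> B \<in> Obj (Reg \<kappa>) \<and>
     \<phi> = (A, arrow_map \<phi>, B) \<and> arrow_map \<phi> \<in> rng_hom A B \<and>
     arrow_map \<phi> \<in> extensional (carrier A)"
  unfolding Reg_def Hom_structure_category by auto

lemma Ident_Reg: "Ident (Reg \<kappa>) A = (A, \<lambda>x\<in>carrier A. x, A)"
  by (simp add: Reg_def)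

lemma Comp_Reg:
  assumes "\<phi> \<in> Hom (Reg \<kappa>) A B" "\<psi> \<in> Hom (Reg \<kappa>) B' D"
  shows "\<psi> \<bullet>\<^bsub>Reg \<kappa>\<^esub> \<phi> = (A, compose (carrier A) (arrow_map \<psi>) (arrow_map \<phi>), D)"
proof -
  obtain f g where "\<phi> = (A, f, B)" "\<psi> = (B', g, D)"
    using assms by (auto simp: Hom_Reg)
  then show ?thesis by (simp add: Reg_def)
qed

lemma regular_ring_homI:
  assumes "\<phi> \<in> Hom (Reg \<kappa>) A B"
  shows "regular_ring_hom A B (arrow_map \<phi>)"
  using assms
  by (auto simp: Hom_Reg Obj_Reg intro!: regular_ring_hom.intro regular_ring_hom_axioms.intro
      regular_ring_record.intro)

lemma LL_obj_in_SCML: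
  assumes "R \<in> Obj (Reg \<kappa>)"
  shows "LL_obj R \<in> Obj (SCML \<kappa>)"
proof -
  interpret regular_ring_record R using assms by (simp add: Obj_Reg regular_ring_record_def)
  have "|carrier (LL_obj R)| \<le>o |carrier R|" by (simp add: carrier_LL_obj card_of_image)
  then show ?thesis
    using assms sc_modular_lattice_LL ordLeq_ordLess_trans by (auto simp: Obj_SCML Obj_Reg)
qed

lemma LL_arr_in_SCML:
  assumes "\<phi> \<in> Hom (Reg \<kappa>) A B"
  shows "LL_arr \<phi> \<in> Hom (SCML \<kappa>) (LL_obj A) (LL_obj B)"
    and "LL_arr \<phi> = (LL_obj A, LL_map A (arrow_map \<phi>) B, LL_obj B)"
proof -
  interpret regular_ring_hom A B "arrow_map \<phi>" using assms by (rule regular_ring_homI)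
  have "\<phi> = (A, arrow_map \<phi>, B)" using assms by (simp add: Hom_Reg)
  then show eq: "LL_arr \<phi> = (LL_obj A, LL_map A (arrow_map \<phi>) B, LL_obj B)" using LL_arr_eq by metis
  have "A \<in> Obj (Reg \<kappa>)" "B \<in> Obj (Reg \<kappa>)" using assms by (simp_all add: Hom_Reg)
  then show "LL_arr \<phi> \<in> Hom (SCML \<kappa>) (LL_obj A) (LL_obj B)"
    unfolding eq Hom_SCML using LL_map_hom LL_map_extensional LL_obj_in_SCML by auto
qed

text \<open>Both functor laws are checked on generators, where \<open>LL_map\<close> amounts to
  applying the ring map.\<close>

lemma is_functor_LL:
  assumes "category (Reg \<kappa>)"
  shows "is_functor (Reg \<kappa>) (SCML \<kappa>) LL"
  unfolding is_functor_def LL_def funct.simps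
proof (intro conjI ballI impI category_SCML assms LL_obj_in_SCML)
  interpret C: category "Reg \<kappa>" by (rule assms)
  fix \<phi> assume \<phi>: "\<phi> \<in> Arr (Reg \<kappa>)"
  define A where "A = Dom (Reg \<kappa>) \<phi>"
  define B where "B = Cod (Reg \<kappa>) \<phi>"
  have \<phi>H: "\<phi> \<in> Hom (Reg \<kappa>) A B" using \<phi> by (simp add: Hom_def A_def B_def)
  then show "LL_arr \<phi> \<in> Hom (SCML \<kappa>) (LL_obj (Dom (Reg \<kappa>) \<phi>)) (LL_obj (Cod (Reg \<kappa>) \<phi>))"
    using LL_arr_in_SCML(1) by (simp add: A_def B_def)
  fix \<psi> assume \<psi>: "\<psi> \<in> Arr (Reg \<kappa>)" and comp: "Cod (Reg \<kappa>) \<phi> = Dom (Reg \<kappa>) \<psi>"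
  define D where "D = Cod (Reg \<kappa>) \<psi>"
  have \<psi>H: "\<psi> \<in> Hom (Reg \<kappa>) B D" using \<psi> comp by (simp add: Hom_def B_def D_def)
  have \<chi>H: "\<psi> \<bullet>\<^bsub>Reg \<kappa>\<^esub> \<phi> \<in> Hom (Reg \<kappa>) A D" by (rule C.Comp_in[OF \<phi>H \<psi>H])
  have \<chi>: "arrow_map (\<psi> \<bullet>\<^bsub>Reg \<kappa>\<^esub> \<phi>) = compose (carrier A) (arrow_map \<psi>) (arrow_map \<phi>)"
    by (simp add: Comp_Reg[OF \<phi>H \<psi>H])
  interpret f: regular_ring_hom A B "arrow_map \<phi>" using \<phi>H by (rule regular_ring_homI)
  interpret g: regular_ring_hom B D "arrow_map \<psi>" using \<psi>H by (rule regular_ring_homI)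
  interpret h: regular_ring_hom A D "arrow_map (\<psi> \<bullet>\<^bsub>Reg \<kappa>\<^esub> \<phi>)" using \<chi>H by (rule regular_ring_homI)
  have "LL_map A (arrow_map (\<psi> \<bullet>\<^bsub>Reg \<kappa>\<^esub> \<phi>)) D =
    compose (carrier (LL_obj A)) (LL_map B (arrow_map \<psi>) D) (LL_map A (arrow_map \<phi>) B)"
  proof (rule extensionalityI[OF h.LL_map_extensional compose_extensional])
    fix I assume I: "I \<in> carrier (LL_obj A)"
    then obtain x where x: "x \<in> carrier A" "I = principal_right_ideal A x" by (rule f.R.LL_E)
    have "arrow_map (\<psi> \<bullet>\<^bsub>Reg \<kappa>\<^esub> \<phi>) x = arrow_map \<psi> (arrow_map \<phi> x)"
      using x(1) by (simp add: \<chi> compose_eq)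
    then show "LL_map A (arrow_map (\<psi> \<bullet>\<^bsub>Reg \<kappa>\<^esub> \<phi>)) D I =
      compose (carrier (LL_obj A)) (LL_map B (arrow_map \<psi>) D) (LL_map A (arrow_map \<phi>) B) I"
      using I x f.f_closed[OF x(1)]
      by (simp add: compose_eq f.LL_map_principal_right_ideal g.LL_map_principal_right_ideal
          h.LL_map_principal_right_ideal)
  qed
  then show "LL_arr (\<psi> \<bullet>\<^bsub>Reg \<kappa>\<^esub> \<phi>) = LL_arr \<psi> \<bullet>\<^bsub>SCML \<kappa>\<^esub> LL_arr \<phi>"
    using Comp_SCML[OF LL_arr_in_SCML(1)[OF \<phi>H] LL_arr_in_SCML(1)[OF \<psi>H]]
    by (simp add: LL_arr_in_SCML(2)[OF \<phi>H] LL_arr_in_SCML(2)[OF \<psi>H] LL_arr_in_SCML(2)[OF \<chi>H])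
next
  interpret C: category "Reg \<kappa>" by (rule assms)
  fix A assume A: "A \<in> Obj (Reg \<kappa>)"
  have iH: "Ident (Reg \<kappa>) A \<in> Hom (Reg \<kappa>) A A" by (rule C.Ident_in[OF A])
  interpret f: regular_ring_hom A A "arrow_map (Ident (Reg \<kappa>) A)" using iH by (rule regular_ring_homI)
  have "LL_map A (arrow_map (Ident (Reg \<kappa>) A)) A = (\<lambda>I\<in>carrier (LL_obj A). I)"
  proof (rule extensionalityI[OF f.LL_map_extensional restrict_extensional])
    fix I assume I: "I \<in> carrier (LL_obj A)"
    then obtain x where x: "x \<in> carrier A" "I = principal_right_ideal A x" by (rule f.R.LL_E)
    then show "LL_map A (arrow_map (Ident (Reg \<kappa>) A)) A I = (\<lambda>I\<in>carrier (LL_obj A). I) I"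
      using I f.LL_map_principal_right_ideal[OF x(1)] by (simp add: Ident_Reg)
  qed
  then show "LL_arr (Ident (Reg \<kappa>) A) = Ident (SCML \<kappa>) (LL_obj A)"
    by (simp add: LL_arr_in_SCML(2)[OF iH] Ident_SCML)
qed

lemma is_functor_full_subcategory:
  assumes "full_subcategory D C" "is_functor C E F"
  shows "is_functor D E F"
proof -
  note D = full_subcategoryD[OF assms(1)]
  \<comment> \<open>Subcategories are compared through their hom-sets, so agreement of the functions
    \<open>Dom\<close> and \<open>Cod\<close> has to be read off from membership in
    \<open>Hom\<close>.\<close>
  have arr: "f \<in> Arr C \<and> Dom C f = Dom D f \<and> Cod C f = Cod D f" if "f \<in> Arr D" for f
  proof -
    have "f \<in> Hom D (Dom D f) (Cod D f)" using that by (simp add: Hom_def)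
    then have "f \<in> Hom C (Dom D f) (Cod D f)"
      using D(4) category.Dom_in[OF D(1) that] category.Cod_in[OF D(1) that] by blast
    then show ?thesis by (simp add: Hom_def)
  qed
  have comp: "g \<bullet>\<^bsub>D\<^esub> f = g \<bullet>\<^bsub>C\<^esub> f" if "f \<in> Arr D" "g \<in> Arr D" "Cod D f = Dom D g" for f g
    using D(6)[of f "Dom D f" "Cod D f" g "Cod D g"] that by (simp add: Hom_def)
  have F: "FArr F f \<in> Hom E (FObj F (Dom C f)) (FObj F (Cod C f))" if "f \<in> Arr C" for f
    using assms(2) that by (simp add: is_functor_def)
  have "FArr F f \<in> Hom E (FObj F (Dom D f)) (FObj F (Cod D f))" if "f \<in> Arr D" for f
    using F[of f] arr[OF that] by simp
  then show ?thesis
    using assms(2) D(1) subsetD[OF D(3)] arr comp D(5) unfolding is_functor_def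
    by simp
qed

section \<open>The two conditions of a right larder\<close>

lemma LL_weakly_presented:
  fixes \<kappa> :: "'u rel" and R :: "'u ring"
  assumes \<kappa>: "\<kappa> = |UNIV :: 'u set|" "natLeq <o \<kappa>" "regularCard \<kappa>"
    and lam: "Cinfinite lam"
    and R: "R \<in> Obj (Reg \<kappa>)" "|carrier R| <o lam"
  shows "weakly_presented \<kappa> lam (SCML \<kappa>) (LL_obj R)"
proof (rule weakly_presented_SCML[OF \<kappa> lam LL_obj_in_SCML[OF R(1)]])
  have "|carrier (LL_obj R)| \<le>o |carrier R|" unfolding LL_obj_def by (simp add: card_of_image)
  then show "|carrier (LL_obj R)| <o lam" using R(2) by (rule ordLeq_ordLess_trans)
qed

lemma LL_larder_extension:
  fixes \<R> :: "('u ring, 'u ring_arrow) category" and lam :: "'l rel"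
  assumes lam: "Cinfinite lam"
    and full: "full_subcategory \<R> (Reg \<kappa>)"
    and small_subrings:
      "\<And>R X. \<lbrakk>R \<in> Obj \<R>; X \<subseteq> carrier R; |X| <o lam\<rbrakk>
         \<Longrightarrow> \<exists>S\<in>Obj \<R>. X \<subseteq> carrier S \<and> is_subrng S R \<and> |carrier S| <o lam"
    and B: "B \<in> Obj \<R>" and S: "|carrier S| <o lam"
    and \<psi>: "\<psi> \<in> Hom (SCML_surj \<kappa>) (LL_obj B) S"
    and I: "|I| <o cofinality lam"
    and C: "\<And>i. i \<in> I \<Longrightarrow> C i \<in> Obj \<R>" "\<And>i. i \<in> I \<Longrightarrow> |carrier (C i)| <o lam"
      "\<And>i. i \<in> I \<Longrightarrow> \<gamma> i \<in> Hom \<R> (C i) B"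
  shows "\<exists>T\<in>Obj \<R>. |carrier T| <o lam \<and> (\<exists>\<iota>\<in>Hom \<R> T B. monomorphism \<R> \<iota>
    \<and> (\<forall>i\<in>I. \<exists>\<delta>\<in>Hom \<R> (C i) T. \<gamma> i = \<iota> \<bullet>\<^bsub>\<R>\<^esub> \<delta>)
    \<and> \<psi> \<bullet>\<^bsub>SCML \<kappa>\<^esub> LL_arr \<iota> \<in> Arr (SCML_surj \<kappa>))"
proof -
  note D = full_subcategoryD[OF full]
  have BR: "B \<in> Obj (Reg \<kappa>)" using B D(3) by blast
  interpret B: regular_ring_record B using BR by (simp add: Obj_Reg regular_ring_record_def)
  have \<psi>H: "\<psi> \<in> Hom (SCML \<kappa>) (LL_obj B) S" and \<psi>surj: "arrow_map \<psi> ` carrier (LL_obj B) = carrier S"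
    using \<psi> by (simp_all add: Hom_SCML_surj)
  have "\<exists>x\<in>carrier B. arrow_map \<psi> (principal_right_ideal B x) = s" if s: "s \<in> carrier S" for s
  proof -
    have "s \<in> arrow_map \<psi> ` carrier (LL_obj B)" using s \<psi>surj by simp
    then obtain J where J: "J \<in> carrier (LL_obj B)" "arrow_map \<psi> J = s" by blast
    obtain x where "x \<in> carrier B" "J = principal_right_ideal B x" by (rule B.LL_E[OF J(1)])
    then show ?thesis using J(2) by blast
  qed
  \<comment> \<open>\<open>t s\<close> generates a preimage of \<open>s\<close>; its presence in the
    subring will make the restricted map surjective.\<close>
  then obtain t where t: "\<And>s. s \<in> carrier S \<Longrightarrow> t s \<in> carrier B"
    "\<And>s. s \<in> carrier S \<Longrightarrow> arrow_map \<psi> (principal_right_ideal B (t s)) = s" by metis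
  have \<gamma>H: "\<gamma> i \<in> Hom (Reg \<kappa>) (C i) B" if "i \<in> I" for i
    using C(3)[OF that] D(4)[OF C(1)[OF that] B] by simp
  have \<gamma>: "arrow_map (\<gamma> i) \<in> rng_hom (C i) B" if "i \<in> I" for i
    using \<gamma>H[OF that] by (simp add: Hom_Reg)
  define X where "X = (\<Union>i\<in>I. arrow_map (\<gamma> i) ` carrier (C i)) \<union> t ` carrier S"
  have "X \<subseteq> carrier B" using t(1) rng_homD(1)[OF \<gamma>] by (auto simp: X_def)
  moreover have "|X| <o lam"
  proof -
    \<comment> \<open>Here the sets united are \<open>lam\<close>-small but possibly infinite, so
      the bound on \<open>I\<close> by the cofinality is essential when \<open>lam\<close> is
      singular.\<close>
    have "|\<Union>i\<in>I. arrow_map (\<gamma> i) ` carrier (C i)| <o lam"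
      by (rule card_of_UNION_ordLess_cofinality[OF lam I]) (rule ordLeq_ordLess_trans[OF card_of_image C(2)])
    moreover have "|t ` carrier S| <o lam" by (rule ordLeq_ordLess_trans[OF card_of_image S])
    ultimately show ?thesis
      unfolding X_def
      by (intro card_of_Un_ordLess_infinite_Field) (use lam in \<open>simp_all add: cinfinite_def\<close>)
  qed
  ultimately obtain T where T: "T \<in> Obj \<R>" "X \<subseteq> carrier T" "is_subrng T B" "|carrier T| <o lam"
    using small_subrings[OF B] by blast
  have TR: "T \<in> Obj (Reg \<kappa>)" using T(1) D(3) by blast
  interpret T: regular_ring_record T using TR by (simp add: Obj_Reg regular_ring_record_def)
  have sub: "carrier T \<subseteq> carrier B"
    and ops: "\<And>x y. \<lbrakk>x \<in> carrier T; y \<in> carrier T\<rbrakk> \<Longrightarrow> x \<oplus>\<^bsub>T\<^esub> y = x \<oplus>\<^bsub>B\<^esub> y"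
      "\<And>x y. \<lbrakk>x \<in> carrier T; y \<in> carrier T\<rbrakk> \<Longrightarrow> x \<otimes>\<^bsub>T\<^esub> y = x \<otimes>\<^bsub>B\<^esub> y"
    using T(3) by (auto simp: is_subrng_def)
  have closed: "x \<oplus>\<^bsub>B\<^esub> y \<in> carrier T" "x \<otimes>\<^bsub>B\<^esub> y \<in> carrier T" if "x \<in> carrier T" "y \<in> carrier T" for x y
    using T.a_closed[OF that] T.mult_closed[OF that] ops[OF that] by simp_all
  define \<iota> where "\<iota> = (T, \<lambda>x\<in>carrier T. x, B)"
  have \<iota>H: "\<iota> \<in> Hom (Reg \<kappa>) T B"
    using sub ops closed TR BR by (auto simp: Hom_Reg \<iota>_def rng_hom_def)
  then have \<iota>R: "\<iota> \<in> Hom \<R> T B" using D(4)[OF T(1) B] by simp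
  interpret \<iota>: regular_ring_hom T B "arrow_map \<iota>" by (rule regular_ring_homI[OF \<iota>H])
  have "monomorphism \<R> \<iota>"
    unfolding monomorphism_def
  proof (intro conjI ballI impI)
    show "\<iota> \<in> Arr \<R>" using \<iota>R by (simp add: Hom_def)
    fix Y g h assume Y: "Y \<in> Obj \<R>" and "g \<in> Hom \<R> Y (Dom \<R> \<iota>)" "h \<in> Hom \<R> Y (Dom \<R> \<iota>)"
      and eq: "\<iota> \<bullet>\<^bsub>\<R>\<^esub> g = \<iota> \<bullet>\<^bsub>\<R>\<^esub> h"
    then have gh: "g \<in> Hom \<R> Y T" "h \<in> Hom \<R> Y T" using \<iota>R by (auto simp: Hom_def)
    then have ghR: "g \<in> Hom (Reg \<kappa>) Y T" "h \<in> Hom (Reg \<kappa>) Y T" using D(4)[OF Y T(1)] by simp_all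
    then have hom: "arrow_map g \<in> rng_hom Y T" "arrow_map h \<in> rng_hom Y T"
      "arrow_map g \<in> extensional (carrier Y)" "arrow_map h \<in> extensional (carrier Y)"
      "g = (Y, arrow_map g, T)" "h = (Y, arrow_map h, T)"
      by (simp_all add: Hom_Reg)
    have "compose (carrier Y) (arrow_map \<iota>) (arrow_map g) = compose (carrier Y) (arrow_map \<iota>) (arrow_map h)"
      using eq D(6)[OF gh(1) \<iota>R] D(6)[OF gh(2) \<iota>R] Comp_Reg[OF ghR(1) \<iota>H] Comp_Reg[OF ghR(2) \<iota>H] by simp
    note * = fun_cong[OF this]
    have "arrow_map g = arrow_map h"
    proof (rule extensionalityI[OF hom(3,4)])
      fix y assume y: "y \<in> carrier Y"
      show "arrow_map g y = arrow_map h y"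
        using *[of y] y rng_homD(1)[OF hom(1) y] rng_homD(1)[OF hom(2) y] by (simp add: compose_eq \<iota>_def)
    qed
    then show "g = h" using hom(5,6) by simp
  qed
  moreover have "\<exists>\<delta>\<in>Hom \<R> (C i) T. \<gamma> i = \<iota> \<bullet>\<^bsub>\<R>\<^esub> \<delta>" if i: "i \<in> I" for i
  proof
    \<comment> \<open>The same map with a smaller codomain, legitimate because \<open>X\<close>
      contains its range.\<close>
    define \<delta> where "\<delta> = (C i, arrow_map (\<gamma> i), T)"
    have mem: "arrow_map (\<gamma> i) x \<in> carrier T" if "x \<in> carrier (C i)" for x
      using T(2) i that unfolding X_def by blast
    have hom: "arrow_map (\<gamma> i) \<in> rng_hom (C i) T"
      using rng_homD[OF \<gamma>[OF i]] mem ops unfolding rng_hom_def by auto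
    have \<delta>H: "\<delta> \<in> Hom (Reg \<kappa>) (C i) T"
      using \<gamma>H[OF i] hom TR by (simp add: Hom_Reg \<delta>_def)
    then show \<delta>R: "\<delta> \<in> Hom \<R> (C i) T" using D(4)[OF C(1)[OF i] T(1)] by simp
    have "compose (carrier (C i)) (arrow_map \<iota>) (arrow_map \<delta>) = arrow_map (\<gamma> i)"
      using mem \<gamma>H[OF i]
      by (intro extensionalityI[of _ "carrier (C i)"]) (simp_all add: compose_eq \<iota>_def \<delta>_def Hom_Reg)
    moreover have "\<gamma> i = (C i, arrow_map (\<gamma> i), B)" using \<gamma>H[OF i] by (simp add: Hom_Reg)
    ultimately show "\<gamma> i = \<iota> \<bullet>\<^bsub>\<R>\<^esub> \<delta>"
      using D(6)[OF \<delta>R \<iota>R] Comp_Reg[OF \<delta>H \<iota>H] by simp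
  qed
  moreover have "\<psi> \<bullet>\<^bsub>SCML \<kappa>\<^esub> LL_arr \<iota> \<in> Arr (SCML_surj \<kappa>)"
  proof -
    note L\<iota> = LL_arr_in_SCML[OF \<iota>H]
    have H: "\<psi> \<bullet>\<^bsub>SCML \<kappa>\<^esub> LL_arr \<iota> \<in> Hom (SCML \<kappa>) (LL_obj T) S"
      by (rule category.Comp_in[OF category_SCML L\<iota>(1) \<psi>H])
    have map: "arrow_map (\<psi> \<bullet>\<^bsub>SCML \<kappa>\<^esub> LL_arr \<iota>) =
        compose (carrier (LL_obj T)) (arrow_map \<psi>) (LL_map T (arrow_map \<iota>) B)"
      using Comp_SCML[OF L\<iota>(1) \<psi>H] L\<iota>(2) by simp
    have le1: "carrier S \<subseteq> arrow_map (\<psi> \<bullet>\<^bsub>SCML \<kappa>\<^esub> LL_arr \<iota>) ` carrier (LL_obj T)"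
    proof
      fix s assume s: "s \<in> carrier S"
      then have tsT: "t s \<in> carrier T" using T(2) by (auto simp: X_def)
      then have "arrow_map \<iota> (t s) = t s" by (simp add: \<iota>_def)
      \<comment> \<open>The inclusion takes the right ideal of \<open>t s\<close> in
        \<open>T\<close> to the one in \<open>B\<close>, where \<open>\<psi>\<close> has the value
        \<open>s\<close>.\<close>
      then have "arrow_map (\<psi> \<bullet>\<^bsub>SCML \<kappa>\<^esub> LL_arr \<iota>) (principal_right_ideal T (t s)) = s"
        using t(2)[OF s] T.LL_I[OF tsT] \<iota>.LL_map_principal_right_ideal[OF tsT]
        by (simp add: map compose_eq)
      then show "s \<in> arrow_map (\<psi> \<bullet>\<^bsub>SCML \<kappa>\<^esub> LL_arr \<iota>) ` carrier (LL_obj T)"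
        using T.LL_I[OF tsT] by blast
    qed
    have "arrow_map (\<psi> \<bullet>\<^bsub>SCML \<kappa>\<^esub> LL_arr \<iota>) \<in> zero_lattice_hom (LL_obj T) S"
      using H unfolding Hom_SCML by (elim conjE)
    then have le2: "arrow_map (\<psi> \<bullet>\<^bsub>SCML \<kappa>\<^esub> LL_arr \<iota>) ` carrier (LL_obj T) \<subseteq> carrier S"
      by (rule image_subsetI[OF zero_lattice_homD(1)])
    have "\<psi> \<bullet>\<^bsub>SCML \<kappa>\<^esub> LL_arr \<iota> \<in> Hom (SCML_surj \<kappa>) (LL_obj T) S"
      unfolding Hom_SCML_surj by (rule conjI[OF H subset_antisym[OF le2 le1]])
    then show ?thesis by (simp add: Hom_def)
  qed
  ultimately show ?thesis using T(1,4) \<iota>R by blast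
qed

section \<open>Projectability\<close>

lemma LL_projectable:
  fixes \<R> :: "('u ring, 'u ring_arrow) category"
  assumes full: "full_subcategory \<R> (Reg \<kappa>)"
    and images: "closed_under_homomorphic_images \<R>"
    and C: "C \<in> Obj \<R>"
    and \<phi>: "\<phi> \<in> Hom (SCML_surj \<kappa>) (LL_obj C) S"
  shows "\<exists>a \<epsilon>. projectability_witness \<R> (SCML \<kappa>) LL C S \<phi> a \<epsilon>"
proof -
  note D = full_subcategoryD[OF full]
  have CR: "C \<in> Obj (Reg \<kappa>)" using C D(3) by blast
  interpret C: regular_ring_record C using CR by (simp add: Obj_Reg regular_ring_record_def)
  define \<phi>m where "\<phi>m = arrow_map \<phi>"
  have \<phi>H: "\<phi> \<in> Hom (SCML \<kappa>) (LL_obj C) S" and \<phi>surj: "\<phi>m ` carrier (LL_obj C) = carrier S"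
    using \<phi> by (simp_all add: Hom_SCML_surj \<phi>m_def)
  then have SS: "S \<in> Obj (SCML \<kappa>)" and \<phi>hom: "\<phi>m \<in> zero_lattice_hom (LL_obj C) S"
    and \<phi>ext: "\<phi>m \<in> extensional (carrier (LL_obj C))" and \<phi>eq: "\<phi> = (LL_obj C, \<phi>m, S)"
    by (simp_all add: Hom_SCML \<phi>m_def)
  interpret S: sc_modular_lattice S using SS by (simp add: Obj_SCML)
  interpret K: LL_hom C S \<phi>m
    by (intro LL_hom.intro LL_hom_axioms.intro \<phi>hom C.regular_ring_record_axioms S.sc_modular_lattice_axioms)
  obtain Q :: "'u ring" and \<pi> where Q: "rng Q" and \<pi>: "\<pi> \<in> rng_hom C Q" "\<pi> \<in> extensional (carrier C)"
    "\<pi> ` carrier C = carrier Q"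
    and \<pi>_eq: "\<And>x y. \<lbrakk>x \<in> carrier C; y \<in> carrier C\<rbrakk> \<Longrightarrow> \<pi> x = \<pi> y \<longleftrightarrow> x \<ominus>\<^bsub>C\<^esub> y \<in> K.kernel_ideal"
  proof (rule C.quotient_exists)
    show "K.kernel_ideal \<subseteq> carrier C" by (auto simp: K.kernel_ideal_def)
    show "\<zero>\<^bsub>C\<^esub> \<in> K.kernel_ideal" by (rule K.kernel_ideal_zero)
    show "a \<ominus>\<^bsub>C\<^esub> b \<in> K.kernel_ideal" if "a \<in> K.kernel_ideal" "b \<in> K.kernel_ideal" for a b
      using that by (rule K.kernel_ideal_diff)
    show "a \<otimes>\<^bsub>C\<^esub> r \<in> K.kernel_ideal" if "a \<in> K.kernel_ideal" "r \<in> carrier C" for a r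
      using that by (intro K.kernel_ideal_mem[OF that(1)] C.principal_right_idealI) auto
    show "r \<otimes>\<^bsub>C\<^esub> a \<in> K.kernel_ideal" if "a \<in> K.kernel_ideal" "r \<in> carrier C" for a r
      using that by (rule K.kernel_ideal_left_mult)
  qed blast
  \<comment> \<open>Regularity of \<open>Q\<close> is obtained indirectly: closure under images
    places \<open>Q\<close> in \<open>\<R>\<close>, all of whose objects are regular rings.\<close>
  have QO: "Q \<in> Obj \<R>"
    using images C \<pi>(1,3) Q unfolding closed_under_homomorphic_images_def by blast
  then have QR: "Q \<in> Obj (Reg \<kappa>)" using D(3) by blast
  interpret Q: regular_ring_record Q using QR by (simp add: Obj_Reg regular_ring_record_def)
  define a where "a = (C, \<pi>, Q)"
  have aH: "a \<in> Hom (Reg \<kappa>) C Q" using CR QR \<pi> by (simp add: Hom_Reg a_def)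
  then have aR: "a \<in> Hom \<R> C Q" using D(4)[OF C QO] by simp
  interpret a: regular_ring_hom C Q \<pi> using regular_ring_homI[OF aH] by (simp add: a_def)
  note La = LL_arr_in_SCML[OF aH]
  define p where "p = LL_map C \<pi> Q"
  have La_eq: "LL_arr a = (LL_obj C, p, LL_obj Q)" using La(2) by (simp add: a_def p_def)
  have p: "p \<in> zero_lattice_hom (LL_obj C) (LL_obj Q)" "p ` carrier (LL_obj C) = carrier (LL_obj Q)"
    using a.LL_map_hom a.LL_map_surj[OF \<pi>(3)] by (simp_all add: p_def)
  \<comment> \<open>Surjectivity of \<open>\<pi>\<close> lifts the coefficient in
    \<open>\<pi> x = \<pi> y \<otimes> \<pi> r\<close> to \<open>C\<close>, and the condition
    becomes the one in \<open>\<phi>_le_iff\<close>.\<close>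
  have le: "\<phi>m (principal_right_ideal C x) \<sqsubseteq>\<^bsub>S\<^esub> \<phi>m (principal_right_ideal C y) \<longleftrightarrow>
      principal_right_ideal Q (\<pi> x) \<subseteq> principal_right_ideal Q (\<pi> y)"
    if xy: "x \<in> carrier C" "y \<in> carrier C" for x y
  proof -
    have "principal_right_ideal Q (\<pi> x) \<subseteq> principal_right_ideal Q (\<pi> y) \<longleftrightarrow> \<pi> x \<in> principal_right_ideal Q (\<pi> y)"
      using Q.principal_right_ideal_subset_iff a.f_closed xy by simp
    also have "\<dots> \<longleftrightarrow> (\<exists>r\<in>carrier C. \<pi> x = \<pi> y \<otimes>\<^bsub>Q\<^esub> \<pi> r)"
      unfolding principal_right_ideal_def \<pi>(3)[symmetric] by blast
    also have "\<dots> \<longleftrightarrow> (\<exists>r\<in>carrier C. \<pi> x = \<pi> (y \<otimes>\<^bsub>C\<^esub> r))"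
      using a.f_mult[OF xy(2)] by simp
    also have "\<dots> \<longleftrightarrow> (\<exists>r\<in>carrier C. x \<ominus>\<^bsub>C\<^esub> y \<otimes>\<^bsub>C\<^esub> r \<in> K.kernel_ideal)"
      using \<pi>_eq[OF xy(1) C.mult_closed[OF xy(2)]] by simp
    finally show ?thesis using K.\<phi>_le_iff[OF xy] by simp
  qed
  have same_kernel: "\<phi>m I = \<phi>m J \<longleftrightarrow> p I = p J"
    if IJ: "I \<in> carrier (LL_obj C)" "J \<in> carrier (LL_obj C)" for I J
  proof -
    obtain x where x: "x \<in> carrier C" "I = principal_right_ideal C x" by (rule C.LL_E[OF IJ(1)])
    obtain y where y: "y \<in> carrier C" "J = principal_right_ideal C y" by (rule C.LL_E[OF IJ(2)])
    have "\<phi>m I = \<phi>m J \<longleftrightarrow> \<phi>m I \<sqsubseteq>\<^bsub>S\<^esub> \<phi>m J \<and> \<phi>m J \<sqsubseteq>\<^bsub>S\<^esub> \<phi>m I"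
      using S.le_antisym S.le_refl zero_lattice_homD(1)[OF \<phi>hom] IJ by metis
    also have "\<dots> \<longleftrightarrow> p I = p J"
      using le[OF x(1) y(1)] le[OF y(1) x(1)] x y by (auto simp: p_def a.LL_map_principal_right_ideal)
    finally show ?thesis .
  qed
  obtain e where e: "e \<in> zero_lattice_hom (LL_obj Q) S" "e \<in> extensional (carrier (LL_obj Q))"
    "\<And>I. I \<in> carrier (LL_obj C) \<Longrightarrow> e (p I) = \<phi>m I"
    using zero_lattice_hom_factor[OF C.lattice_LL C.bottom_LL(1) p \<phi>hom] same_kernel by blast
  obtain e' where e': "e' \<in> zero_lattice_hom S (LL_obj Q)" "e' \<in> extensional (carrier S)"
    "\<And>I. I \<in> carrier (LL_obj C) \<Longrightarrow> e' (\<phi>m I) = p I"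
    using zero_lattice_hom_factor[OF C.lattice_LL C.bottom_LL(1) \<phi>hom \<phi>surj p(1)] same_kernel by blast
  define \<epsilon> where "\<epsilon> = (LL_obj Q, e, S)"
  define \<epsilon>' where "\<epsilon>' = (S, e', LL_obj Q)"
  have LQ: "LL_obj Q \<in> Obj (SCML \<kappa>)" by (rule LL_obj_in_SCML[OF QR])
  have \<epsilon>H: "\<epsilon> \<in> Hom (SCML \<kappa>) (LL_obj Q) S" using e LQ SS by (simp add: Hom_SCML \<epsilon>_def)
  have \<epsilon>'H: "\<epsilon>' \<in> Hom (SCML \<kappa>) S (LL_obj Q)" using e' LQ SS by (simp add: Hom_SCML \<epsilon>'_def)
  have e'e: "e' (e J) = J" if J: "J \<in> carrier (LL_obj Q)" for J
  proof -
    obtain I where "I \<in> carrier (LL_obj C)" "J = p I" using J p(2) by blast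
    then show ?thesis using e(3) e'(3) by simp
  qed
  have ee': "e (e' s) = s" if s: "s \<in> carrier S" for s
  proof -
    obtain I where "I \<in> carrier (LL_obj C)" "s = \<phi>m I" using s \<phi>surj by blast
    then show ?thesis using e(3) e'(3) by simp
  qed
  have iso: "isomorphism (SCML \<kappa>) \<epsilon>"
  proof -
    have "\<epsilon>' \<bullet>\<^bsub>SCML \<kappa>\<^esub> \<epsilon> = Ident (SCML \<kappa>) (LL_obj Q)"
      using Comp_SCML[OF \<epsilon>H \<epsilon>'H] e'e by (simp add: Ident_SCML \<epsilon>_def \<epsilon>'_def compose_def restrict_def fun_eq_iff)
    moreover have "\<epsilon> \<bullet>\<^bsub>SCML \<kappa>\<^esub> \<epsilon>' = Ident (SCML \<kappa>) S"
      using Comp_SCML[OF \<epsilon>'H \<epsilon>H] ee' by (simp add: Ident_SCML \<epsilon>_def \<epsilon>'_def compose_def restrict_def fun_eq_iff)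
    moreover have "\<epsilon> \<in> Arr (SCML \<kappa>)" "Dom (SCML \<kappa>) \<epsilon> = LL_obj Q" "Cod (SCML \<kappa>) \<epsilon> = S"
      using \<epsilon>H by (simp_all add: Hom_def)
    ultimately show ?thesis unfolding isomorphism_def using \<epsilon>'H by auto
  qed
  have epi: "epimorphism \<R> a"
    unfolding epimorphism_def
  proof (intro conjI ballI impI)
    show "a \<in> Arr \<R>" using aR by (simp add: Hom_def)
    fix Y g h assume Y: "Y \<in> Obj \<R>" and "g \<in> Hom \<R> (Cod \<R> a) Y" "h \<in> Hom \<R> (Cod \<R> a) Y"
      and eq: "g \<bullet>\<^bsub>\<R>\<^esub> a = h \<bullet>\<^bsub>\<R>\<^esub> a"
    then have gh: "g \<in> Hom \<R> Q Y" "h \<in> Hom \<R> Q Y" using aR by (auto simp: Hom_def)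
    then have ghR: "g \<in> Hom (Reg \<kappa>) Q Y" "h \<in> Hom (Reg \<kappa>) Q Y" using D(4)[OF QO Y] by simp_all
    then have ext: "arrow_map g \<in> extensional (carrier Q)" "arrow_map h \<in> extensional (carrier Q)"
      "g = (Q, arrow_map g, Y)" "h = (Q, arrow_map h, Y)"
      by (simp_all add: Hom_Reg)
    have "compose (carrier C) (arrow_map g) \<pi> = compose (carrier C) (arrow_map h) \<pi>"
      using eq D(6)[OF aR gh(1)] D(6)[OF aR gh(2)] Comp_Reg[OF aH ghR(1)] Comp_Reg[OF aH ghR(2)]
      by (simp add: a_def)
    note * = fun_cong[OF this]
    have "arrow_map g = arrow_map h"
    proof (rule extensionalityI[OF ext(1,2)])
      fix q assume "q \<in> carrier Q"
      then obtain x where "x \<in> carrier C" "q = \<pi> x" using \<pi>(3) by blast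
      then show "arrow_map g q = arrow_map h q" using *[of x] by (simp add: compose_eq)
    qed
    then show "g = h" using ext(3,4) by simp
  qed
  have \<phi>_factor: "\<phi> = \<epsilon> \<bullet>\<^bsub>SCML \<kappa>\<^esub> LL_arr a"
  proof -
    have "compose (carrier (LL_obj C)) e p = \<phi>m"
      using e(3) \<phi>ext by (intro extensionalityI[of _ "carrier (LL_obj C)"]) (simp_all add: compose_eq)
    then show ?thesis using Comp_SCML[OF La(1) \<epsilon>H] by (simp add: La_eq \<epsilon>_def \<phi>eq)
  qed
  have lift: "\<exists>g\<in>Hom \<R> Q Y. f = g \<bullet>\<^bsub>\<R>\<^esub> a \<and> \<eta> = LL_arr g"
    if Y: "Y \<in> Obj \<R>" and f: "f \<in> Hom \<R> C Y" and \<eta>: "\<eta> \<in> Hom (SCML \<kappa>) (LL_obj Q) (LL_obj Y)"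
      and eq: "LL_arr f = \<eta> \<bullet>\<^bsub>SCML \<kappa>\<^esub> LL_arr a" for Y f \<eta>
  proof -
    have YR: "Y \<in> Obj (Reg \<kappa>)" using Y D(3) by blast
    interpret Y: regular_ring_record Y using YR by (simp add: Obj_Reg regular_ring_record_def)
    have fH: "f \<in> Hom (Reg \<kappa>) C Y" using f D(4)[OF C Y] by simp
    define fm where "fm = arrow_map f"
    have f_eq: "f = (C, fm, Y)" and fm: "fm \<in> rng_hom C Y" "fm \<in> extensional (carrier C)"
      using fH by (simp_all add: Hom_Reg fm_def)
    interpret f: regular_ring_hom C Y fm using regular_ring_homI[OF fH] by (simp add: fm_def)
    define \<eta>m where "\<eta>m = arrow_map \<eta>"
    have \<eta>_eq: "\<eta> = (LL_obj Q, \<eta>m, LL_obj Y)" and \<eta>m: "\<eta>m \<in> zero_lattice_hom (LL_obj Q) (LL_obj Y)"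
      "\<eta>m \<in> extensional (carrier (LL_obj Q))"
      using \<eta> by (simp_all add: Hom_SCML \<eta>m_def)
    have maps: "LL_map C fm Y = compose (carrier (LL_obj C)) \<eta>m p"
      using eq Comp_SCML[OF La(1) \<eta>] LL_arr_in_SCML(2)[OF fH] by (simp add: La_eq fm_def \<eta>m_def)
    have map_at: "principal_right_ideal Y (fm x) = \<eta>m (principal_right_ideal Q (\<pi> x))" if x: "x \<in> carrier C" for x
      using fun_cong[OF maps, of "principal_right_ideal C x"] C.LL_I[OF x]
      by (simp add: compose_eq f.LL_map_principal_right_ideal[OF x] p_def a.LL_map_principal_right_ideal[OF x])
    \<comment> \<open>The difference \<open>u\<close> becomes zero in \<open>Q\<close>, so
      \<open>\<eta>\<close> forces the right ideal of \<open>fm u\<close> in \<open>Y\<close> to be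
      zero; regularity of \<open>Y\<close> puts \<open>fm u\<close> itself into that ideal.\<close>
    have ker: "fm x = fm y" if xy: "x \<in> carrier C" "y \<in> carrier C" "\<pi> x = \<pi> y" for x y
    proof -
      define u where "u = x \<ominus>\<^bsub>C\<^esub> y"
      have u: "u \<in> carrier C" using xy by (simp add: u_def)
      have "\<pi> u = \<zero>\<^bsub>Q\<^esub>"
        using rng_hom_diff[OF C.rng_axioms Q.rng_axioms \<pi>(1) xy(1,2)] xy a.f_closed by (simp add: u_def)
      then have "principal_right_ideal Y (fm u) = \<eta>m \<bottom>\<^bsub>LL_obj Q\<^esub>"
        using map_at[OF u] by (simp add: Q.bottom_LL Q.principal_right_ideal_zero)
      also have "\<dots> = {\<zero>\<^bsub>Y\<^esub>}" using zero_lattice_homD(2)[OF \<eta>m(1)] by (simp add: Y.bottom_LL)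
      finally have "fm u = \<zero>\<^bsub>Y\<^esub>" using Y.self_mem[OF f.f_closed[OF u]] by simp
      then have "fm x \<ominus>\<^bsub>Y\<^esub> fm y = \<zero>\<^bsub>Y\<^esub>"
        using rng_hom_diff[OF C.rng_axioms Y.rng_axioms fm(1) xy(1,2)] by (simp add: u_def)
      then show ?thesis using Y.diff_eq_zero_iff f.f_closed xy by simp
    qed
    define gm where "gm = (\<lambda>q\<in>carrier Q. fm (SOME x. x \<in> carrier C \<and> \<pi> x = q))"
    have gm: "gm (\<pi> x) = fm x" if x: "x \<in> carrier C" for x
    proof -
      have "x \<in> carrier C \<and> \<pi> x = \<pi> x" using x by simp
      then have "(SOME x'. x' \<in> carrier C \<and> \<pi> x' = \<pi> x) \<in> carrier C \<and>
          \<pi> (SOME x'. x' \<in> carrier C \<and> \<pi> x' = \<pi> x) = \<pi> x" by (rule someI)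
      then show ?thesis unfolding gm_def using a.f_closed[OF x] ker[OF _ x] by auto
    qed
    have gm_hom: "gm \<in> rng_hom Q Y"
      unfolding rng_hom_def
    proof (intro CollectI conjI ballI funcsetI)
      fix q assume "q \<in> carrier Q"
      then obtain x where x: "x \<in> carrier C" "q = \<pi> x" using \<pi>(3) by blast
      then show "gm q \<in> carrier Y" using gm f.f_closed by simp
      fix q' assume "q' \<in> carrier Q"
      then obtain x' where x': "x' \<in> carrier C" "q' = \<pi> x'" using \<pi>(3) by blast
      show "gm (q \<oplus>\<^bsub>Q\<^esub> q') = gm q \<oplus>\<^bsub>Y\<^esub> gm q'"
        using gm[OF C.a_closed[OF x(1) x'(1)]] gm[OF x(1)] gm[OF x'(1)] x x'
          a.f_add[OF x(1) x'(1)] f.f_add[OF x(1) x'(1)] by simp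
      show "gm (q \<otimes>\<^bsub>Q\<^esub> q') = gm q \<otimes>\<^bsub>Y\<^esub> gm q'"
        using gm[OF C.mult_closed[OF x(1) x'(1)]] gm[OF x(1)] gm[OF x'(1)] x x'
          a.f_mult[OF x(1) x'(1)] f.f_mult[OF x(1) x'(1)] by simp
    qed
    define g where "g = (Q, gm, Y)"
    have gH: "g \<in> Hom (Reg \<kappa>) Q Y" using gm_hom QR YR by (simp add: Hom_Reg g_def gm_def)
    then have gR: "g \<in> Hom \<R> Q Y" using D(4)[OF QO Y] by simp
    interpret g: regular_ring_hom Q Y gm using regular_ring_homI[OF gH] by (simp add: g_def)
    have "compose (carrier C) gm \<pi> = fm"
      using gm fm(2) by (intro extensionalityI[of _ "carrier C"]) (simp_all add: compose_eq)
    then have "f = g \<bullet>\<^bsub>\<R>\<^esub> a"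
      using D(6)[OF aR gR] Comp_Reg[OF aH gH] by (simp add: f_eq g_def a_def)
    \<comment> \<open>Since \<open>\<pi>\<close> is onto, every member of \<open>LL_obj Q\<close>
      has a generator of the form \<open>\<pi> x\<close>, and there \<open>map_at\<close> determines
      \<open>\<eta>m\<close>.\<close>
    moreover have "\<eta>m = LL_map Q gm Y"
    proof (rule extensionalityI[OF \<eta>m(2) g.LL_map_extensional])
      fix J assume "J \<in> carrier (LL_obj Q)"
      then obtain q where q: "q \<in> carrier Q" "J = principal_right_ideal Q q" by (rule Q.LL_E)
      then obtain x where x: "x \<in> carrier C" "q = \<pi> x" using \<pi>(3) by blast
      show "\<eta>m J = LL_map Q gm Y J"
        using g.LL_map_principal_right_ideal[OF q(1)] gm[OF x(1)] map_at[OF x(1)] q x by simp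
    qed
    then have "\<eta> = LL_arr g" using LL_arr_eq[of Q gm Y] by (simp add: \<eta>_eq g_def)
    ultimately show ?thesis using gR by blast
  qed
  have "projectability_witness \<R> (SCML \<kappa>) LL C S \<phi> a \<epsilon>"
    unfolding projectability_witness_def LL_def funct.simps
    using QO aR epi \<epsilon>H iso \<phi>_factor lift by blast
  then show ?thesis by blast
qed

section \<open>The main theorem\<close>

theorem mainTheorem17:
  fixes \<R> :: "('u ring, 'u ring_arrow) category"
    and lam :: "'l rel"
    and \<kappa> :: "'u rel"
  assumes universe: "\<kappa> = |UNIV :: 'u set|" "natLeq <o \<kappa>" "regularCard \<kappa>"
    and lam: "Cinfinite lam" "lam <o \<kappa>"
    and full: "full_subcategory \<R> (Reg \<kappa>)"
    and colimits: "closed_under_small_directed_colimits \<kappa> (Reg \<kappa>) \<R>"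
    and images: "closed_under_homomorphic_images \<R>"
    and small_subrings:
      "\<And>R X. \<lbrakk>R \<in> Obj \<R>; X \<subseteq> carrier R; |X| <o lam\<rbrakk>
         \<Longrightarrow> \<exists>S\<in>Obj \<R>. X \<subseteq> carrier S \<and> is_subrng S R \<and> |carrier S| <o lam"
  shows "projectable_right_larder \<kappa> lam
           \<R> (small_part lam \<R>)
           (SCML \<kappa>) (small_part lam (SCML \<kappa>))
           (SCML_surj \<kappa>) LL"
proof -
  note D = full_subcategoryD[OF full]
  have "right_larder \<kappa> lam \<R> (small_part lam \<R>) (SCML \<kappa>) (small_part lam (SCML \<kappa>)) (SCML_surj \<kappa>) LL"
    unfolding right_larder_def
  proof (intro conjI ballI allI impI)
    show "full_subcategory (small_part lam \<R>) \<R>"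
      unfolding small_part_def by (rule full_subcategory_full_subcategory_on[OF D(1)])
    show "full_subcategory (small_part lam (SCML \<kappa>)) (SCML \<kappa>)"
      unfolding small_part_def by (rule full_subcategory_full_subcategory_on[OF category_SCML])
    show "subcategory (SCML_surj \<kappa>) (SCML \<kappa>)" by (rule subcategory_SCML_surj)
    show "is_functor \<R> (SCML \<kappa>) LL"
      by (rule is_functor_full_subcategory[OF full is_functor_LL[OF D(2)]])
    show "weakly_presented \<kappa> lam (SCML \<kappa>) (FObj LL C)" if "C \<in> Obj (small_part lam \<R>)" for C
    proof -
      have "C \<in> Obj \<R>" "|carrier C| <o lam" using that by (simp_all add: small_part_def)
      then show ?thesis
        using LL_weakly_presented[OF universe lam(1)] D(3) by (auto simp: LL_def)
    qed
  next
    fix B S \<psi> and I :: "'u set" and Ci \<gamma>i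
    assume B: "B \<in> Obj \<R>" and S: "S \<in> Obj (small_part lam (SCML \<kappa>))"
      and \<psi>: "\<psi> \<in> Hom (SCML_surj \<kappa>) (FObj LL B) S"
      and I: "|I| <o cofinality lam \<and> (\<forall>i\<in>I. Ci i \<in> Obj (small_part lam \<R>) \<and>
        \<gamma>i i \<in> Hom \<R> (Ci i) B \<and> monomorphism \<R> (\<gamma>i i))"
    have "\<exists>T\<in>Obj \<R>. |carrier T| <o lam \<and> (\<exists>\<iota>\<in>Hom \<R> T B. monomorphism \<R> \<iota>
      \<and> (\<forall>i\<in>I. \<exists>\<delta>\<in>Hom \<R> (Ci i) T. \<gamma>i i = \<iota> \<bullet>\<^bsub>\<R>\<^esub> \<delta>)
      \<and> \<psi> \<bullet>\<^bsub>SCML \<kappa>\<^esub> LL_arr \<iota> \<in> Arr (SCML_surj \<kappa>))"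
      by (rule LL_larder_extension[OF lam(1) full small_subrings B])
        (use S \<psi> I in \<open>simp_all add: small_part_def LL_def\<close>)
    then show "\<exists>C\<in>Obj (small_part lam \<R>). \<exists>\<gamma>\<in>Hom \<R> C B. monomorphism \<R> \<gamma> \<and>
        (\<forall>i\<in>I. \<exists>\<delta>\<in>Hom \<R> (Ci i) C. \<gamma>i i = \<gamma> \<bullet>\<^bsub>\<R>\<^esub> \<delta>) \<and>
        \<psi> \<bullet>\<^bsub>SCML \<kappa>\<^esub> FArr LL \<gamma> \<in> Arr (SCML_surj \<kappa>)"
      by (simp add: small_part_def LL_def) blast
  qed
  then show ?thesis
    unfolding projectable_right_larder_def
    using LL_projectable[OF full images] by (simp add: LL_def)
qed

end
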